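(* There exists $\gamma_0>1$ such that for every $c$ with $1<c<\gamma_0$ the Delaunay torus $\mathbb T_{\mathrm D,c}$ (the rotationally symmetric $C^{1,1}$ surface in $\mathbb R^3$ defined in the context) exists and is an embedded torus, and this family satisfies $$\mathcal W(\mathbb T_{\mathrm D,c})<8\pi\qquad\text{whenever } 1<c<\gamma_0$$ and $$\lim_{c\to1+}\operatorname{iso}(\mathbb T_{\mathrm D,c})=\infty .$$
   Context: **Functionals.** For an immersed oriented closed surface $f:\Sigma\to\mathbb R^3$ of class at least $C^{1,1}$, with Gauss map $n:\Sigma\to\mathbb S^2$ and area measure $\mu$ of the pulled-back Euclidean metric, let $H$ be the arithmetic mean of the two principal curvatures (defined $\mu$-almost everywhere) and set $$\mathcal W(f)=\int_\Sigma H^2\,d\mu,\qquad \operatorname{area}(f)=\int_\Sigma 1\,d\mu,\qquad \operatorname{vol}(f)=\frac13\int_\Sigma n\cdot f\,d\mu,$$ $$\operatorname{iso}(f)=\frac{\operatorname{area}(f)}{\operatorname{vol}(f)^{2/3}}\ \text{ if }\operatorname{vol}(f)>0,\qquad \operatorname{iso}(f)=\infty\ \text{ if }\operatorname{vol}(f)\le 0.$$ For the surfaces below the orientation is chosen so that $\operatorname{vol}\ge 0$ (for an embedded surface: $n$ is the outward normal and $\operatorname{vol}$ is the enclosed volume). **Elliptic integrals.** For $0<k<1$, $K(k)=\int_0^{\pi/2}\frac{d\theta}{\sqrt{1-k^2\sin^2\theta}}$ and $E(k)=\int_0^{\pi/2}\sqrt{1-k^2\sin^2\theta}\,d\theta$.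 **Delaunay tori $\mathbb T_{\mathrm D,c}$.** Let $c>1$. Suppose $a>y>0$ solve the system $$4aE\Bigl(\frac ya\Bigr)=4c\Bigl[E\Bigl(\frac1c\Bigr)-\Bigl(1-\frac1{c^2}\Bigr)K\Bigl(\frac1c\Bigr)\Bigr],\qquad a-y=c-1,$$ and let $L$ denote the common value of both sides of the first equation. (For given $c$ there is at most one such solution, since $y\mapsto (y+c-1)E\bigl(\tfrac{y}{y+c-1}\bigr)$ is strictly increasing; we say that $\mathbb T_{\mathrm D,c}$ exists if there is a solution.) Define two plane curves, where the first coordinate is the distance to the axis of rotation and the second is the position along the axis: * *Unduloid arc* (one period): for $0\le t\le2\pi$, $$f_U(t)=\sqrt{a^2-y^2}\,\frac{a-y\cos t}{\sqrt{a^2-y^2\cos^2t}},\qquad g_U(t)=\int_0^t\sqrt{a^2-y^2\cos^2x}\,dx-y\sin t\,\frac{a-y\cos t}{\sqrt{a^2-y^2\cos^2t}}.$$ It runs from $(a-y,0)$ to $(a-y,L)$; its surface of revolution has constant mean curvature of absolute value $\frac1{2a}$. * *Nodoid arc* (one period, translated by $L$): for $0\le s\le2\pi$, $$f_N(s)=\sqrt{c^2-\sin^2s}-\cos s,\qquad g_N(s)=L+\int_0^s\Bigl(\cos x-\frac{\cos^2x}{\sqrt{c^2-\sin^2x}}\Bigr)dx.$$ It runs from $(c-1,L)$ to $(c-1,0)$; its surface of revolution has constant mean curvature of absolute value $\frac12$. The concatenation of the two arcs is a closed $C^{1,1}$-regular curve in the open half plane $\{(f,g)\in\mathbb R^2: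 f>0\}$. $\mathbb T_{\mathrm D,c}$ is the surface of revolution in $\mathbb R^3$ obtained from this profile curve via $(f,g)\mapsto(f\cos\theta,f\sin\theta,g)$, $\theta\in[0,2\pi]$. *)

theory Defs
  imports "HOL-Analysis.Analysis"
begin

text \<open>
  Surfaces of torus type are maps on the universal cover: the closed surface is
  \<open>\<real>\<^sup>2/\<int>\<^sup>2\<close>, and an immersion of it is a map \<open>F\<close> on the plane that has period \<open>1\<close> in each
  variable.  The unit square is a fundamental domain.  The orientation is the one induced from
  the standard orientation of the plane, so \<open>F \<circ> prod.swap\<close> is the same surface with the
  opposite orientation.
\<close>

type_synonym surface = "real \<times> real \<Rightarrow> real ^ 3"

definition surface_normal :: "surface \<Rightarrow> real \<times> real \<Rightarrow> real ^ 3" where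
  "surface_normal F z =
     cross3 (frechet_derivative F (at z) (1, 0)) (frechet_derivative F (at z) (0, 1))"

definition gauss_map :: "surface \<Rightarrow> real \<times> real \<Rightarrow> real ^ 3" where
  "gauss_map F z = surface_normal F z /\<^sub>R norm (surface_normal F z)"

definition area_measure :: "surface \<Rightarrow> (real \<times> real) measure" where
  "area_measure F =
     density (lebesgue_on ({0..1} \<times> {0..1})) (\<lambda>z. ennreal (norm (surface_normal F z)))"

text \<open>
  Principal curvatures are the eigenvalues of the Weingarten map, that is
  \<open>dn(w) = - \<kappa> dF(w)\<close> for a nonzero tangent vector \<open>w\<close>.  For a \<open>C\<^sup>1\<^sup>,\<^sup>1\<close> immersion the Gauss map is
  Lipschitz, so this set is meaningful almost everywhere; it has two elements, or one at an
  umbilic point, where \<open>Min\<close> and \<open>Max\<close> agree.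
\<close>

definition principal_curvatures :: "surface \<Rightarrow> real \<times> real \<Rightarrow> real set" where
  "principal_curvatures F z =
     {\<kappa>. \<exists>w. w \<noteq> 0 \<and>
        frechet_derivative (gauss_map F) (at z) w = - \<kappa> *\<^sub>R frechet_derivative F (at z) w}"

definition mean_curvature :: "surface \<Rightarrow> real \<times> real \<Rightarrow> real" where
  "mean_curvature F z = (Min (principal_curvatures F z) + Max (principal_curvatures F z)) / 2"

definition willmore :: "surface \<Rightarrow> real" where
  "willmore F = (\<integral>z. (mean_curvature F z)\<^sup>2 \<partial>area_measure F)"

definition surface_area :: "surface \<Rightarrow> real" where
  "surface_area F = (\<integral>z. 1 \<partial>area_measure F)"

definition enclosed_vol :: "surface \<Rightarrow> real" where
  "enclosed_vol F = 1 / 3 * (\<integral>z. gauss_map F z \<bullet> F z \<partial>area_measure F)"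

definition iso_ratio :: "surface \<Rightarrow> ereal" where
  "iso_ratio F =
     (if enclosed_vol F > 0 then ereal (surface_area F / enclosed_vol F powr (2 / 3)) else \<infinity>)"

definition doubly_periodic :: "surface \<Rightarrow> bool" where
  "doubly_periodic F \<longleftrightarrow> (\<forall>u v. F (u + 1, v) = F (u, v) \<and> F (u, v + 1) = F (u, v))"

definition C11_immersion :: "surface \<Rightarrow> bool" where
  "C11_immersion F \<longleftrightarrow>
     (\<exists>D :: real \<times> real \<Rightarrow> (real \<times> real) \<Rightarrow>\<^sub>L (real ^ 3).
        (\<forall>z. (F has_derivative blinfun_apply (D z)) (at z) \<and> inj (blinfun_apply (D z))) \<and>
        (\<exists>C. C-lipschitz_on UNIV D))"

text \<open>By compactness of the torus an injective immersion is an embedding.\<close>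

definition embedded_C11_torus :: "surface \<Rightarrow> bool" where
  "embedded_C11_torus F \<longleftrightarrow>
     doubly_periodic F \<and> C11_immersion F \<and>
     (\<forall>z w. F z = F w \<longrightarrow> fst z - fst w \<in> \<int> \<and> snd z - snd w \<in> \<int>)"

definition ellK :: "real \<Rightarrow> real" where
  "ellK k = integral {0..pi / 2} (\<lambda>\<theta>. 1 / sqrt (1 - k\<^sup>2 * (sin \<theta>)\<^sup>2))"

definition ellE :: "real \<Rightarrow> real" where
  "ellE k = integral {0..pi / 2} (\<lambda>\<theta>. sqrt (1 - k\<^sup>2 * (sin \<theta>)\<^sup>2))"

definition delaunay_L :: "real \<Rightarrow> real" where
  "delaunay_L c = 4 * c * (ellE (1 / c) - (1 - 1 / c\<^sup>2) * ellK (1 / c))"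

definition delaunay_system :: "real \<Rightarrow> real \<Rightarrow> real \<Rightarrow> bool" where
  "delaunay_system c a y \<longleftrightarrow>
     a > y \<and> y > 0 \<and> 4 * a * ellE (y / a) = delaunay_L c \<and> a - y = c - 1"

definition delaunay_exists :: "real \<Rightarrow> bool" where
  "delaunay_exists c \<longleftrightarrow> (\<exists>a y. delaunay_system c a y)"

text \<open>
  The system has at most one solution, as \<open>y \<mapsto> (y + c - 1) E(y / (y + c - 1))\<close> is strictly
  increasing.
\<close>

definition delaunay_params :: "real \<Rightarrow> real \<times> real" where
  "delaunay_params c = (SOME (a, y). delaunay_system c a y)"

definition unduloid_arc :: "real \<Rightarrow> real \<Rightarrow> real \<Rightarrow> real \<times> real" where
  "unduloid_arc a y t =
     (sqrt (a\<^sup>2 - y\<^sup>2) * ((a - y * cos t) / sqrt (a\<^sup>2 - y\<^sup>2 * (cos t)\<^sup>2)),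
      integral {0..t} (\<lambda>x. sqrt (a\<^sup>2 - y\<^sup>2 * (cos x)\<^sup>2))
        - y * sin t * ((a - y * cos t) / sqrt (a\<^sup>2 - y\<^sup>2 * (cos t)\<^sup>2)))"

definition nodoid_arc :: "real \<Rightarrow> real \<Rightarrow> real \<times> real" where
  "nodoid_arc c s =
     (sqrt (c\<^sup>2 - (sin s)\<^sup>2) - cos s,
      delaunay_L c + integral {0..s} (\<lambda>x. cos x - (cos x)\<^sup>2 / sqrt (c\<^sup>2 - (sin x)\<^sup>2)))"

definition delaunay_profile :: "real \<Rightarrow> real \<Rightarrow> real \<times> real" where
  "delaunay_profile c =
     (case delaunay_params c of (a, y) \<Rightarrow>
        (\<lambda>x. unduloid_arc a y (2 * pi * x)) +++ (\<lambda>x. nodoid_arc c (2 * pi * x)))"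

definition arc_length :: "(real \<Rightarrow> real \<times> real) \<Rightarrow> real \<Rightarrow> real" where
  "arc_length \<gamma> x = integral {0..x} (\<lambda>t. norm (vector_derivative \<gamma> (at t)))"

text \<open>
  The concatenated parametrization has jumps of speed at the two junctions; the closed curve is
  \<open>C\<^sup>1\<^sup>,\<^sup>1\<close>-regular in its parametrization proportional to arc length, here extended to the line
  with period \<open>1\<close>.
\<close>

definition constant_speed :: "(real \<Rightarrow> real \<times> real) \<Rightarrow> real \<Rightarrow> real \<times> real" where
  "constant_speed \<gamma> u = \<gamma> (inv_into {0..1} (arc_length \<gamma>) (frac u * arc_length \<gamma> 1))"

definition surface_of_revolution :: "(real \<Rightarrow> real \<times> real) \<Rightarrow> surface" where
  "surface_of_revolution \<gamma> =
     (\<lambda>(u, v). vector [fst (\<gamma> u) * cos (2 * pi * v), fst (\<gamma> u) * sin (2 * pi * v), snd (\<gamma> u)])"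

definition choose_orientation :: "surface \<Rightarrow> surface" where
  "choose_orientation F = (if enclosed_vol F \<ge> 0 then F else F \<circ> prod.swap)"

definition delaunay_torus :: "real \<Rightarrow> surface" where
  "delaunay_torus c =
     choose_orientation (surface_of_revolution (constant_speed (delaunay_profile c)))"

end

theory Submission
  imports Defs "HOL-Real_Asymp.Real_Asymp"
begin

text \<open>
  In arc length, both Delaunay arcs are instances of Kenmotsu's family with radius
  \<open>\<bar>a - y exp (i w / a)\<bar>\<close>: the unduloid has parameters \<open>(a, y)\<close>, the nodoid \<open>(-1, -c)\<close>. In these
  coordinates the profile is explicit, it is simple because the nodoid arc stays outside the
  unduloid arc as soon as \<open>a < 1\<close>, and
  \<open>\<W> = (\<pi> / 2) (I (y / a) + I c)\<close> with the convex function
  \<open>I \<rho> = \<integral>\<^sub>0\<^sup>2\<^sup>\<pi> \<bar>1 - \<rho> exp (i v)\<bar> dv\<close>, \<open>I 1 = 8\<close>. The closing condition reads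
  \<open>a I' (a / y) = I' (1 / c)\<close>, so tangent lines of \<open>I\<close> reduce \<open>\<W> < 8 \<pi>\<close> to a comparison of
  values of \<open>1 - I' / 4\<close> just below \<open>1\<close>, where it behaves like \<open>- (\<epsilon> / 2) ln \<epsilon>\<close>. The same logarithm
  makes \<open>1 - a\<close> dominate \<open>c - 1\<close>, hence the volume is positive; it tends to \<open>0\<close> since both arcs converge
  to the same semicircle, while the area tends to \<open>32 \<pi>\<close>.
\<close>

section \<open>Real integrals and Lipschitz functions\<close>

text \<open>With \<open>D = (c - 1) / a\<close>, the two terms of the energy leave their common
  limit \<open>8\<close> by about \<open>- 4 D\<close> and \<open>4 (c - 1)\<close>. These nearly
  cancel, since \<open>a\<close> tends to \<open>1\<close>, so the inequality is decided at the
  order of \<open>- D^2 ln D\<close>. There, up to the factor \<open>4\<close>, the closing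
  condition contributes the gain \<open>D * eta c\<close>, while the loss is \<open>D\<close> times
  the mean slope deficit between \<open>1 - D\<close> and \<open>1\<close>, about half its value at
  \<open>1 - D\<close>. One tangent at \<open>1 - D\<close> would charge the full value and consume
  the whole gain; a second tangent at the midpoint lowers the charge to three quarters, which is
  enough. The family degenerates in the limit: the radius \<open>c - 1\<close> at the junctions
  tends to \<open>0\<close> and no curvature bound is uniform. Regularity is therefore shown for
  each \<open>c\<close> separately, while area, energy and volume are expressed by the integrals
  \<open>J\<close>, which are continuous up to \<open>c = 1\<close>. At a junction both unit
  tangents are axial, but the mean curvature jumps from \<open>1 / (2 a)\<close> to
  \<open>- 1 / 2\<close>. Tangents are thus only Lipschitz, and curvature is computed off finitely
  many parallels.\<close>

lemma integral_has_real_derivative_at: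
  fixes f :: "real \<Rightarrow> real"
  assumes "continuous_on UNIV f" "0 < x"
  shows "((\<lambda>x. integral {0..x} f) has_real_derivative f x) (at x)"
proof -
  have "((\<lambda>x. integral {0..x} f) has_vector_derivative f x) (at x within {0..x+1})"
    by (rule integral_has_vector_derivative) (use assms continuous_on_subset in auto)
  moreover have "at x within {0..x+1} = at x"
    by (rule at_within_interior) (use assms in auto)
  ultimately show ?thesis
    by (simp add: has_real_derivative_iff_has_vector_derivative)
qed

lemma has_integral_affine_real:
  fixes h :: "real \<Rightarrow> real"
  assumes h: "(h has_integral I) {s..t}" and m: "0 < m"
  shows "((\<lambda>x. h (m * x - r)) has_integral I / m) {(s + r) / m..(t + r) / m}"
proof (cases "s \<le> t")
  case True
  have "(\<lambda>x. (1 / m) *\<^sub>R x + - ((1 / m) *\<^sub>R (- r))) ` cbox s t = (\<lambda>x. (1 / m) * x + r / m) ` {s..t}"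
    by simp
  also have "\<dots> = {(s + r) / m..(t + r) / m}"
    using m True unfolding image_affinity_atLeastAtMost by (simp add: add_divide_distrib)
  finally show ?thesis
    using has_integral_affinity[of h I s t m "- r"] h m by (simp add: mult.commute)
next
  case False
  then have "I = 0" "(t + r) / m < (s + r) / m" using h m by (simp_all add: divide_strict_right_mono)
  then show ?thesis by simp
qed

lemma has_integral_flip:
  fixes h :: "real \<Rightarrow> real"
  assumes "(h has_integral I) {s..t}"
  shows "((\<lambda>x. h (s + t - x)) has_integral I) {s..t}"
proof -
  have "((\<lambda>x. h (- x)) has_integral I) {-t..-s}"
    using assms by (simp add: has_integral_reflect_real)
  from has_integral_affine_real[OF this, of 1 "s + t"] show ?thesis by simp
qed

lemma lipschitz_of_bounded_deriv:
  fixes h :: "real \<Rightarrow> real"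
  assumes "\<And>x. (h has_real_derivative h' x) (at x)" "\<And>x. \<bar>h' x\<bar> \<le> C"
  shows "C-lipschitz_on UNIV h"
proof (rule lipschitz_onI)
  show "0 \<le> C" using assms(2)[of 0] by linarith
  show "dist (h x) (h y) \<le> C * dist x y" for x y
    using field_differentiable_bound[of UNIV h h' C x y] assms
    by (auto simp: dist_norm)
qed

lemma DERIV_frac: "u \<notin> \<int> \<Longrightarrow> (frac has_real_derivative 1) (at u)"
  for u :: real
proof -
  assume "u \<notin> \<int>"
  then have u: "of_int \<lfloor>u\<rfloor> < u" "u < of_int \<lfloor>u\<rfloor> + 1"
    using frac_gt_0_iff[of u] frac_lt_1[of u] by (auto simp: frac_def)
  have "((\<lambda>x. x - of_int \<lfloor>u\<rfloor>) has_real_derivative 1) (at u)"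
    by (auto intro!: derivative_eq_intros)
  then show ?thesis
  proof (rule has_field_derivative_transform_within_open[where S = "{of_int \<lfloor>u\<rfloor><..<of_int \<lfloor>u\<rfloor> + 1}"])
    fix x :: real assume "x \<in> {of_int \<lfloor>u\<rfloor><..<of_int \<lfloor>u\<rfloor> + 1}"
    then have "\<lfloor>x\<rfloor> = \<lfloor>u\<rfloor>" by (simp add: floor_unique)
    then show "x - of_int \<lfloor>u\<rfloor> = frac x" by (simp add: frac_def)
  qed (use u in auto)
qed

lemma continuous_at_frac: "u \<notin> \<int> \<Longrightarrow> isCont frac u" for u :: real
  by (rule DERIV_isCont[OF DERIV_frac])

lemma cos_eq_cases:
  fixes u u' :: real
  assumes "0 \<le> u" "u < 2 * pi" "0 \<le> u'" "u' < 2 * pi" "cos u = cos u'"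
  shows "u = u' \<or> u + u' = 2 * pi"
proof -
  have c: "cos (2 * pi - x) = cos x" for x by (simp add: cos_diff)
  consider "u \<le> pi" "u' \<le> pi" | "u \<le> pi" "pi \<le> u'" | "pi \<le> u" "u' \<le> pi" | "pi \<le> u" "pi \<le> u'"
    by linarith
  then show ?thesis
  proof cases
    case 1 then show ?thesis using cos_inj_pi[of u u'] assms by simp
  next
    case 2 then show ?thesis using cos_inj_pi[of u "2 * pi - u'"] assms by (simp add: c)
  next
    case 3 then show ?thesis using cos_inj_pi[of "2 * pi - u" u'] assms by (simp add: c)
  next
    case 4 then show ?thesis using cos_inj_pi[of "2 * pi - u" "2 * pi - u'"] assms by (simp add: c)
  qed
qed

lemma periodic_bounded:
  fixes h :: "real \<Rightarrow> real"
  assumes "continuous_on UNIV h" "\<And>u. h (u + 1) = h u"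
  shows "\<exists>B. \<forall>u. \<bar>h u\<bar> \<le> B"
proof -
  have "compact (h ` {0..1})"
    by (rule compact_continuous_image[OF continuous_on_subset[OF assms(1)]]) auto
  then obtain B where B: "\<And>u. u \<in> {0..1} \<Longrightarrow> \<bar>h u\<bar> \<le> B"
    using compact_imp_bounded[of "h ` {0..1}"] by (metis bounded_iff imageI real_norm_def)
  have nat: "h (u + real n) = h u" for u n
  proof (induction n)
    case (Suc n)
    then show ?case using assms(2)[of "u + real n"] by (simp add: add_ac)
  qed simp
  have int: "h (u + of_int m) = h u" for u m
  proof (cases "m \<ge> 0")
    case True then show ?thesis using nat[of u "nat m"] by simp
  next
    case False then show ?thesis using nat[of "u + of_int m" "nat (- m)"] by simp
  qed
  have "\<bar>h u\<bar> \<le> B" for u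
  proof -
    have "h u = h (frac u)" using int[of "frac u" "\<lfloor>u\<rfloor>"] by (simp add: frac_def)
    moreover have "\<bar>h (frac u)\<bar> \<le> B" by (rule B) (simp add: frac_lt_1 less_imp_le)
    ultimately show ?thesis by simp
  qed
  then show ?thesis by blast
qed

section \<open>Kenmotsu arcs\<close>

definition ken_rad :: "real \<Rightarrow> real \<Rightarrow> real \<Rightarrow> real" where
  "ken_rad a y w = sqrt (a\<^sup>2 + y\<^sup>2 - 2 * a * y * cos (w / a))"

definition ken_tr :: "real \<Rightarrow> real \<Rightarrow> real \<Rightarrow> real" where
  "ken_tr a y w = y * sin (w / a) / ken_rad a y w"

definition ken_tz :: "real \<Rightarrow> real \<Rightarrow> real \<Rightarrow> real" where
  "ken_tz a y w = (a - y * cos (w / a)) / ken_rad a y w"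

definition ken_hgt :: "real \<Rightarrow> real \<Rightarrow> real \<Rightarrow> real" where
  "ken_hgt a y w = integral {0..w} (ken_tz a y)"

text \<open>The curvature of the profile, written as \<open>1 / a - ken_tz / ken_rad\<close> with
  the cosine eliminated. In this form the two principal curvatures add up to the constant
  \<open>1 / a\<close>.\<close>

definition ken_curv :: "real \<Rightarrow> real \<Rightarrow> real \<Rightarrow> real" where
  "ken_curv a y w = (1 - (a\<^sup>2 - y\<^sup>2) / (ken_rad a y w)\<^sup>2) / (2 * a)"

text \<open>Only the sign of the product is fixed, so that \<open>(a, y)\<close> and
  \<open>(-1, -c)\<close> are both instances; the negative first parameter of the nodoid reverses
  the sign of its mean curvature. The condition \<open>a \<noteq> y\<close> keeps the arc away from
  the axis.\<close>

locale kenmotsu =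
  fixes a y :: real
  assumes ay: "0 < a * y" and ne: "a \<noteq> y"
begin

lemma a_nz: "a \<noteq> 0" using ay by auto

lemma rad_arg_ge: "(a - y)\<^sup>2 \<le> a\<^sup>2 + y\<^sup>2 - 2 * a * y * cos t"
proof -
  have "a * y * cos t \<le> a * y" using ay by (simp add: mult_left_le)
  then show ?thesis by (simp add: power2_eq_square algebra_simps)
qed

lemma rad_arg_pos: "0 < a\<^sup>2 + y\<^sup>2 - 2 * a * y * cos t"
proof -
  have "0 < (a - y)\<^sup>2" using ne by auto
  then show ?thesis using rad_arg_ge[of t] by linarith
qed

lemma rad_pos: "0 < ken_rad a y w"
  unfolding ken_rad_def using rad_arg_pos by simp

lemma rad_sq: "(ken_rad a y w)\<^sup>2 = a\<^sup>2 + y\<^sup>2 - 2 * a * y * cos (w / a)"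
  unfolding ken_rad_def using rad_arg_pos[of "w / a"] by simp

text \<open>Eliminating the cosine makes \<open>ken_tz\<close> and \<open>ken_curv\<close> rational
  in the radius. Derivative formulas become rational identities, and points of different arcs can be
  compared at equal radius.\<close>

lemma cos_rad: "y * cos (w / a) = (a\<^sup>2 + y\<^sup>2 - (ken_rad a y w)\<^sup>2) / (2 * a)"
  unfolding rad_sq using a_nz by (simp add: field_simps)

lemma tz_eq: "ken_tz a y w = ((ken_rad a y w)\<^sup>2 + a\<^sup>2 - y\<^sup>2) / (2 * a * ken_rad a y w)"
  unfolding ken_tz_def cos_rad using a_nz rad_pos[of w] by (simp add: field_simps power2_eq_square)

text \<open>Together with \<open>DERIV_rad\<close> and \<open>DERIV_hgt\<close> this is the
  statement that \<open>w\<close> is arc length.\<close>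

lemma unit: "(ken_tr a y w)\<^sup>2 + (ken_tz a y w)\<^sup>2 = 1"
proof -
  have "(y * sin (w / a))\<^sup>2 + (a - y * cos (w / a))\<^sup>2
      = y\<^sup>2 * ((sin (w / a))\<^sup>2 + (cos (w / a))\<^sup>2) + a\<^sup>2 - 2 * a * y * cos (w / a)"
    by algebra
  also have "\<dots> = (ken_rad a y w)\<^sup>2" by (simp add: rad_sq)
  finally show ?thesis using rad_pos[of w]
    unfolding ken_tr_def ken_tz_def by (simp add: power_divide add_divide_distrib[symmetric])
qed

lemma tr_sq: "(ken_tr a y w)\<^sup>2 = 1 - (ken_tz a y w)\<^sup>2"
  using unit[of w] by linarith

lemma DERIV_rad: "(ken_rad a y has_real_derivative ken_tr a y w) (at w)"
proof -
  have "((\<lambda>w. sqrt (a\<^sup>2 + y\<^sup>2 - 2 * a * y * cos (w / a))) has_real_derivative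
      (2 * a * y * (sin (w / a) * (1 / a))) * (inverse (sqrt (a\<^sup>2 + y\<^sup>2 - 2 * a * y * cos (w / a))) / 2)) (at w)"
    using rad_arg_pos[of "w / a"] a_nz by (auto intro!: derivative_eq_intros)
  then show ?thesis
    using a_nz by (simp add: ken_rad_def[abs_def] ken_tr_def field_simps)
qed

lemma DERIV_tz: "(ken_tz a y has_real_derivative ken_curv a y w * ken_tr a y w) (at w)"
proof -
  have "((\<lambda>w. ((ken_rad a y w)\<^sup>2 + a\<^sup>2 - y\<^sup>2) / (2 * a * ken_rad a y w)) has_real_derivative
      ((2 * ken_rad a y w * ken_tr a y w) * (2 * a * ken_rad a y w)
       - ((ken_rad a y w)\<^sup>2 + a\<^sup>2 - y\<^sup>2) * (2 * a * ken_tr a y w)) / (2 * a * ken_rad a y w)\<^sup>2) (at w)"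
    using rad_pos[of w] a_nz by (auto intro!: derivative_eq_intros DERIV_rad simp: power2_eq_square)
  moreover have "((2 * ken_rad a y w * ken_tr a y w) * (2 * a * ken_rad a y w)
       - ((ken_rad a y w)\<^sup>2 + a\<^sup>2 - y\<^sup>2) * (2 * a * ken_tr a y w)) / (2 * a * ken_rad a y w)\<^sup>2
     = ken_curv a y w * ken_tr a y w"
    unfolding ken_curv_def using rad_pos[of w] a_nz by (simp add: field_simps power2_eq_square)
  ultimately show ?thesis by (simp add: tz_eq[abs_def])
qed

lemma DERIV_tr: "(ken_tr a y has_real_derivative - ken_curv a y w * ken_tz a y w) (at w)"
proof -
  let ?r = "ken_rad a y w"
  have "((\<lambda>w. y * sin (w / a) / ken_rad a y w) has_real_derivative
      ((y * cos (w / a) / a) * ?r - y * sin (w / a) * ken_tr a y w) / ?r\<^sup>2) (at w)"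
    using rad_pos[of w] a_nz by (auto intro!: derivative_eq_intros DERIV_rad simp: power2_eq_square)
  moreover have "((y * cos (w / a) / a) * ?r - y * sin (w / a) * ken_tr a y w) / ?r\<^sup>2
      = ((y * cos (w / a)) / a - (ken_tr a y w)\<^sup>2) / ?r"
    unfolding ken_tr_def using rad_pos[of w] by (simp add: field_simps power2_eq_square)
  moreover have "\<dots> = - ken_curv a y w * ken_tz a y w"
    unfolding cos_rad tr_sq tz_eq ken_curv_def using rad_pos[of w] a_nz
    by (simp add: divide_simps) (simp add: algebra_simps power2_eq_square)
  ultimately show ?thesis by (simp add: ken_tr_def[abs_def])
qed

lemma tz_le_1: "\<bar>ken_tz a y w\<bar> \<le> 1" and tr_le_1: "\<bar>ken_tr a y w\<bar> \<le> 1"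
proof -
  have "(ken_tz a y w)\<^sup>2 \<le> 1" "(ken_tr a y w)\<^sup>2 \<le> 1"
    using unit[of w] zero_le_power2[of "ken_tz a y w"] zero_le_power2[of "ken_tr a y w"] by linarith+
  then show "\<bar>ken_tz a y w\<bar> \<le> 1" "\<bar>ken_tr a y w\<bar> \<le> 1" by (simp_all add: abs_square_le_1)
qed

lemma continuous_rad: "continuous_on A (ken_rad a y)"
  and continuous_tz: "continuous_on A (ken_tz a y)"
  using DERIV_rad DERIV_tz
  by (auto intro!: continuous_at_imp_continuous_on intro: DERIV_isCont)

text \<open>The bound blows up as \<open>a - y\<close> tends to \<open>0\<close>. That is harmless,
  because it only supplies Lipschitz constants for one torus at a time.\<close>

lemma curv_bound: "\<bar>ken_curv a y w\<bar> \<le> (1 + \<bar>a\<^sup>2 - y\<^sup>2\<bar> / (a - y)\<^sup>2) / (2 * \<bar>a\<bar>)"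
proof -
  have "(a - y)\<^sup>2 \<le> (ken_rad a y w)\<^sup>2" using rad_arg_ge[of "w / a"] by (simp add: rad_sq)
  moreover have "0 < (a - y)\<^sup>2" using ne by simp
  ultimately have "\<bar>a\<^sup>2 - y\<^sup>2\<bar> / (ken_rad a y w)\<^sup>2 \<le> \<bar>a\<^sup>2 - y\<^sup>2\<bar> / (a - y)\<^sup>2"
    by (intro divide_left_mono mult_pos_pos) (use rad_pos[of w] in auto)
  then have "\<bar>1 - (a\<^sup>2 - y\<^sup>2) / (ken_rad a y w)\<^sup>2\<bar> \<le> 1 + \<bar>a\<^sup>2 - y\<^sup>2\<bar> / (a - y)\<^sup>2"
    by (intro order.trans[OF abs_triangle_ineq4]) simp
  then show ?thesis unfolding ken_curv_def abs_divide
    by (simp add: abs_mult divide_right_mono)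
qed

text \<open>\<open>ken_hgt\<close> vanishes identically on the negative half-line, since it
  integrates over an empty interval there; the formula is therefore confined to positive
  \<open>w\<close>.\<close>

lemma DERIV_hgt: "0 < w \<Longrightarrow> (ken_hgt a y has_real_derivative ken_tz a y w) (at w)"
  unfolding ken_hgt_def[abs_def] by (rule integral_has_real_derivative_at[OF continuous_tz])

lemma hgt_0 [simp]: "ken_hgt a y 0 = 0"
  by (simp add: ken_hgt_def)

lemma continuous_hgt: "A \<subseteq> {0..} \<Longrightarrow> continuous_on A (ken_hgt a y)"
proof -
  have cont: "continuous_on {0..n} (ken_hgt a y)" for n
    unfolding ken_hgt_def by (intro indefinite_integral_continuous_1 integrable_continuous_real continuous_tz)
  have "continuous (at x within {0..}) (ken_hgt a y)" if "0 \<le> x" for x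
  proof -
    have "continuous (at x within {0..x+1}) (ken_hgt a y)"
      using cont[of "x+1"] that by (simp add: continuous_on_eq_continuous_within)
    moreover have "at x within {0..x+1} = at x within {0..}"
      by (rule at_within_nhd[where S = "{..<x+1}"]) auto
    ultimately show ?thesis by simp
  qed
  then have "continuous_on {0..} (ken_hgt a y)" by (simp add: continuous_on_eq_continuous_within)
  then show "A \<subseteq> {0..} \<Longrightarrow> continuous_on A (ken_hgt a y)" using continuous_on_subset by blast
qed

text \<open>One period has length \<open>2 * pi * \<bar>a\<bar>\<close>: for negative
  \<open>a\<close> the angle \<open>w / a\<close> runs through a full turn backwards.\<close>

lemma ken_reflect:
  "ken_rad a y (2 * pi * \<bar>a\<bar> - w) = ken_rad a y w"
  "ken_tr a y (2 * pi * \<bar>a\<bar> - w) = - ken_tr a y w"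
  "ken_tz a y (2 * pi * \<bar>a\<bar> - w) = ken_tz a y w"
proof -
  have *: "(2 * pi * \<bar>a\<bar> - w) / a = (if a > 0 then 2 * pi else - (2 * pi)) - w / a"
    using a_nz by (auto simp: field_simps)
  have cs: "cos ((2 * pi * \<bar>a\<bar> - w) / a) = cos (w / a)" "sin ((2 * pi * \<bar>a\<bar> - w) / a) = - sin (w / a)"
    unfolding * by (simp_all add: cos_diff sin_diff)
  show r: "ken_rad a y (2 * pi * \<bar>a\<bar> - w) = ken_rad a y w" unfolding ken_rad_def cs ..
  show "ken_tr a y (2 * pi * \<bar>a\<bar> - w) = - ken_tr a y w" unfolding ken_tr_def r cs by simp
  show "ken_tz a y (2 * pi * \<bar>a\<bar> - w) = ken_tz a y w" unfolding ken_tz_def r cs ..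
qed

lemma hgt_reflect:
  assumes "0 \<le> w" "w \<le> 2 * pi * \<bar>a\<bar>"
  shows "ken_hgt a y (2 * pi * \<bar>a\<bar> - w) = ken_hgt a y (2 * pi * \<bar>a\<bar>) - ken_hgt a y w"
proof -
  have "integral {2 * pi * \<bar>a\<bar> - w..2 * pi * \<bar>a\<bar>} (ken_tz a y)
      = integral {2 * pi * \<bar>a\<bar> - w..2 * pi * \<bar>a\<bar>} (\<lambda>x. ken_tz a y (2 * pi * \<bar>a\<bar> - x))"
    by (simp add: ken_reflect)
  also have "\<dots> = integral {0..w} (ken_tz a y)"
  proof -
    have "((\<lambda>x. ken_tz a y (2 * pi * \<bar>a\<bar> - x)) has_integral integral {0..w} (ken_tz a y)) {2 * pi * \<bar>a\<bar> - w..2 * pi * \<bar>a\<bar>}"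
      using has_integral_affinity[of "ken_tz a y" "integral {0..w} (ken_tz a y)" 0 w "-1" "2 * pi * \<bar>a\<bar>"]
        integrable_integral[OF integrable_continuous_real[OF continuous_tz[of "{0..w}"]]] assms
      by (simp add: image_affinity_atLeastAtMost_diff algebra_simps)
    then show ?thesis by (rule integral_unique)
  qed
  moreover have "integral {0..2 * pi * \<bar>a\<bar> - w} (ken_tz a y) + integral {2 * pi * \<bar>a\<bar> - w..2 * pi * \<bar>a\<bar>} (ken_tz a y)
      = integral {0..2 * pi * \<bar>a\<bar>} (ken_tz a y)"
    using assms by (intro Henstock_Kurzweil_Integration.integral_combine integrable_continuous_real continuous_tz) auto
  ultimately show ?thesis by (simp add: ken_hgt_def)
qed

lemma rad_lipschitz: "1-lipschitz_on A (ken_rad a y)"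
  by (rule lipschitz_on_subset[OF lipschitz_of_bounded_deriv[OF DERIV_rad]]) (use tr_le_1 in auto)

lemma tr_lipschitz: "\<exists>C. C-lipschitz_on UNIV (ken_tr a y)"
  and tz_lipschitz: "\<exists>C. C-lipschitz_on UNIV (ken_tz a y)"
proof -
  have "\<bar>ken_curv a y w * t\<bar> \<le> (1 + \<bar>a\<^sup>2 - y\<^sup>2\<bar> / (a - y)\<^sup>2) / (2 * \<bar>a\<bar>)" if "\<bar>t\<bar> \<le> 1" for t w
    unfolding abs_mult using mult_mono[OF curv_bound that] order.trans[OF abs_ge_zero curv_bound] by simp
  then have "\<bar>- ken_curv a y w * ken_tz a y w\<bar> \<le> (1 + \<bar>a\<^sup>2 - y\<^sup>2\<bar> / (a - y)\<^sup>2) / (2 * \<bar>a\<bar>)"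
      "\<bar>ken_curv a y w * ken_tr a y w\<bar> \<le> (1 + \<bar>a\<^sup>2 - y\<^sup>2\<bar> / (a - y)\<^sup>2) / (2 * \<bar>a\<bar>)" for w
    using tr_le_1[of w] tz_le_1[of w] by auto
  then show "\<exists>C. C-lipschitz_on UNIV (ken_tr a y)" "\<exists>C. C-lipschitz_on UNIV (ken_tz a y)"
    using lipschitz_of_bounded_deriv[OF DERIV_tr] lipschitz_of_bounded_deriv[OF DERIV_tz] by blast+
qed

lemma hgt_lipschitz: "1-lipschitz_on {0..} (ken_hgt a y)"
proof (rule lipschitz_on_leI)
  fix x x' :: real assume x: "x \<in> {0..}" "x' \<in> {0..}" "x \<le> x'"
  show "dist (ken_hgt a y x) (ken_hgt a y x') \<le> 1 * dist x x'"
  proof (cases "x = x'")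
    case False
    then have "x < x'" using x by simp
    moreover have "continuous_on {x..x'} (ken_hgt a y)" by (rule continuous_hgt) (use x in auto)
    moreover have "ken_hgt a y differentiable at z" if "x < z" for z
      using DERIV_hgt[of z] that x by (auto simp: real_differentiable_def)
    ultimately obtain l z where z: "x < z" "(ken_hgt a y has_real_derivative l) (at z)"
        "ken_hgt a y x' - ken_hgt a y x = (x' - x) * l"
      using MVT[of x x' "ken_hgt a y"] by blast
    then have "l = ken_tz a y z" using DERIV_unique[OF z(2) DERIV_hgt] x by simp
    then have "\<bar>(x' - x) * l\<bar> \<le> (x' - x) * 1"
      unfolding abs_mult using tz_le_1[of z] x by (intro mult_mono) auto
    then show ?thesis using z(3) x by (simp add: dist_real_def abs_minus_commute)
  qed simp
qed simp

lemma hgt_strict_mono: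
  assumes "0 \<le> v" "v < w" "\<And>t. v < t \<Longrightarrow> t < w \<Longrightarrow> 0 < ken_tz a y t"
  shows "ken_hgt a y v < ken_hgt a y w"
proof (rule DERIV_pos_imp_increasing_open[OF assms(2)])
  show "\<exists>d. (ken_hgt a y has_real_derivative d) (at t) \<and> 0 < d" if "v < t" "t < w" for t
    using assms that by (intro exI[of _ "ken_tz a y t"] conjI DERIV_hgt) auto
qed (use assms in \<open>auto intro: continuous_hgt\<close>)

lemma hgt_strict_antimono:
  assumes "0 \<le> v" "v < w" "\<And>t. v < t \<Longrightarrow> t < w \<Longrightarrow> ken_tz a y t < 0"
  shows "ken_hgt a y w < ken_hgt a y v"
proof (rule DERIV_neg_imp_decreasing_open[OF assms(2)])
  show "\<exists>d. (ken_hgt a y has_real_derivative d) (at t) \<and> d < 0" if "v < t" "t < w" for t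
    using assms that by (intro exI[of _ "ken_tz a y t"] conjI DERIV_hgt) auto
qed (use assms in \<open>auto intro: continuous_hgt\<close>)

lemma norm_tangent: "norm (ken_tr a y w * d, ken_tz a y w * d) = \<bar>d\<bar>"
proof -
  have "(ken_tr a y w * d)\<^sup>2 + (ken_tz a y w * d)\<^sup>2 = ((ken_tr a y w)\<^sup>2 + (ken_tz a y w)\<^sup>2) * d\<^sup>2"
    by algebra
  then show ?thesis by (simp add: norm_Pair unit)
qed

end

section \<open>Tori of revolution\<close>

text \<open>Mean curvature is known only off the junctions, so \<open>\<phi>\<close> is prescribed
  only off finitely many vertical lines. These form a null set, and completeness of Lebesgue measure
  then gives the measurability of \<open>\<phi>\<close> as well.\<close>

lemma integral_unit_square_fst:
  fixes h :: "real \<Rightarrow> real" and \<phi> :: "real \<times> real \<Rightarrow> real"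
  assumes h [measurable]: "h \<in> borel_measurable borel" and bd: "\<And>u. \<bar>h u\<bar> \<le> B"
    and S: "finite S" and eq: "\<And>z. fst z \<in> {0..1} - S \<Longrightarrow> \<phi> z = h (fst z)"
  shows "\<phi> \<in> borel_measurable (lebesgue_on ({0..1} \<times> {0..1}))"
    and "integral\<^sup>L (lebesgue_on ({0..1} \<times> {0..1})) \<phi> = integral {0..1} h"
proof -
  let ?Q = "{0..1::real} \<times> {0..1::real}"
  have Qb [measurable]: "?Q \<in> sets borel" by (simp add: closed_Times borel_closed)
  have Ql: "?Q \<in> sets lebesgue" by simp
  have "negligible {z :: real \<times> real. fst z \<in> S}"
  proof -
    have "negligible {z :: real \<times> real. fst z = s}" for s
      using negligible_standard_hyperplane[of "(1, 0) :: real \<times> real" s]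
      by (simp add: Basis_prod_def inner_prod_def)
    then have "negligible (\<Union>s\<in>S. {z :: real \<times> real. fst z = s})"
      by (intro negligible_Union) (use S in auto)
    moreover have "(\<Union>s\<in>S. {z :: real \<times> real. fst z = s}) = {z. fst z \<in> S}" by auto
    ultimately show ?thesis by simp
  qed
  then have null: "{z :: real \<times> real. fst z \<in> S} \<in> null_sets lebesgue"
    by (simp add: negligible_iff_null_sets)
  have AE: "AE z in lebesgue. indicator ?Q z * h (fst z) = indicator ?Q z * \<phi> z"
    by (rule AE_I'[OF null]) (use eq in \<open>force simp: indicator_def\<close>)
  have [measurable]: "(\<lambda>z::real \<times> real. h (fst z)) \<in> borel_measurable borel"
    by (rule measurable_compose[OF borel_measurable_continuous_onI[OF continuous_on_fst[OF continuous_on_id]] h])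
  have "(\<lambda>z. indicator ?Q z * h (fst z)) \<in> borel_measurable lborel"
    by measurable
  then have m1: "(\<lambda>z. indicator ?Q z * h (fst z)) \<in> borel_measurable lebesgue"
    by (rule measurable_completion)
  then have m2: "(\<lambda>z. indicator ?Q z * \<phi> z) \<in> borel_measurable lebesgue"
    by (rule borel_measurable_AE[OF _ AE])
  then show "\<phi> \<in> borel_measurable (lebesgue_on ?Q)"
    using Ql by (simp add: borel_measurable_restrict_space_iff mult.commute)
  have "integral\<^sup>L (lebesgue_on ?Q) \<phi> = integral\<^sup>L lebesgue (\<lambda>z. indicator ?Q z * \<phi> z)"
    by (subst integral_restrict_space) simp_all
  also have "\<dots> = integral\<^sup>L lebesgue (\<lambda>z. indicator ?Q z * h (fst z))"
    by (rule integral_cong_AE[OF m2 m1]) (use AE in auto)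
  \<comment> \<open>Fubini applies to \<open>lborel\<close> on the plane, which is a product
    measure; \<open>lebesgue\<close> is its completion.\<close>
  also have "\<dots> = integral\<^sup>L lborel (\<lambda>z. indicator ?Q z * h (fst z))"
    by (rule integral_completion) measurable
  also have "\<dots> = integral\<^sup>L (lborel \<Otimes>\<^sub>M lborel) (\<lambda>z. indicator ?Q z * h (fst z))"
    by (simp add: lborel_prod)
  also have "\<dots> = (\<integral>u. (\<integral>v. indicator ?Q (u, v) * h u \<partial>lborel) \<partial>lborel)"
  proof -
    have "emeasure lborel ?Q < \<infinity>"
      using emeasure_lborel_cbox_finite[of "(0,0) :: real \<times> real" "(1,1)"] by (simp add: cbox_Pair_eq)
    then have "integrable lborel (\<lambda>z. indicator ?Q z * h (fst z))"
      by (intro integrableI_bounded_set[where A = ?Q and B = B])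
        (auto simp: indicator_def intro!: AE_I2 bd)
    then have "integrable (lborel \<Otimes>\<^sub>M lborel) (\<lambda>z. indicator ?Q z * h (fst z))"
      by (simp add: lborel_prod)
    from lborel_pair.integral_fst'[OF this] show ?thesis by simp
  qed
  also have "\<dots> = (\<integral>u. indicator {0..1} u *\<^sub>R h u \<partial>lborel)"
  proof (rule Bochner_Integration.integral_cong[OF refl])
    fix u :: real
    have "(\<integral>v. indicator ?Q (u, v) * h u \<partial>lborel) = (\<integral>v. (indicator {0..1} u * h u) * indicator {0..1} (v :: real) \<partial>lborel)"
      by (rule Bochner_Integration.integral_cong[OF refl]) (auto simp: indicator_def)
    also have "\<dots> = indicator {0..1} u *\<^sub>R h u"
      by simp
    finally show "(\<integral>v. indicator ?Q (u, v) * h u \<partial>lborel) = indicator {0..1} u *\<^sub>R h u" .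
  qed
  also have "\<dots> = integral {0..1} h"
  proof -
    have "set_integrable lborel {0..1} h"
      unfolding set_integrable_def
      by (intro integrableI_bounded_set[where A = "{0..1}" and B = B])
        (auto simp: indicator_def intro!: AE_I2 bd)
    from set_borel_integral_eq_integral(2)[OF this] show ?thesis
      by (simp add: set_lebesgue_integral_def)
  qed
  finally show "integral\<^sup>L (lebesgue_on ?Q) \<phi> = integral {0..1} h" .
qed

section \<open>Products of bounded Lipschitz functions, and coordinates in three-space\<close>

definition bounded_lipschitz :: "('a::metric_space \<Rightarrow> real) \<Rightarrow> bool" where
  "bounded_lipschitz h \<longleftrightarrow> (\<exists>C. C-lipschitz_on UNIV h) \<and> (\<exists>B. \<forall>x. \<bar>h x\<bar> \<le> B)"

lemma bounded_lipschitzI: "C-lipschitz_on UNIV h \<Longrightarrow> (\<And>x. \<bar>h x\<bar> \<le> B) \<Longrightarrow> bounded_lipschitz h"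
  by (auto simp: bounded_lipschitz_def)

text \<open>A product of Lipschitz functions is controlled only when the factors are bounded;
  carrying both properties together makes the class closed under multiplication, which is what the
  entries of \<open>dF\<close> require.\<close>

lemma bounded_lipschitz_mult:
  assumes "bounded_lipschitz h" "bounded_lipschitz k"
  shows "bounded_lipschitz (\<lambda>x. h x * k x)"
proof -
  obtain C B where h: "C-lipschitz_on UNIV h" "\<And>x. \<bar>h x\<bar> \<le> B" using assms(1) by (auto simp: bounded_lipschitz_def)
  obtain C' B' where k: "C'-lipschitz_on UNIV k" "\<And>x. \<bar>k x\<bar> \<le> B'" using assms(2) by (auto simp: bounded_lipschitz_def)
  have pos: "0 \<le> B" "0 \<le> B'" "0 \<le> C" "0 \<le> C'"
    using h k by (auto intro: order.trans[OF abs_ge_zero] lipschitz_on_nonneg)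
  have "(B * C' + B' * C)-lipschitz_on UNIV (\<lambda>x. h x * k x)"
  proof (rule lipschitz_onI)
    fix x y
    have "\<bar>h x * k x - h y * k y\<bar> \<le> \<bar>h x * (k x - k y)\<bar> + \<bar>(h x - h y) * k y\<bar>"
      by (rule order.trans[OF _ abs_triangle_ineq]) (simp add: algebra_simps)
    also have "\<dots> \<le> B * (C' * dist x y) + (C * dist x y) * B'"
      unfolding abs_mult
      using lipschitz_onD[OF h(1), of x y] lipschitz_onD[OF k(1), of x y] h(2)[of x] k(2)[of y] pos
      by (intro add_mono mult_mono) (auto simp: dist_real_def)
    finally show "dist (h x * k x) (h y * k y) \<le> (B * C' + B' * C) * dist x y"
      by (simp add: dist_real_def algebra_simps)
  qed (use pos in auto)
  moreover have "\<bar>h x * k x\<bar> \<le> B * B'" for x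
    unfolding abs_mult using h(2) k(2) pos by (intro mult_mono) auto
  ultimately show ?thesis by (rule bounded_lipschitzI)
qed

lemma bounded_lipschitz_const: "bounded_lipschitz (\<lambda>x. c)"
  by (rule bounded_lipschitzI[where C = 0 and B = "\<bar>c\<bar>"]) (auto simp: lipschitz_on_def)

lemma bounded_lipschitz_fst: "bounded_lipschitz h \<Longrightarrow> bounded_lipschitz (\<lambda>z :: real \<times> real. h (fst z))"
  and bounded_lipschitz_snd: "bounded_lipschitz h \<Longrightarrow> bounded_lipschitz (\<lambda>z :: real \<times> real. h (snd z))"
proof -
  assume "bounded_lipschitz h"
  then obtain C B where C: "C-lipschitz_on UNIV h" and B: "\<And>x. \<bar>h x\<bar> \<le> B" by (auto simp: bounded_lipschitz_def)
  have "dist (h x) (h y) \<le> C * r" if "dist x y \<le> r" for x y r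
    using lipschitz_onD[OF C, of x y] mult_left_mono[OF that lipschitz_on_nonneg[OF C]] by simp
  then have "C-lipschitz_on UNIV (\<lambda>z :: real \<times> real. h (fst z))" "C-lipschitz_on UNIV (\<lambda>z :: real \<times> real. h (snd z))"
    using lipschitz_on_nonneg[OF C] by (auto simp: lipschitz_on_def dist_fst_le dist_snd_le)
  then show "bounded_lipschitz (\<lambda>z :: real \<times> real. h (fst z))" "bounded_lipschitz (\<lambda>z :: real \<times> real. h (snd z))"
    using B by (auto intro: bounded_lipschitzI)
qed

lemma bounded_lipschitz_cos: "bounded_lipschitz (\<lambda>v. cos (2 * pi * v))"
  by (rule bounded_lipschitzI[where C = "2 * pi" and B = 1], rule lipschitz_of_bounded_deriv[where h' = "\<lambda>v. - (2 * pi) * sin (2 * pi * v)"])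
    (auto intro!: derivative_eq_intros simp: abs_mult)

lemma bounded_lipschitz_sin: "bounded_lipschitz (\<lambda>v. sin (2 * pi * v))"
  by (rule bounded_lipschitzI[where C = "2 * pi" and B = 1], rule lipschitz_of_bounded_deriv[where h' = "\<lambda>v. (2 * pi) * cos (2 * pi * v)"])
    (auto intro!: derivative_eq_intros simp: abs_mult)

lemma vector3_eq: "(vector [x, y, z] :: real ^ 3) = x *\<^sub>R axis 1 1 + y *\<^sub>R axis 2 1 + z *\<^sub>R axis 3 1"
  by (simp add: vec_eq_iff forall_3 axis_def)

lemma inner_vector3: "(vector [x, y, z] :: real ^ 3) \<bullet> vector [x', y', z'] = x * x' + y * y' + z * z'"
  by (simp add: inner_vec_def sum_3)

lemma norm_vector3: "norm (vector [x, y, z] :: real ^ 3) = sqrt (x\<^sup>2 + y\<^sup>2 + z\<^sup>2)"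
  by (simp add: norm_eq_sqrt_inner inner_vector3 power2_eq_square)

lemma scaleR_vector3: "r *\<^sub>R (vector [x, y, z] :: real ^ 3) = vector [r * x, r * y, r * z]"
  by (simp add: vec_eq_iff forall_3)

lemma minus_vector3: "- (vector [x, y, z] :: real ^ 3) = vector [- x, - y, - z]"
  by (simp add: vec_eq_iff forall_3)

lemma vector3_eq_iff: "(vector [x, y, z] :: real ^ 3) = vector [x', y', z'] \<longleftrightarrow> x = x' \<and> y = y' \<and> z = z'"
  by (simp add: vec_eq_iff forall_3)

lemma has_derivative_vector3:
  assumes "(f1 has_derivative g1) F" "(f2 has_derivative g2) F" "(f3 has_derivative g3) F"
  shows "((\<lambda>z. vector [f1 z, f2 z, f3 z] :: real ^ 3) has_derivative (\<lambda>h. vector [g1 h, g2 h, g3 h])) F"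
  unfolding vector3_eq by (intro derivative_intros assms)

lemma has_derivative_fst_comp:
  assumes "(h has_real_derivative d) (at (fst z))"
  shows "((\<lambda>z :: real \<times> real. h (fst z)) has_derivative (\<lambda>w. d * fst w)) (at z)"
  using has_derivative_compose[OF has_derivative_fst[OF has_derivative_ident]
      assms[unfolded has_field_derivative_def]] by simp

lemma has_derivative_snd_comp:
  assumes "(h has_real_derivative d) (at (snd z))"
  shows "((\<lambda>z :: real \<times> real. h (snd z)) has_derivative (\<lambda>w. d * snd w)) (at z)"
  using has_derivative_compose[OF has_derivative_snd[OF has_derivative_ident]
      assms[unfolded has_field_derivative_def]] by simp

section \<open>Differential geometry of a torus over a profile of constant speed\<close>

locale revolution_torus =
  fixes f g p q :: "real \<Rightarrow> real" and s :: real
  assumes s_pos: "0 < s" and f_pos: "\<And>u. 0 < f u"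
    and DERIV_f: "\<And>u. (f has_real_derivative s * p u) (at u)"
    and DERIV_g: "\<And>u. (g has_real_derivative s * q u) (at u)"
    and speed: "\<And>u. (p u)\<^sup>2 + (q u)\<^sup>2 = 1"
    and lip_p: "\<exists>C. C-lipschitz_on UNIV p" and lip_q: "\<exists>C. C-lipschitz_on UNIV q"
    and per: "\<And>u. f (u + 1) = f u" "\<And>u. g (u + 1) = g u"
    and simple: "\<And>u u'. f u = f u' \<Longrightarrow> g u = g u' \<Longrightarrow> u - u' \<in> \<int>"
begin

abbreviation "F \<equiv> surface_of_revolution (\<lambda>u. (f u, g u))"

lemma F_eq: "F = (\<lambda>z. vector [f (fst z) * cos (2 * pi * snd z), f (fst z) * sin (2 * pi * snd z), g (fst z)])"
  by (auto simp: surface_of_revolution_def fun_eq_iff)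

definition dF :: "real \<times> real \<Rightarrow> real \<times> real \<Rightarrow> real ^ 3" where
  "dF z w = vector
    [s * p (fst z) * cos (2 * pi * snd z) * fst w - 2 * pi * f (fst z) * sin (2 * pi * snd z) * snd w,
     s * p (fst z) * sin (2 * pi * snd z) * fst w + 2 * pi * f (fst z) * cos (2 * pi * snd z) * snd w,
     s * q (fst z) * fst w]"

lemma p_le: "\<bar>p u\<bar> \<le> 1" and q_le: "\<bar>q u\<bar> \<le> 1"
proof -
  have "(p u)\<^sup>2 \<le> 1" "(q u)\<^sup>2 \<le> 1"
    using speed[of u] zero_le_power2[of "p u"] zero_le_power2[of "q u"] by linarith+
  then show "\<bar>p u\<bar> \<le> 1" "\<bar>q u\<bar> \<le> 1" by (simp_all add: abs_square_le_1)
qed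

lemma bounded_lipschitz_p: "bounded_lipschitz p" and bounded_lipschitz_q: "bounded_lipschitz q"
  using lip_p lip_q p_le q_le by (auto simp: bounded_lipschitz_def)

lemma continuous_f: "continuous_on A f" and continuous_g: "continuous_on A g"
  using DERIV_f DERIV_g by (auto intro!: continuous_at_imp_continuous_on intro: DERIV_isCont)

lemma f_bounded: "\<exists>B. \<forall>u. \<bar>f u\<bar> \<le> B" and g_bounded: "\<exists>B. \<forall>u. \<bar>g u\<bar> \<le> B"
  by (intro periodic_bounded continuous_f continuous_g per)+

lemma bounded_lipschitz_f: "bounded_lipschitz f"
proof -
  have "s-lipschitz_on UNIV f"
    by (rule lipschitz_of_bounded_deriv[OF DERIV_f]) (use p_le s_pos in \<open>auto simp: abs_mult mult_left_le\<close>)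
  then show ?thesis using f_bounded by (auto simp: bounded_lipschitz_def)
qed

lemma has_derivative_F: "(F has_derivative dF z) (at z)"
proof -
  have c: "((\<lambda>v. cos (2 * pi * v)) has_real_derivative - (2 * pi) * sin (2 * pi * v)) (at v)"
    and sn: "((\<lambda>v. sin (2 * pi * v)) has_real_derivative (2 * pi) * cos (2 * pi * v)) (at v)" for v
    by (auto intro!: derivative_eq_intros)
  note d = has_derivative_fst_comp[OF DERIV_f] has_derivative_fst_comp[OF DERIV_g]
    has_derivative_snd_comp[OF c] has_derivative_snd_comp[OF sn]
  show ?thesis
    unfolding F_eq
    by (rule has_derivative_eq_rhs, rule has_derivative_vector3,
        rule has_derivative_mult[OF d(1) d(3)], rule has_derivative_mult[OF d(1) d(4)], rule d(2))
      (auto simp: dF_def fun_eq_iff algebra_simps)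
qed

lemma dF_inj_aux:
  assumes "dF z w = 0"
  shows "w = 0"
proof -
  let ?C = "cos (2 * pi * snd z)" and ?S = "sin (2 * pi * snd z)"
  have "dF z w = vector [0, 0, 0]" using assms by (simp add: vec_eq_iff forall_3)
  then have e: "s * p (fst z) * ?C * fst w - 2 * pi * f (fst z) * ?S * snd w = 0"
      "s * p (fst z) * ?S * fst w + 2 * pi * f (fst z) * ?C * snd w = 0" and e3: "s * q (fst z) * fst w = 0"
    by (simp_all add: dF_def vector3_eq_iff)
  have cs: "?C * ?C + ?S * ?S = 1" using sin_cos_squared_add2[of "2 * pi * snd z"] by (simp add: power2_eq_square)
  \<comment> \<open>Combining the first two equations with weights \<open>?C\<close>,
    \<open>?S\<close>, and afterwards \<open>- ?S\<close>, \<open>?C\<close>, rotates them back to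
    the half plane of the profile and separates the components of \<open>w\<close>.\<close>
  have "s * p (fst z) * fst w * (?C * ?C + ?S * ?S) = 0"
    using e by algebra
  then have 1: "p (fst z) * fst w = 0" using s_pos by (simp only: cs) auto
  have "2 * pi * f (fst z) * snd w * (?C * ?C + ?S * ?S) = 0"
    using e by algebra
  then have "2 * pi * f (fst z) * snd w = 0" by (simp only: cs)
  then have 2: "snd w = 0" using f_pos[of "fst z"] by simp
  have "q (fst z) * fst w = 0" using e3 s_pos by simp
  then have "fst w = 0" using 1 speed[of "fst z"] by auto
  then show ?thesis using 2 by (simp add: prod_eq_iff)
qed

lemma linear_dF: "linear (dF z)"
  using has_derivative_F has_derivative_linear by blast

text \<open>\<open>dF\<close> is a combination of five constant linear maps whose coefficients are
  products of bounded Lipschitz functions of one variable, so the Lipschitz property of the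
  derivative reduces to scalar statements.\<close>

lemma C11: "C11_immersion F"
proof -
  define B where "B i = Blinfun (\<lambda>w :: real \<times> real. fst w *\<^sub>R (axis i 1 :: real ^ 3))" for i :: 3
  define B' where "B' i = Blinfun (\<lambda>w :: real \<times> real. snd w *\<^sub>R (axis i 1 :: real ^ 3))" for i :: 3
  have B: "blinfun_apply (B i) = (\<lambda>w. fst w *\<^sub>R axis i 1)" for i
    unfolding B_def by (rule bounded_linear_Blinfun_apply)
      (intro bounded_linear_scaleR_const bounded_linear_fst)
  have B': "blinfun_apply (B' i) = (\<lambda>w. snd w *\<^sub>R axis i 1)" for i
    unfolding B'_def by (rule bounded_linear_Blinfun_apply)
      (intro bounded_linear_scaleR_const bounded_linear_snd)
  define D where "D z = (s * p (fst z) * cos (2 * pi * snd z)) *\<^sub>R B 1 + (- (2 * pi) * f (fst z) * sin (2 * pi * snd z)) *\<^sub>R B' 1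
     + (s * p (fst z) * sin (2 * pi * snd z)) *\<^sub>R B 2 + (2 * pi * f (fst z) * cos (2 * pi * snd z)) *\<^sub>R B' 2
     + (s * q (fst z)) *\<^sub>R B 3" for z
  have "blinfun_apply (D z) = dF z" for z
    unfolding D_def dF_def vector3_eq
    by (simp add: fun_eq_iff blinfun.add_left blinfun.diff_left blinfun.scaleR_left B B' scaleR_diff_left scaleR_add_left mult_ac)
  moreover have "inj (dF z)" for z
    using linear_injective_0[OF linear_dF] dF_inj_aux by blast
  moreover have "\<exists>C. C-lipschitz_on UNIV D"
  proof -
    have scaled: "\<exists>C. C-lipschitz_on UNIV (\<lambda>z :: real \<times> real. c z *\<^sub>R A)"
      if c: "bounded_lipschitz c" for c and A :: "(real \<times> real) \<Rightarrow>\<^sub>L (real ^ 3)"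
    proof -
      obtain C where C: "C-lipschitz_on UNIV c" using c by (auto simp: bounded_lipschitz_def)
      have "(C * norm A)-lipschitz_on UNIV (\<lambda>z. c z *\<^sub>R A)"
      proof (rule lipschitz_onI)
        show "0 \<le> C * norm A" using lipschitz_on_nonneg[OF C] by simp
        fix x y :: "real \<times> real"
        have "dist (c x *\<^sub>R A) (c y *\<^sub>R A) = dist (c x) (c y) * norm A"
          by (simp add: dist_norm scaleR_diff_left[symmetric])
        also have "\<dots> \<le> (C * dist x y) * norm A"
          by (intro mult_right_mono lipschitz_onD[OF C]) auto
        finally show "dist (c x *\<^sub>R A) (c y *\<^sub>R A) \<le> C * norm A * dist x y" by (simp add: algebra_simps)
      qed
      then show ?thesis by blast
    qed
    have sum: "\<exists>C. C-lipschitz_on UNIV (\<lambda>z. h z + k z)"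
      if "\<exists>C. C-lipschitz_on UNIV h" "\<exists>C. C-lipschitz_on UNIV k"
      for h k :: "real \<times> real \<Rightarrow> (real \<times> real) \<Rightarrow>\<^sub>L (real ^ 3)"
      using that lipschitz_on_add by blast
    show ?thesis
      unfolding D_def
      by (intro sum scaled bounded_lipschitz_mult bounded_lipschitz_const bounded_lipschitz_fst[OF bounded_lipschitz_p] bounded_lipschitz_fst[OF bounded_lipschitz_q] bounded_lipschitz_fst[OF bounded_lipschitz_f]
            bounded_lipschitz_snd[OF bounded_lipschitz_cos] bounded_lipschitz_snd[OF bounded_lipschitz_sin])
  qed
  ultimately show ?thesis
    unfolding C11_immersion_def using has_derivative_F by metis
qed

lemma embedded: "embedded_C11_torus F"
proof -
  have "doubly_periodic F"
    unfolding doubly_periodic_def F_eq using per by (auto simp: distrib_left)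
  moreover have "fst z - fst w \<in> \<int> \<and> snd z - snd w \<in> \<int>" if "F z = F w" for z w
  proof -
    let ?x = "2 * pi * snd z" and ?y = "2 * pi * snd w"
    have e: "f (fst z) * cos ?x = f (fst w) * cos ?y" "f (fst z) * sin ?x = f (fst w) * sin ?y" "g (fst z) = g (fst w)"
      using that by (simp_all add: F_eq vector3_eq_iff)
    have "(f (fst z))\<^sup>2 = (f (fst z) * cos ?x)\<^sup>2 + (f (fst z) * sin ?x)\<^sup>2"
      by (simp add: power_mult_distrib distrib_left[symmetric])
    also have "\<dots> = (f (fst w))\<^sup>2"
      unfolding e by (simp add: power_mult_distrib distrib_left[symmetric])
    finally have ff: "f (fst z) = f (fst w)"
      using f_pos[of "fst z"] f_pos[of "fst w"] by (simp add: power2_eq_iff_nonneg less_imp_le)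
    then have "sin ?x = sin ?y \<and> cos ?x = cos ?y" using e f_pos[of "fst w"] by simp
    then obtain n where n: "?x = ?y + 2 * pi * of_int n"
      by (auto simp: sin_cos_eq_iff elim: Ints_cases)
    then have "2 * pi * (snd z - snd w) = 2 * pi * of_int n" by (simp add: algebra_simps)
    then have "snd z - snd w = of_int n" by simp
    then show ?thesis using simple[OF ff e(3)] by simp
  qed
  ultimately show ?thesis using C11 by (auto simp: embedded_C11_torus_def)
qed

text \<open>Where the profile moves up the axis, as along the unduloid arc, this normal points
  towards the axis. This is the direction out of the solid torus, in agreement with the positive
  volume found later.\<close>

definition nF :: "real \<times> real \<Rightarrow> real ^ 3" where
  "nF z = vector [- q (fst z) * cos (2 * pi * snd z), - q (fst z) * sin (2 * pi * snd z), p (fst z)]"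

lemma surface_normal_eq: "surface_normal F z = (2 * pi * s * f (fst z)) *\<^sub>R nF z"
proof -
  have fd: "frechet_derivative F (at z) = dF z"
    using frechet_derivative_at[OF has_derivative_F] by simp
  let ?C = "cos (2 * pi * snd z)" and ?S = "sin (2 * pi * snd z)"
  have "s * p (fst z) * ?C * (2 * pi * f (fst z) * ?C) + s * p (fst z) * ?S * (2 * pi * f (fst z) * ?S)
      = 2 * pi * s * f (fst z) * p (fst z) * (?C\<^sup>2 + ?S\<^sup>2)"
    by algebra
  then show ?thesis
    unfolding surface_normal_def fd dF_def nF_def cross3_def scaleR_vector3 vector3_eq_iff
    by simp
qed

lemma norm_nF: "norm (nF z) = 1"
proof -
  have "(- q (fst z) * cos (2 * pi * snd z))\<^sup>2 + (- q (fst z) * sin (2 * pi * snd z))\<^sup>2 + (p (fst z))\<^sup>2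
     = (q (fst z))\<^sup>2 * ((cos (2 * pi * snd z))\<^sup>2 + (sin (2 * pi * snd z))\<^sup>2) + (p (fst z))\<^sup>2"
    by algebra
  also have "\<dots> = 1" using speed[of "fst z"] by simp
  finally show ?thesis unfolding nF_def norm_vector3 by simp
qed

lemma norm_surface_normal: "norm (surface_normal F z) = 2 * pi * s * f (fst z)"
  using s_pos f_pos[of "fst z"] by (simp add: surface_normal_eq norm_nF)

lemma gauss_map_eq: "gauss_map F = nF"
proof
  fix z :: "real \<times> real"
  have "2 * pi * s * f (fst z) \<noteq> 0" using s_pos f_pos[of "fst z"] by simp
  then show "gauss_map F z = nF z"
    unfolding gauss_map_def norm_surface_normal by (simp only: surface_normal_eq scaleR_scaleR left_inverse scaleR_one simp_thms not_False_eq_True)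
qed

text \<open>In the frame of meridian and parallel the Weingarten map is diagonal: the derivative of
  the Gauss map is \<open>- dF\<close> after scaling the two directions by \<open>k\<close> and
  \<open>q / f\<close>.\<close>

lemma mean_curvature_eq:
  assumes dp: "(p has_real_derivative - (s * k * q (fst z))) (at (fst z))"
    and dq: "(q has_real_derivative s * k * p (fst z)) (at (fst z))"
  shows "mean_curvature F z = (k + q (fst z) / f (fst z)) / 2"
proof -
  let ?l = "q (fst z) / f (fst z)"
  have fd: "frechet_derivative F (at z) = dF z"
    using frechet_derivative_at[OF has_derivative_F] by simp
  have c: "((\<lambda>v. cos (2 * pi * v)) has_real_derivative - (2 * pi) * sin (2 * pi * v)) (at v)"
    and sn: "((\<lambda>v. sin (2 * pi * v)) has_real_derivative (2 * pi) * cos (2 * pi * v)) (at v)" for v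
    by (auto intro!: derivative_eq_intros)
  note d = has_derivative_fst_comp[OF dp] has_derivative_fst_comp[OF dq]
    has_derivative_snd_comp[OF c] has_derivative_snd_comp[OF sn]
  have nf: "nF = (\<lambda>z. vector [- (q (fst z) * cos (2 * pi * snd z)), - (q (fst z) * sin (2 * pi * snd z)), p (fst z)])"
    by (simp add: nF_def fun_eq_iff)
  have "(nF has_derivative (\<lambda>w. - dF z (k * fst w, ?l * snd w))) (at z)"
    unfolding nf
    by (rule has_derivative_eq_rhs, rule has_derivative_vector3,
        rule has_derivative_minus[OF has_derivative_mult[OF d(2) d(3)]],
        rule has_derivative_minus[OF has_derivative_mult[OF d(2) d(4)]], rule d(1))
      (use f_pos[of "fst z"] in \<open>simp add: dF_def fun_eq_iff minus_vector3 vector3_eq_iff algebra_simps\<close>)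
  then have "frechet_derivative (gauss_map F) (at z) = (\<lambda>w. - dF z (k * fst w, ?l * snd w))"
    unfolding gauss_map_eq by (rule frechet_derivative_at[symmetric])
  then have "principal_curvatures F z = {\<kappa>. \<exists>w. w \<noteq> 0 \<and> dF z (k * fst w, ?l * snd w) = \<kappa> *\<^sub>R dF z w}"
    unfolding principal_curvatures_def fd by simp
  also have "\<dots> = {\<kappa>. \<exists>w. w \<noteq> 0 \<and> (k - \<kappa>) * fst w = 0 \<and> (?l - \<kappa>) * snd w = 0}"
  proof -
    \<comment> \<open>Injectivity of \<open>dF z\<close> turns the eigenvalue equation between space
      vectors into two scalar equations in the parameter plane.\<close>
    have "dF z (k * fst w, ?l * snd w) = \<kappa> *\<^sub>R dF z w \<longleftrightarrow> (k - \<kappa>) * fst w = 0 \<and> (?l - \<kappa>) * snd w = 0" for w \<kappa>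
    proof -
      have "dF z (k * fst w, ?l * snd w) - \<kappa> *\<^sub>R dF z w = dF z ((k * fst w, ?l * snd w) - \<kappa> *\<^sub>R w)"
        using linear_dF[of z] by (simp add: linear_diff linear_scale)
      moreover have "(k * fst w, ?l * snd w) - \<kappa> *\<^sub>R w = ((k - \<kappa>) * fst w, (?l - \<kappa>) * snd w)"
        by (simp add: prod_eq_iff left_diff_distrib)
      ultimately have "dF z (k * fst w, ?l * snd w) = \<kappa> *\<^sub>R dF z w \<longleftrightarrow> dF z ((k - \<kappa>) * fst w, (?l - \<kappa>) * snd w) = 0"
        by (metis right_minus_eq)
      also have "\<dots> \<longleftrightarrow> ((k - \<kappa>) * fst w, (?l - \<kappa>) * snd w) = 0"
        using dF_inj_aux linear_0[OF linear_dF] by metis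
      finally show ?thesis by (simp only: zero_prod_def prod.inject)
    qed
    then show ?thesis by simp
  qed
  also have "\<dots> = {k, ?l}"
  proof (intro set_eqI iffI)
    fix \<kappa> assume "\<kappa> \<in> {\<kappa>. \<exists>w. w \<noteq> 0 \<and> (k - \<kappa>) * fst w = 0 \<and> (?l - \<kappa>) * snd w = 0}"
    then show "\<kappa> \<in> {k, ?l}" by (auto simp: prod_eq_iff)
  next
    fix \<kappa> assume "\<kappa> \<in> {k, ?l}"
    then consider "\<kappa> = k" | "\<kappa> = ?l" by blast
    then show "\<kappa> \<in> {\<kappa>. \<exists>w. w \<noteq> 0 \<and> (k - \<kappa>) * fst w = 0 \<and> (?l - \<kappa>) * snd w = 0}"
    proof cases
      case 1 then show ?thesis by (auto intro!: exI[of _ "(1, 0)"] simp: prod_eq_iff)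
    next
      case 2 then show ?thesis by (auto intro!: exI[of _ "(0, 1)"] simp: prod_eq_iff)
    qed
  qed
  finally show ?thesis unfolding mean_curvature_def by (simp add: min_def max_def)
qed

lemma integral_area_measure:
  assumes h: "h \<in> borel_measurable borel" and bd: "\<And>u. \<bar>h u\<bar> \<le> B"
    and S: "finite S" and eq: "\<And>z. fst z \<in> {0..1} - S \<Longrightarrow> \<phi> z = h (fst z)"
  shows "integral\<^sup>L (area_measure F) \<phi> = 2 * pi * s * integral {0..1} (\<lambda>u. f u * h u)"
proof -
  note [measurable] = h
  have [measurable]: "f \<in> borel_measurable borel"
    using continuous_f by (rule borel_measurable_continuous_onI)
  obtain A where A: "\<And>u. \<bar>f u\<bar> \<le> A" using f_bounded by blast
  have m\<phi>: "\<phi> \<in> borel_measurable (lebesgue_on ({0..1} \<times> {0..1}))"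
    by (rule integral_unit_square_fst(1)[OF assms])
  let ?w = "\<lambda>z :: real \<times> real. 2 * pi * s * f (fst z)"
  have wb: "\<bar>2 * pi * s * f u\<bar> \<le> 2 * pi * s * A" for u
    using A[of u] s_pos by (simp add: abs_mult)
  have mw: "?w \<in> borel_measurable (lebesgue_on ({0..1} \<times> {0..1}))"
    using integral_unit_square_fst(1)[of "\<lambda>u. 2 * pi * s * f u" "2 * pi * s * A" "{}" "?w"] wb by simp
  have "integral\<^sup>L (area_measure F) \<phi> = integral\<^sup>L (lebesgue_on ({0..1} \<times> {0..1})) (\<lambda>z. ?w z *\<^sub>R \<phi> z)"
    unfolding area_measure_def norm_surface_normal
    by (rule integral_density[OF m\<phi> mw]) (use s_pos f_pos in \<open>auto intro!: AE_I2 simp: less_imp_le\<close>)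
  also have "\<dots> = integral {0..1} (\<lambda>u. (2 * pi * s * f u) * h u)"
  proof (rule integral_unit_square_fst(2)[where S = S and B = "(2 * pi * s * A) * B"])
    show "\<bar>2 * pi * s * f u * h u\<bar> \<le> 2 * pi * s * A * B" for u
      using mult_mono[OF wb[of u] bd[of u]] order.trans[OF abs_ge_zero wb[of u]] by (simp add: abs_mult)
  qed (use S eq in auto)
  also have "\<dots> = 2 * pi * s * integral {0..1} (\<lambda>u. f u * h u)"
    by (simp add: mult.assoc)
  finally show ?thesis .
qed

lemma area_eq: "surface_area F = 2 * pi * s * integral {0..1} f"
  unfolding surface_area_def
  by (subst integral_area_measure[where h = "\<lambda>_. 1" and B = 1 and S = "{}"]) auto

lemma willmore_eq:
  assumes "H \<in> borel_measurable borel" "\<And>u. \<bar>H u\<bar> \<le> B" "finite S"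
    "\<And>z. fst z \<in> {0..1} - S \<Longrightarrow> (mean_curvature F z)\<^sup>2 = H (fst z)"
  shows "willmore F = 2 * pi * s * integral {0..1} (\<lambda>u. f u * H u)"
  unfolding willmore_def by (rule integral_area_measure[OF assms])

text \<open>The height is removed from the integrand by integrating the derivative of
  \<open>f^2 * g\<close> over a period, where periodicity makes the boundary terms cancel. The
  result is the disc formula, the integral of \<open>- pi r^2 dz\<close> along the closed
  profile.\<close>

lemma vol_eq: "enclosed_vol F = - pi * s * integral {0..1} (\<lambda>u. (f u)\<^sup>2 * q u)"
proof -
  have cp: "continuous_on A p" "continuous_on A q" for A
    using lip_p lip_q lipschitz_on_continuous_on continuous_on_subset by blast+
  obtain A A' where A: "\<And>u. \<bar>f u\<bar> \<le> A" "\<And>u. \<bar>g u\<bar> \<le> A'" using f_bounded g_bounded by blast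
  have inner: "gauss_map F z \<bullet> F z = p (fst z) * g (fst z) - q (fst z) * f (fst z)" for z
  proof -
    have "gauss_map F z \<bullet> F z = - q (fst z) * f (fst z) * ((cos (2 * pi * snd z))\<^sup>2 + (sin (2 * pi * snd z))\<^sup>2) + p (fst z) * g (fst z)"
      unfolding gauss_map_eq nF_def unfolding F_eq inner_vector3 by algebra
    then show ?thesis by simp
  qed
  have "\<bar>p u * g u - q u * f u\<bar> \<le> A' + A" for u
  proof -
    have "\<bar>p u * g u\<bar> \<le> 1 * A'" "\<bar>q u * f u\<bar> \<le> 1 * A"
      unfolding abs_mult using p_le q_le A by (intro mult_mono; simp)+
    then show ?thesis by linarith
  qed
  then have "enclosed_vol F = 1 / 3 * (2 * pi * s * integral {0..1} (\<lambda>u. f u * (p u * g u - q u * f u)))"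
    unfolding enclosed_vol_def
    by (subst integral_area_measure[where h = "\<lambda>u. p u * g u - q u * f u" and S = "{}" and B = "A' + A"])
      (auto simp: inner intro!: borel_measurable_continuous_onI continuous_intros cp continuous_f continuous_g)
  also have "integral {0..1} (\<lambda>u. f u * (p u * g u - q u * f u)) = - (3 / 2) * integral {0..1} (\<lambda>u. (f u)\<^sup>2 * q u)"
  proof -
    have "((\<lambda>u. 2 * s * (f u * p u * g u) + s * ((f u)\<^sup>2 * q u)) has_integral (f 1)\<^sup>2 * g 1 - (f 0)\<^sup>2 * g 0) {0..1}"
    proof (rule fundamental_theorem_of_calculus)
      fix u :: real
      have "((\<lambda>u. (f u)\<^sup>2 * g u) has_real_derivative 2 * s * (f u * p u * g u) + s * ((f u)\<^sup>2 * q u)) (at u)"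
        by (rule derivative_eq_intros DERIV_f DERIV_g refl)+ (simp add: power2_eq_square algebra_simps)
      then show "((\<lambda>u. (f u)\<^sup>2 * g u) has_vector_derivative 2 * s * (f u * p u * g u) + s * ((f u)\<^sup>2 * q u)) (at u within {0..1})"
        using has_real_derivative_iff_has_vector_derivative has_vector_derivative_at_within by blast
    qed simp
    moreover have "(f 1)\<^sup>2 * g 1 - (f 0)\<^sup>2 * g 0 = 0" using per(1)[of 0] per(2)[of 0] by simp
    ultimately have 0: "integral {0..1} (\<lambda>u. 2 * s * (f u * p u * g u) + s * ((f u)\<^sup>2 * q u)) = 0"
      by (simp add: integral_unique)
    have i: "(\<lambda>u. f u * p u * g u) integrable_on {0..1}" "(\<lambda>u. (f u)\<^sup>2 * q u) integrable_on {0..1}"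
      by (intro integrable_continuous_real continuous_intros cp continuous_f continuous_g)+
    have "2 * s * integral {0..1} (\<lambda>u. f u * p u * g u) + s * integral {0..1} (\<lambda>u. (f u)\<^sup>2 * q u) = 0"
      using 0 i by (subst (asm) Henstock_Kurzweil_Integration.integral_add) (auto intro!: integrable_on_mult_right)
    then have "s * (2 * integral {0..1} (\<lambda>u. f u * p u * g u) + integral {0..1} (\<lambda>u. (f u)\<^sup>2 * q u)) = 0"
      by (simp add: algebra_simps)
    then have "integral {0..1} (\<lambda>u. f u * p u * g u) = - integral {0..1} (\<lambda>u. (f u)\<^sup>2 * q u) / 2"
      using s_pos by simp
    moreover have "integral {0..1} (\<lambda>u. f u * (p u * g u - q u * f u))
        = integral {0..1} (\<lambda>u. f u * p u * g u) - integral {0..1} (\<lambda>u. (f u)\<^sup>2 * q u)"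
      using i by (subst Henstock_Kurzweil_Integration.integral_diff[symmetric]) (auto simp: algebra_simps power2_eq_square)
    ultimately show ?thesis by simp
  qed
  finally show ?thesis by simp
qed

end

section \<open>Arc length of the unduloid and the nodoid\<close>

text \<open>The angles \<open>und_len a y t / a\<close> and \<open>t\<close> are related like the eccentric and the true anomaly on an
  ellipse of eccentricity \<open>y / a\<close>; the closed form has no branch jumps.\<close>

definition und_len :: "real \<Rightarrow> real \<Rightarrow> real \<Rightarrow> real" where
  "und_len a y t = a * (t - 2 * arctan (y * sin t / (a + sqrt (a\<^sup>2 - y\<^sup>2) + y * cos t)))"

text \<open>Law of sines in the triangle with sides \<open>1\<close>, \<open>c\<close> and the
  radius, for \<open>s\<close> between \<open>0\<close> and \<open>pi\<close>: the sides
  \<open>1\<close> and \<open>c\<close> enclose the angle \<open>nod_len c s\<close>, the angle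
  opposite to \<open>1\<close> is \<open>arcsin (sin s / c)\<close>, and the angle opposite to
  \<open>c\<close> is \<open>pi - s\<close>.\<close>

definition nod_len :: "real \<Rightarrow> real \<Rightarrow> real" where
  "nod_len c s = s - arcsin (sin s / c)"

locale unduloid =
  fixes a y :: real
  assumes y_pos: "0 < y" and y_less: "y < a"
begin

sublocale kenmotsu a y
  using y_pos y_less by unfold_locales auto

definition b :: real where "b = sqrt (a\<^sup>2 - y\<^sup>2)"

lemma sq_less: "y\<^sup>2 < a\<^sup>2"
  using y_pos y_less by (simp add: power_strict_mono)

lemma b_pos: "0 < b" and b_sq: "b\<^sup>2 = a\<^sup>2 - y\<^sup>2"
  unfolding b_def using sq_less by simp_all

lemma a_pos: "0 < a" using y_pos y_less by simp

lemma abs_y_cos: "\<bar>y * cos t\<bar> < a"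
proof -
  have "\<bar>y * cos t\<bar> \<le> y * 1" unfolding abs_mult using y_pos by (intro mult_mono) auto
  then show ?thesis using y_less by simp
qed

lemma plus_pos: "0 < a + y * cos t" and minus_pos: "0 < a - y * cos t"
  using abs_y_cos[of t] by (auto simp: abs_less_iff)

lemma rad_arg_pos': "0 < a\<^sup>2 - y\<^sup>2 * (cos t)\<^sup>2"
proof -
  have "a\<^sup>2 - y\<^sup>2 * (cos t)\<^sup>2 = (a + y * cos t) * (a - y * cos t)" by algebra
  then show ?thesis using plus_pos minus_pos by simp
qed

lemma und_len_trig:
  shows "cos (und_len a y t / a) = (y + a * cos t) / (a + y * cos t)"
    and "sin (und_len a y t / a) = b * sin t / (a + y * cos t)"
proof -
  define d C S where "d = a + b" and "C = cos t" and "S = sin t"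
  define M N T where "M = d + y * C" and "N = y * S" and "T = N / M"
  have d: "0 < d" and M: "0 < M"
    using a_pos b_pos plus_pos[of t] by (auto simp: d_def M_def C_def)
  have CS: "C\<^sup>2 + S\<^sup>2 = 1" by (simp add: C_def S_def)
  have p: "0 < a + y * C" using plus_pos by (simp add: C_def)
  \<comment> \<open>The summand \<open>b\<close> in the denominator of \<open>und_len\<close> is
    chosen for this factorization. It holds because \<open>b^2 = a^2 - y^2\<close>, and it lets the
    common factor \<open>2 * d\<close> cancel from the double-angle formulas.\<close>
  have MN: "M\<^sup>2 + N\<^sup>2 = 2 * d * (a + y * C)"
    using CS b_sq unfolding M_def N_def d_def by algebra
  have ca: "(cos (arctan T))\<^sup>2 = M\<^sup>2 / (M\<^sup>2 + N\<^sup>2)"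
  proof -
    have "1 + T\<^sup>2 = (M\<^sup>2 + N\<^sup>2) / M\<^sup>2" using M by (simp add: T_def field_simps)
    then show ?thesis by (simp add: cos_arctan power_divide)
  qed
  have sa: "sin (arctan T) = T * cos (arctan T)"
    by (simp add: cos_arctan sin_arctan)
  have c2: "cos (2 * arctan T) = (M\<^sup>2 - N\<^sup>2) / (2 * d * (a + y * C))"
  proof -
    have "cos (2 * arctan T) = (1 - T\<^sup>2) * (cos (arctan T))\<^sup>2"
      unfolding cos_double sa by algebra
    also have "\<dots> = (M\<^sup>2 - N\<^sup>2) / (M\<^sup>2 + N\<^sup>2)"
    proof -
      have "1 - T\<^sup>2 = (M\<^sup>2 - N\<^sup>2) / M\<^sup>2" using M by (simp add: T_def field_simps)
      then show ?thesis unfolding ca using M by simp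
    qed
    finally show ?thesis by (simp only: MN)
  qed
  have s2: "sin (2 * arctan T) = 2 * M * N / (2 * d * (a + y * C))"
  proof -
    have "sin (2 * arctan T) = 2 * T * (cos (arctan T))\<^sup>2"
      by (simp add: sin_double sa power2_eq_square)
    also have "\<dots> = 2 * M * N / (M\<^sup>2 + N\<^sup>2)"
      unfolding ca unfolding T_def using M by (simp add: power2_eq_square)
    finally show ?thesis by (simp only: MN)
  qed
  have v: "und_len a y t / a = t - 2 * arctan T"
    using a_pos by (simp add: und_len_def T_def N_def M_def d_def b_def S_def C_def)
  have nz: "2 * d * (a + y * C) \<noteq> 0" using d p by simp
  have "cos (und_len a y t / a) = (C * (M\<^sup>2 - N\<^sup>2) + S * (2 * M * N)) / (2 * d * (a + y * C))"
    unfolding v cos_diff c2 s2 by (simp add: C_def S_def add_divide_distrib)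
  also have "C * (M\<^sup>2 - N\<^sup>2) + S * (2 * M * N) = 2 * d * (y + a * C)"
    using CS b_sq unfolding M_def N_def d_def by algebra
  also have "2 * d * (y + a * C) / (2 * d * (a + y * C)) = (y + a * C) / (a + y * C)"
    using d by simp
  finally show "cos (und_len a y t / a) = (y + a * cos t) / (a + y * cos t)"
    by (simp add: C_def)
  have "sin (und_len a y t / a) = (S * (M\<^sup>2 - N\<^sup>2) - C * (2 * M * N)) / (2 * d * (a + y * C))"
    unfolding v sin_diff c2 s2 C_def[symmetric] S_def[symmetric] by (simp only: times_divide_eq_right[symmetric] diff_divide_distrib[symmetric]) (simp add: diff_divide_distrib right_diff_distrib)
  also have "S * (M\<^sup>2 - N\<^sup>2) - C * (2 * M * N) = 2 * d * (b * S)"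
    using CS b_sq unfolding M_def N_def d_def by algebra
  also have "2 * d * (b * S) / (2 * d * (a + y * C)) = b * S / (a + y * C)"
    using d by simp
  finally show "sin (und_len a y t / a) = b * sin t / (a + y * cos t)"
    by (simp add: C_def S_def)
qed

lemma DERIV_und_len: "(und_len a y has_real_derivative a * b / (a + y * cos t)) (at t)"
proof -
  define d C S where "d = a + b" and "C = cos t" and "S = sin t"
  define M N where "M = d + y * C" and "N = y * S"
  have d: "0 < d" and M: "0 < M"
    using a_pos b_pos plus_pos[of t] by (auto simp: d_def M_def C_def)
  have CS: "C\<^sup>2 + S\<^sup>2 = 1" by (simp add: C_def S_def)
  have p: "0 < a + y * C" using plus_pos by (simp add: C_def)
  have MN: "M\<^sup>2 + N\<^sup>2 = 2 * d * (a + y * C)"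
    using CS b_sq unfolding M_def N_def d_def by algebra
  have "((\<lambda>t. y * sin t / (d + y * cos t)) has_real_derivative
      (y * C * M + N * N) / M\<^sup>2) (at t)"
    using M by (auto intro!: derivative_eq_intros simp: M_def N_def C_def S_def power2_eq_square)
  from DERIV_chain2[OF DERIV_arctan this]
  have "((\<lambda>t. arctan (y * sin t / (d + y * cos t))) has_real_derivative
      inverse (1 + (N / M)\<^sup>2) * ((y * C * M + N * N) / M\<^sup>2)) (at t)"
    by (simp add: M_def N_def C_def S_def)
  moreover have "inverse (1 + (N / M)\<^sup>2) * ((y * C * M + N * N) / M\<^sup>2) = (y * C * M + N * N) / (M\<^sup>2 + N\<^sup>2)"
  proof -
    have "1 + (N / M)\<^sup>2 = (M\<^sup>2 + N\<^sup>2) / M\<^sup>2" using M by (simp add: field_simps)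
    then show ?thesis using M by simp
  qed
  ultimately have "((\<lambda>t. a * (t - 2 * arctan (y * sin t / (d + y * cos t)))) has_real_derivative
      a * (1 - 2 * ((y * C * M + N * N) / (M\<^sup>2 + N\<^sup>2)))) (at t)"
    by (intro DERIV_cmult DERIV_diff DERIV_ident) simp
  moreover have "1 - 2 * ((y * C * M + N * N) / (M\<^sup>2 + N\<^sup>2)) = b / (a + y * C)"
  proof -
    have "M\<^sup>2 + N\<^sup>2 - 2 * (y * C * M + N * N) = 2 * d * b"
      using CS b_sq unfolding M_def N_def d_def by algebra
    moreover have "M\<^sup>2 + N\<^sup>2 \<noteq> 0" unfolding MN using d p by simp
    ultimately have "1 - 2 * ((y * C * M + N * N) / (M\<^sup>2 + N\<^sup>2)) = 2 * d * b / (M\<^sup>2 + N\<^sup>2)"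
      by (simp add: field_simps)
    also have "\<dots> = b / (a + y * C)" unfolding MN using d by simp
    finally show ?thesis .
  qed
  ultimately show ?thesis by (simp add: und_len_def[abs_def] d_def b_def C_def)
qed

lemma und_len_0 [simp]: "und_len a y 0 = 0" and und_len_2pi: "und_len a y (2 * pi) = 2 * pi * a"
  by (simp_all add: und_len_def)

lemma continuous_und_len: "continuous_on A (und_len a y)"
  using DERIV_und_len by (auto intro!: continuous_at_imp_continuous_on intro: DERIV_isCont)

lemma und_len_mono: "s < t \<Longrightarrow> und_len a y s < und_len a y t"
  by (rule DERIV_pos_imp_increasing) (use DERIV_und_len a_pos b_pos plus_pos in \<open>auto intro!: exI simp: divide_pos_pos\<close>)

lemma und_len_range: "0 \<le> t \<Longrightarrow> t \<le> 2 * pi \<Longrightarrow> und_len a y t \<in> {0..2 * pi * a}"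
  using und_len_mono[of 0 t] und_len_mono[of t "2 * pi"] und_len_2pi by (cases "t = 0"; cases "t = 2 * pi") auto

abbreviation "R t \<equiv> sqrt (a\<^sup>2 - y\<^sup>2 * (cos t)\<^sup>2)"

lemma R_pos: "0 < R t" and R_sq: "(R t)\<^sup>2 = (a + y * cos t) * (a - y * cos t)"
  using rad_arg_pos'[of t] by (simp_all add: power2_eq_square algebra_simps)

lemma rad_und_len: "ken_rad a y (und_len a y t) = b * ((a - y * cos t) / R t)"
proof -
  have p: "a + y * cos t \<noteq> 0" using plus_pos[of t] by simp
  have "a\<^sup>2 + y\<^sup>2 - 2 * a * y * ((y + a * cos t) / (a + y * cos t))
      = ((a\<^sup>2 + y\<^sup>2) * (a + y * cos t) - 2 * a * y * (y + a * cos t)) / (a + y * cos t)"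
    using p by (simp add: field_simps)
  also have "(a\<^sup>2 + y\<^sup>2) * (a + y * cos t) - 2 * a * y * (y + a * cos t) = b\<^sup>2 * (a - y * cos t)"
    unfolding b_sq by algebra
  also have "b\<^sup>2 * (a - y * cos t) / (a + y * cos t) = (b * ((a - y * cos t) / R t))\<^sup>2"
    unfolding power_mult_distrib power_divide R_sq using minus_pos[of t] by (simp add: power2_eq_square)
  finally have "ken_rad a y (und_len a y t) = sqrt ((b * ((a - y * cos t) / R t))\<^sup>2)"
    unfolding ken_rad_def und_len_trig by simp
  also have "\<dots> = b * ((a - y * cos t) / R t)"
    using b_pos minus_pos[of t] R_pos[of t] by simp
  finally show ?thesis .
qed

lemma tz_und_len: "ken_tz a y (und_len a y t) = b / R t"
proof -
  have p: "a + y * cos t \<noteq> 0" using plus_pos[of t] by simp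
  have "a - y * ((y + a * cos t) / (a + y * cos t)) = b\<^sup>2 / (a + y * cos t)"
    unfolding b_sq using p by (simp add: field_simps power2_eq_square)
  then have "ken_tz a y (und_len a y t) = b\<^sup>2 / (a + y * cos t) / (b * ((a - y * cos t) / R t))"
    unfolding ken_tz_def rad_und_len und_len_trig by simp
  also have "\<dots> = b * R t / ((a + y * cos t) * (a - y * cos t))"
    using b_pos R_pos[of t] by (simp add: power2_eq_square)
  also have "\<dots> = b / R t"
  proof -
    have "b * r / r\<^sup>2 = b / r" for r :: real by (simp add: power2_eq_square)
    then show ?thesis unfolding R_sq[symmetric] .
  qed
  finally show ?thesis .
qed

lemma continuous_R: "continuous_on A R"
  by (intro continuous_intros)

text \<open>Both heights vanish at \<open>t = 0\<close> and have the same derivative on the open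
  period. At the ends only continuity enters, in keeping with the domain of
  \<open>DERIV_hgt\<close>.\<close>

lemma hgt_und_len:
  assumes "0 \<le> t" "t \<le> 2 * pi"
  shows "ken_hgt a y (und_len a y t) = snd (unduloid_arc a y t)"
proof -
  let ?f = "\<lambda>t. ken_hgt a y (und_len a y t)
    - (integral {0..t} R - y * sin t * ((a - y * cos t) / R t))"
  have "?f t = ?f 0"
  proof (rule DERIV_isconst2[of 0 "2 * pi"])
    show "continuous_on {0..2 * pi} ?f"
      by (intro continuous_intros continuous_on_compose2[OF continuous_hgt[of "{0..2 * pi * a}"] continuous_und_len]
            indefinite_integral_continuous_1 integrable_continuous_real)
        (use und_len_range R_pos in \<open>auto simp: less_imp_neq[symmetric]\<close>)
    fix t :: real assume t: "0 < t" "t < 2 * pi"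
    let ?C = "cos t" and ?S = "sin t"
    have "0 < und_len a y t" using und_len_mono[of 0 t] t by simp
    from DERIV_chain2[OF DERIV_hgt[OF this] DERIV_und_len]
    have 1: "((\<lambda>t. ken_hgt a y (und_len a y t)) has_real_derivative b / R t * (a * b / (a + y * ?C))) (at t)"
      by (simp add: tz_und_len)
    have 2: "((\<lambda>t. integral {0..t} R) has_real_derivative R t) (at t)"
      by (rule integral_has_real_derivative_at[OF continuous_R]) (use t in simp)
    have dR: "(R has_real_derivative y\<^sup>2 * ?C * ?S / R t) (at t)"
      using rad_arg_pos'[of t] by (auto intro!: derivative_eq_intros simp: field_simps)
    have 3: "((\<lambda>t. y * sin t * ((a - y * cos t) / R t)) has_real_derivative
       (y * ?C * ((a - y * ?C) / R t) + y * ?S * ((y * ?S * R t - (a - y * ?C) * (y\<^sup>2 * ?C * ?S / R t)) / (R t * R t)))) (at t)"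
    proof -
      have d1: "((\<lambda>t. y * sin t) has_real_derivative y * ?C) (at t)"
        and d2: "((\<lambda>t. a - y * cos t) has_real_derivative y * ?S) (at t)"
        by (auto intro!: derivative_eq_intros)
      have "R t \<noteq> 0" using R_pos[of t] by linarith
      from DERIV_mult[OF d1 DERIV_divide[OF d2 dR this]] show ?thesis
        by (simp only: mult.commute add.commute)
    qed
    have 4: "b / R t * (a * b / (a + y * ?C)) - (R t - (y * ?C * ((a - y * ?C) / R t)
        + y * ?S * ((y * ?S * R t - (a - y * ?C) * (y\<^sup>2 * ?C * ?S / R t)) / (R t * R t)))) = 0"
    proof -
      define r C S where "r = R t" and "C = ?C" and "S = ?S"
      have r: "r \<noteq> 0" "r\<^sup>2 = (a + y * C) * (a - y * C)" using R_pos[of t] unfolding r_def C_def R_sq by linarith+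
      have CS: "C\<^sup>2 + S\<^sup>2 = 1" by (simp add: C_def S_def)
      \<comment> \<open>Treating the root \<open>r\<close> and its inverse \<open>u\<close> as
        unknowns bound by \<open>r * u = 1\<close> and \<open>r^2 = (a + y C) (a - y C)\<close>
        turns the claim into a polynomial identity modulo these relations.\<close>
      define u where "u = 1 / r"
      have ru: "r * u = 1" "u\<^sup>2 * r\<^sup>2 = 1" using r(1) by (simp_all add: u_def power_divide)
      have "a + y * C \<noteq> 0" "a - y * C \<noteq> 0" using plus_pos[of t] minus_pos[of t] unfolding C_def by linarith+
      then have ip: "1 / (a + y * C) = u\<^sup>2 * (a - y * C)"
        by (simp add: u_def power_divide r(2))
      have q: "X / r = X * u" for X by (simp add: u_def)
      have "b / r * (a * b * (1 / (a + y * C))) - (r - (y * C * ((a - y * C) / r)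
        + y * S * ((y * S * r - (a - y * C) * (y\<^sup>2 * C * S / r)) / r / r))) = 0"
        unfolding ip q using CS r(2) b_sq ru by algebra
      then show ?thesis by (simp add: r_def C_def S_def)
    qed
    show "(?f has_real_derivative 0) (at t)"
      using DERIV_diff[OF 1 DERIV_diff[OF 2 3]] unfolding 4 .
  qed (use assms pi_gt_zero in auto)
  then show ?thesis by (simp add: unduloid_arc_def)
qed

lemma unduloid_arc_eq:
  "0 \<le> t \<Longrightarrow> t \<le> 2 * pi \<Longrightarrow> unduloid_arc a y t = (ken_rad a y (und_len a y t), ken_hgt a y (und_len a y t))"
  by (simp add: prod_eq_iff hgt_und_len rad_und_len) (simp add: unduloid_arc_def b_def)

lemma hgt_period: "ken_hgt a y (2 * pi * a) = integral {0..2 * pi} R"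
  using hgt_und_len[of "2 * pi"] by (simp add: und_len_2pi unduloid_arc_def)

end

locale nodoid =
  fixes c :: real
  assumes c_gt: "1 < c"
begin

sublocale kenmotsu "-1" "-c"
  using c_gt by unfold_locales auto

abbreviation "S s \<equiv> sqrt (c\<^sup>2 - (sin s)\<^sup>2)"

lemma c_sq: "1 < c\<^sup>2"
  using c_gt by (simp add: one_less_power)

lemma S_arg_pos: "0 < c\<^sup>2 - (sin s)\<^sup>2"
proof -
  have "(sin s)\<^sup>2 \<le> 1" by (simp add: abs_square_le_1)
  then show ?thesis using c_sq by linarith
qed

lemma S_pos: "0 < S s" and S_sq: "(S s)\<^sup>2 = c\<^sup>2 - (sin s)\<^sup>2"
  using S_arg_pos[of s] by simp_all

lemma cos_less_S: "cos s < S s"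
proof (rule real_less_rsqrt)
  show "(cos s)\<^sup>2 < c\<^sup>2 - (sin s)\<^sup>2" using c_sq by (simp add: cos_squared_eq)
qed

lemma sin_div: "\<bar>sin s / c\<bar> < 1" "- 1 < sin s / c" "sin s / c < 1"
proof -
  have "\<bar>sin s\<bar> < c" using c_gt abs_sin_le_one[of s] by linarith
  then show "\<bar>sin s / c\<bar> < 1" using c_gt by simp
  then show "- 1 < sin s / c" "sin s / c < 1" by linarith+
qed

lemma nod_trig:
  shows "sin (arcsin (sin s / c)) = sin s / c" "cos (arcsin (sin s / c)) = S s / c"
proof -
  show "sin (arcsin (sin s / c)) = sin s / c" using sin_div[of s] by (intro sin_arcsin) auto
  have "cos (arcsin (sin s / c)) = sqrt (1 - (sin s / c)\<^sup>2)"
    using sin_div[of s] by (intro cos_arcsin) auto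
  also have "1 - (sin s / c)\<^sup>2 = (c\<^sup>2 - (sin s)\<^sup>2) / c\<^sup>2" using c_gt by (simp add: field_simps)
  finally show "cos (arcsin (sin s / c)) = S s / c" using c_gt by (simp add: real_sqrt_divide)
qed

lemma nod_len_trig:
  shows "c * cos (nod_len c s) = S s * cos s + (sin s)\<^sup>2"
  using c_gt by (simp add: nod_len_def cos_diff nod_trig field_simps power2_eq_square)

lemma rad_nod_len: "ken_rad (-1) (-c) (nod_len c s) = S s - cos s"
proof -
  have "(-1)\<^sup>2 + (-c)\<^sup>2 - 2 * (-1) * (-c) * cos (nod_len c s / -1) = 1 + c\<^sup>2 - 2 * (c * cos (nod_len c s))"
    by simp
  also have "\<dots> = (S s - cos s)\<^sup>2"
    unfolding nod_len_trig using S_sq[of s] sin_squared_eq[of s] by algebra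
  finally show ?thesis unfolding ken_rad_def using cos_less_S[of s] by simp
qed

lemma tz_nod_len: "ken_tz (-1) (-c) (nod_len c s) = cos s"
proof -
  have "-1 - (-c) * cos (nod_len c s / -1) = (S s * cos s + (sin s)\<^sup>2) - 1"
    by (simp add: nod_len_trig)
  also have "\<dots> = cos s * (S s - cos s)"
    using sin_squared_eq[of s] by algebra
  finally show ?thesis unfolding ken_tz_def rad_nod_len using cos_less_S[of s] by simp
qed

lemma DERIV_nod_len: "(nod_len c has_real_derivative 1 - cos s / S s) (at s)"
proof -
  have "((\<lambda>s. arcsin (sin s / c)) has_real_derivative inverse (sqrt (1 - (sin s / c)\<^sup>2)) * (cos s / c)) (at s)"
    by (rule DERIV_chain2[OF DERIV_arcsin]) (use sin_div[of s] c_gt in \<open>auto intro!: derivative_eq_intros\<close>)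
  moreover have "sqrt (1 - (sin s / c)\<^sup>2) = S s / c"
  proof -
    have "1 - (sin s / c)\<^sup>2 = (c\<^sup>2 - (sin s)\<^sup>2) / c\<^sup>2" using c_gt by (simp add: field_simps)
    then show ?thesis using c_gt by (simp add: real_sqrt_divide)
  qed
  ultimately have "((\<lambda>s. arcsin (sin s / c)) has_real_derivative cos s / S s) (at s)"
    using c_gt by simp
  then show ?thesis unfolding nod_len_def[abs_def] by (rule DERIV_diff[OF DERIV_ident])
qed

lemma nod_speed_pos: "0 < 1 - cos s / S s"
  using cos_less_S[of s] S_pos[of s] by simp

lemma nod_len_0 [simp]: "nod_len c 0 = 0" and nod_len_2pi: "nod_len c (2 * pi) = 2 * pi"
  by (simp_all add: nod_len_def)

lemma continuous_nod_len: "continuous_on A (nod_len c)"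
  using DERIV_nod_len by (auto intro!: continuous_at_imp_continuous_on intro: DERIV_isCont)

lemma nod_len_mono: "s < t \<Longrightarrow> nod_len c s < nod_len c t"
  by (rule DERIV_pos_imp_increasing) (use DERIV_nod_len nod_speed_pos in \<open>auto intro!: exI\<close>)

lemma nod_len_range: "0 \<le> t \<Longrightarrow> t \<le> 2 * pi \<Longrightarrow> nod_len c t \<in> {0..2 * pi}"
  using nod_len_mono[of 0 t] nod_len_mono[of t "2 * pi"] nod_len_2pi by (cases "t = 0"; cases "t = 2 * pi") auto

lemma hgt_nod_len:
  assumes "0 \<le> t" "t \<le> 2 * pi"
  shows "ken_hgt (-1) (-c) (nod_len c t) = integral {0..t} (\<lambda>x. cos x - (cos x)\<^sup>2 / S x)"
proof -
  have cont: "continuous_on A (\<lambda>x. cos x - (cos x)\<^sup>2 / S x)" for A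
    by (intro continuous_intros) (use S_pos in \<open>auto simp: less_imp_neq[symmetric]\<close>)
  let ?f = "\<lambda>t. ken_hgt (-1) (-c) (nod_len c t) - integral {0..t} (\<lambda>x. cos x - (cos x)\<^sup>2 / S x)"
  have "?f t = ?f 0"
  proof (rule DERIV_isconst2[of 0 "2 * pi"])
    show "continuous_on {0..2 * pi} ?f"
      by (intro continuous_intros continuous_on_compose2[OF continuous_hgt[of "{0..2 * pi}"] continuous_nod_len]
            indefinite_integral_continuous_1 integrable_continuous_real cont)
        (use nod_len_range in auto)
    fix t :: real assume t: "0 < t" "t < 2 * pi"
    have "0 < nod_len c t" using nod_len_mono[of 0 t] t by simp
    from DERIV_chain2[OF DERIV_hgt[OF this] DERIV_nod_len]
    have 1: "((\<lambda>t. ken_hgt (-1) (-c) (nod_len c t)) has_real_derivative cos t * (1 - cos t / S t)) (at t)"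
      by (simp add: tz_nod_len)
    have 2: "((\<lambda>t. integral {0..t} (\<lambda>x. cos x - (cos x)\<^sup>2 / S x)) has_real_derivative cos t - (cos t)\<^sup>2 / S t) (at t)"
      by (rule integral_has_real_derivative_at[OF cont]) (use t in simp)
    show "(?f has_real_derivative 0) (at t)"
      using DERIV_diff[OF 1 2] by (simp add: power2_eq_square right_diff_distrib)
  qed (use assms pi_gt_zero in auto)
  then show ?thesis by simp
qed

lemma nodoid_arc_eq:
  "0 \<le> t \<Longrightarrow> t \<le> 2 * pi \<Longrightarrow>
    nodoid_arc c t = (ken_rad (-1) (-c) (nod_len c t), delaunay_L c + ken_hgt (-1) (-c) (nod_len c t))"
  by (simp add: nodoid_arc_def hgt_nod_len rad_nod_len)

lemma hgt_period: "ken_hgt (-1) (-c) (2 * pi) = integral {0..2 * pi} (\<lambda>x. cos x - (cos x)\<^sup>2 / S x)"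
  using hgt_nod_len[of "2 * pi"] by (simp add: nod_len_2pi)

end

section \<open>The closed profile curve\<close>

text \<open>Two points in different unit cells are compared through the endpoints \<open>1\<close>
  and \<open>0\<close>, where \<open>h\<close> takes the same value; the two partial distances add
  up to at most \<open>y - x\<close>.\<close>

lemma lipschitz_frac:
  fixes h :: "real \<Rightarrow> real"
  assumes h: "C-lipschitz_on {0..1} h" and per: "h 0 = h 1"
  shows "C-lipschitz_on UNIV (\<lambda>u. h (frac u))"
proof -
  have C: "0 \<le> C" using h by (rule lipschitz_on_nonneg)
  have f: "frac u \<in> {0..1}" for u :: real by (simp add: frac_lt_1 less_imp_le)
  have le: "\<bar>h (frac x) - h (frac y)\<bar> \<le> C * (y - x)" if "x \<le> y" for x y
  proof (cases "\<lfloor>x\<rfloor> = \<lfloor>y\<rfloor>")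
    case True
    then have "\<bar>frac x - frac y\<bar> = y - x" using that by (simp add: frac_def)
    then show ?thesis using lipschitz_onD[OF h f f, of x y] by (simp add: dist_real_def)
  next
    case False
    then have "\<lfloor>x\<rfloor> + 1 \<le> \<lfloor>y\<rfloor>" using floor_mono[OF that] by simp
    then have "real_of_int \<lfloor>x\<rfloor> + 1 \<le> real_of_int \<lfloor>y\<rfloor>" by linarith
    then have d: "(1 - frac x) + frac y \<le> y - x" by (simp add: frac_def)
    have "\<bar>h (frac x) - h (frac y)\<bar> \<le> \<bar>h (frac x) - h 1\<bar> + \<bar>h 0 - h (frac y)\<bar>"
      using per by simp
    also have "\<dots> \<le> C * (1 - frac x) + C * frac y"
      using lipschitz_onD[OF h f, of 1 x] lipschitz_onD[OF h _ f, of 0 y] f[of x] f[of y]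
      by (intro add_mono) (simp_all add: dist_real_def)
    also have "\<dots> \<le> C * (y - x)"
      using mult_left_mono[OF d C] by (simp add: algebra_simps)
    finally show ?thesis .
  qed
  show ?thesis
  proof (rule lipschitz_onI[OF _ C])
    fix x y :: real
    show "dist (h (frac x)) (h (frac y)) \<le> C * dist x y"
      using le[of x y] le[of y x] by (cases "x \<le> y") (auto simp: dist_real_def abs_minus_commute)
  qed
qed

text \<open>Serves at the junctions, where each arc provides only a one-sided formula. Finitely many
  exceptions per interval do not disturb the fundamental theorem, so \<open>F\<close> is an
  indefinite integral of the continuous \<open>f\<close> up to a constant and inherits its
  derivative everywhere.\<close>

lemma DERIV_across_exceptions:
  fixes F f :: "real \<Rightarrow> real"
  assumes F: "continuous_on UNIV F" and f: "continuous_on UNIV f"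
    and fin: "\<And>a b. finite (S \<inter> {a..b})"
    and der: "\<And>x. x \<notin> S \<Longrightarrow> (F has_real_derivative f x) (at x)"
  shows "(F has_real_derivative f x) (at x)"
proof -
  define a where "a = x - 1"
  have ax: "a < x" by (simp add: a_def)
  have "(f has_integral F t - F a) {a..t}" if "a \<le> t" for t
  proof (rule fundamental_theorem_of_calculus_interior_strong[OF fin[of a t] that])
    fix s assume "s \<in> {a<..<t} - (S \<inter> {a..t})"
    then show "(F has_vector_derivative f s) (at s)"
      using der[of s] by (auto simp: has_real_derivative_iff_has_vector_derivative)
  qed (rule continuous_on_subset[OF F], simp)
  then have i: "integral {a..t} f = F t - F a" if "a \<le> t" for t
    using that by (simp add: integral_unique)
  have "((\<lambda>t. integral {a..t} f) has_vector_derivative f x) (at x within {a..x+1})"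
    by (rule integral_has_vector_derivative[OF continuous_on_subset[OF f]]) (auto simp: a_def)
  moreover have "at x within {a..x+1} = at x" by (rule at_within_interior) (auto simp: a_def)
  ultimately have "((\<lambda>t. integral {a..t} f) has_real_derivative f x) (at x)"
    by (simp add: has_real_derivative_iff_has_vector_derivative)
  then have "((\<lambda>t. F t - F a) has_real_derivative f x) (at x)"
    by (rule has_field_derivative_transform_within_open[where S = "{a<..}"]) (use i in \<open>auto simp: a_def[symmetric] ax\<close>)
  from DERIV_add[OF this DERIV_const[of "F a"]] show ?thesis by simp
qed

text \<open>\<open>J 1 1 \<rho>\<close> is the convex function \<open>I \<rho>\<close> of the
  overview. The case \<open>n = 3\<close> enters through the volume, whose integrand is the squared
  radius times \<open>ken_tz\<close>.\<close>

definition J :: "nat \<Rightarrow> real \<Rightarrow> real \<Rightarrow> real" where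
  "J n a y = integral {0..2 * pi} (\<lambda>v. sqrt (a\<^sup>2 + y\<^sup>2 - 2 * a * y * cos v) ^ n)"

text \<open>The closing conditions are phrased by heights over one period, the form used in gluing.
  Their link to the elliptic system, and the bound \<open>a < 1\<close> that follows from it, are
  established in \<open>delaunay_system_locale\<close>.\<close>

locale delaunay = und: unduloid a y + nod: nodoid c for a y c :: real +
  assumes eps: "a - y = c - 1" and a_less: "a < 1"
    and close_und: "ken_hgt a y (2 * pi * a) = delaunay_L c"
    and close_nod: "ken_hgt (-1) (-c) (2 * pi) = - delaunay_L c"
begin

abbreviation "L \<equiv> delaunay_L c"

lemma a_pos: "0 < a" by (rule und.a_pos)

lemma c_gt: "1 < c" by (rule nod.c_gt)

section \<open>Gluing functions of arc length on the two arcs\<close>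

definition len :: real where "len = 2 * pi * (a + 1)"

lemma len_pos: "0 < len" using a_pos by (simp add: len_def)

definition glue :: "(real \<Rightarrow> real) \<Rightarrow> (real \<Rightarrow> real) \<Rightarrow> real \<Rightarrow> real" where
  "glue h k u = (let w = len * frac u in if w \<le> 2 * pi * a then h w else k (w - 2 * pi * a))"

definition lam :: real where "lam = a / (a + 1)"

lemma lam: "0 < lam" "lam < 1" "len * lam = 2 * pi * a"
  using a_pos by (simp_all add: lam_def len_def)

lemma le_lam: "len * x \<le> 2 * pi * a \<longleftrightarrow> x \<le> lam" "len * x < 2 * pi * a \<longleftrightarrow> x < lam"
  using len_pos unfolding lam(3)[symmetric] by simp_all

lemma glue_eq: "glue h k u = (if frac u \<le> lam then h (len * frac u) else k (len * frac u - 2 * pi * a))"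
  by (simp add: glue_def le_lam)

lemma glue_mult: "glue h k u * glue h' k' u = glue (\<lambda>w. h w * h' w) (\<lambda>w. k w * k' w) u"
  and glue_power: "(glue h k u) ^ n = glue (\<lambda>w. h w ^ n) (\<lambda>w. k w ^ n) u"
  by (simp_all add: glue_def Let_def)

lemma glue_lipschitz:
  assumes h: "C-lipschitz_on {0..2 * pi * a} h" and k: "C'-lipschitz_on {0..2 * pi} k"
    and e: "h (2 * pi * a) = k 0" "k (2 * pi) = h 0"
  shows "\<exists>C. C-lipschitz_on UNIV (glue h k)"
proof -
  let ?g = "\<lambda>x. if x \<le> lam then h (len * x) else k (len * x - 2 * pi * a)"
  have pos: "0 \<le> C" "0 \<le> C'" using h k lipschitz_on_nonneg by blast+
  have d: "dist (len * x - r) (len * x' - r) = len * dist x x'" for x x' r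
    using len_pos by (simp add: dist_real_def right_diff_distrib[symmetric] abs_mult)
  have "(C * len)-lipschitz_on {0..lam} (\<lambda>x. h (len * x))"
  proof (rule lipschitz_onI)
    fix x x' assume "x \<in> {0..lam}" "x' \<in> {0..lam}"
    then have "dist (h (len * x)) (h (len * x')) \<le> C * dist (len * x) (len * x')"
      using len_pos by (intro lipschitz_onD[OF h]) (auto simp: le_lam)
    then show "dist (h (len * x)) (h (len * x')) \<le> C * len * dist x x'"
      using d[of x 0 x'] by simp
  qed (use pos len_pos in simp)
  moreover have "(C' * len)-lipschitz_on {lam..1} (\<lambda>x. k (len * x - 2 * pi * a))"
  proof (rule lipschitz_onI)
    fix x x' assume x: "x \<in> {lam..1}" "x' \<in> {lam..1}"
    have r: "len * x - 2 * pi * a \<in> {0..2 * pi}" if "x \<in> {lam..1}" for x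
    proof -
      have "len * lam \<le> len * x" "len * x \<le> len * 1" using that len_pos by (auto intro!: mult_left_mono)
      then show ?thesis using lam(3) by (simp add: len_def distrib_left)
    qed
    have "dist (k (len * x - 2 * pi * a)) (k (len * x' - 2 * pi * a)) \<le> C' * dist (len * x - 2 * pi * a) (len * x' - 2 * pi * a)"
      by (intro lipschitz_onD[OF k] r x)
    then show "dist (k (len * x - 2 * pi * a)) (k (len * x' - 2 * pi * a)) \<le> C' * len * dist x x'"
      by (simp add: d)
  qed (use pos len_pos in simp)
  ultimately have "(max (C * len) (C' * len))-lipschitz_on {0..1} ?g"
    by (rule lipschitz_on_concat_max) (simp add: lam e)
  moreover have "?g 0 = ?g 1"
    using lam e by (simp add: len_def distrib_left)
  ultimately have "(max (C * len) (C' * len))-lipschitz_on UNIV (\<lambda>u. ?g (frac u))"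
    by (rule lipschitz_frac)
  then show ?thesis by (auto simp: glue_eq[abs_def])
qed

definition junctions :: "real set" where "junctions = {u. frac u \<in> {0, lam}}"

lemma junctions_finite: "finite (junctions \<inter> {s..t})"
proof (rule finite_subset)
  show "junctions \<inter> {s..t} \<subseteq> (\<lambda>(n, x). of_int n + x) ` ({\<lfloor>s\<rfloor>..\<lfloor>t\<rfloor>} \<times> {0, lam})"
  proof
    fix u assume u: "u \<in> junctions \<inter> {s..t}"
    have "u = of_int \<lfloor>u\<rfloor> + frac u" by (simp add: frac_def)
    moreover have "\<lfloor>u\<rfloor> \<in> {\<lfloor>s\<rfloor>..\<lfloor>t\<rfloor>}" using u by (auto intro: floor_mono)
    ultimately show "u \<in> (\<lambda>(n, x). of_int n + x) ` ({\<lfloor>s\<rfloor>..\<lfloor>t\<rfloor>} \<times> {0, lam})"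
      using u unfolding junctions_def by (intro image_eqI[of _ _ "(\<lfloor>u\<rfloor>, frac u)"]) auto
  qed
qed auto

lemma DERIV_glue:
  assumes u: "u \<notin> junctions"
    and h: "\<And>w. 0 < w \<Longrightarrow> (h has_real_derivative h' w) (at w)"
    and k: "\<And>w. 0 < w \<Longrightarrow> (k has_real_derivative k' w) (at w)"
  shows "(glue h k has_real_derivative len * glue h' k' u) (at u)"
proof -
  have f: "frac u \<noteq> 0" "frac u \<noteq> lam" using u by (auto simp: junctions_def)
  then have pos: "0 < frac u" using frac_ge_0[of u] by linarith
  have Z: "u \<notin> \<int>" using f by simp
  have lin: "((\<lambda>u. len * frac u - r) has_real_derivative len) (at u)" for r
    using DERIV_diff[OF DERIV_cmult[OF DERIV_frac[OF Z], of len] DERIV_const[of r]] by simp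
  have ev: "frac \<midarrow>u\<rightarrow> frac u" using continuous_at_frac[OF Z] by (simp add: isCont_def)
  show ?thesis
  proof (cases "frac u < lam")
    case True
    have "((\<lambda>u. h (len * frac u)) has_real_derivative h' (len * frac u) * len) (at u)"
      using DERIV_chain2[OF h lin[of 0]] pos len_pos by simp
    moreover have "eventually (\<lambda>x. h (len * frac x) = glue h k x) (at u)"
      using order_tendstoD(2)[OF ev True] by eventually_elim (simp add: glue_eq)
    ultimately have "(glue h k has_real_derivative h' (len * frac u) * len) (at u)"
      using True by (subst has_field_derivative_cong_eventually[symmetric]) (auto simp: glue_eq)
    then show ?thesis using True by (simp add: glue_eq mult.commute)
  next
    case False
    then have gt: "lam < frac u" using f by simp
    then have "len * lam < len * frac u" using len_pos by simp
    then have "0 < len * frac u - 2 * pi * a" using lam by simp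
    then have "((\<lambda>u. k (len * frac u - 2 * pi * a)) has_real_derivative k' (len * frac u - 2 * pi * a) * len) (at u)"
      by (rule DERIV_chain2[OF k lin])
    moreover have "eventually (\<lambda>x. k (len * frac x - 2 * pi * a) = glue h k x) (at u)"
      using order_tendstoD(1)[OF ev gt] by eventually_elim (simp add: glue_eq)
    ultimately have "(glue h k has_real_derivative k' (len * frac u - 2 * pi * a) * len) (at u)"
      using gt by (subst has_field_derivative_cong_eventually[symmetric]) (auto simp: glue_eq)
    then show ?thesis using gt by (simp add: glue_eq mult.commute)
  qed
qed

lemma glue_has_integral:
  assumes h: "(h has_integral I) {0..2 * pi * a}" and k: "(k has_integral I') {0..2 * pi}"
  shows "(glue h k has_integral (I + I') / len) {0..1}"
proof -
  have "((\<lambda>x. h (len * x)) has_integral I / len) {0..lam}"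
  proof -
    have "2 * pi * a / len = lam" using lam len_pos by (simp add: field_simps)
    then show ?thesis using has_integral_affine_real[OF h len_pos, of 0] by simp
  qed
  then have 1: "(glue h k has_integral I / len) {0..lam}"
  proof (rule has_integral_spike_finite[of "{1}", rotated 2])
    fix x assume "x \<in> {0..lam} - {1}"
    then have "frac x = x" "x \<le> lam" using lam by (auto simp: frac_eq)
    then show "glue h k x = h (len * x)" by (simp add: glue_eq)
  qed simp
  have "((\<lambda>x. k (len * x - 2 * pi * a)) has_integral I' / len) {lam..1}"
  proof -
    have "2 * pi * a / len = lam" using lam len_pos by (simp add: field_simps)
    moreover have "(2 * pi + 2 * pi * a) / len = 1" using len_pos by (simp add: len_def algebra_simps)
    ultimately show ?thesis using has_integral_affine_real[OF k len_pos, of "2 * pi * a"] by simp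
  qed
  then have 2: "(glue h k has_integral I' / len) {lam..1}"
  \<comment> \<open>Both endpoints are exceptional: at \<open>lam\<close> the glued function still
    takes the value of the first piece, and at \<open>1\<close> it has wrapped around to
    \<open>h 0\<close>.\<close>
  proof (rule has_integral_spike_finite[of "{lam, 1}", rotated 2])
    fix x assume "x \<in> {lam..1} - {lam, 1}"
    then have "frac x = x" "\<not> x \<le> lam" using lam by (auto simp: frac_eq)
    then show "glue h k x = k (len * x - 2 * pi * a)" by (simp add: glue_eq)
  qed simp
  show ?thesis
    using has_integral_combine[OF _ _ 1 2] lam by (simp add: add_divide_distrib)
qed

definition f :: "real \<Rightarrow> real" where "f = glue (ken_rad a y) (ken_rad (-1) (-c))"
definition g :: "real \<Rightarrow> real" where "g = glue (ken_hgt a y) (\<lambda>w. L + ken_hgt (-1) (-c) w)"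
definition p :: "real \<Rightarrow> real" where "p = glue (ken_tr a y) (ken_tr (-1) (-c))"
definition q :: "real \<Rightarrow> real" where "q = glue (ken_tz a y) (ken_tz (-1) (-c))"

text \<open>All four arc ends have radius \<open>c - 1\<close> and upward axial tangent, so radius
  and tangent match at the junctions. Nothing comparable holds for \<open>ken_curv\<close>.\<close>

lemma ends:
  "ken_rad a y 0 = c - 1" "ken_rad a y (2 * pi * a) = c - 1"
  "ken_rad (-1) (-c) 0 = c - 1" "ken_rad (-1) (-c) (2 * pi) = c - 1"
  "ken_tr a y 0 = 0" "ken_tr a y (2 * pi * a) = 0" "ken_tr (-1) (-c) 0 = 0" "ken_tr (-1) (-c) (2 * pi) = 0"
  "ken_tz a y 0 = 1" "ken_tz a y (2 * pi * a) = 1" "ken_tz (-1) (-c) 0 = 1" "ken_tz (-1) (-c) (2 * pi) = 1"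
proof -
  have 1: "a\<^sup>2 + y\<^sup>2 - 2 * a * y = (c - 1)\<^sup>2" unfolding eps[symmetric] by algebra
  have 2: "1 + c\<^sup>2 - 2 * c = (c - 1)\<^sup>2" by algebra
  show "ken_rad a y 0 = c - 1" "ken_rad a y (2 * pi * a) = c - 1"
    "ken_rad (-1) (-c) 0 = c - 1" "ken_rad (-1) (-c) (2 * pi) = c - 1"
    using a_pos c_gt by (simp_all add: ken_rad_def 1 2)
  then show "ken_tr a y 0 = 0" "ken_tr a y (2 * pi * a) = 0" "ken_tr (-1) (-c) 0 = 0" "ken_tr (-1) (-c) (2 * pi) = 0"
    "ken_tz a y 0 = 1" "ken_tz a y (2 * pi * a) = 1" "ken_tz (-1) (-c) 0 = 1" "ken_tz (-1) (-c) (2 * pi) = 1"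
    using a_pos c_gt eps by (simp_all add: ken_tr_def ken_tz_def)
qed

lemma DERIV_f: "(f has_real_derivative len * p u) (at u)"
  and DERIV_g: "(g has_real_derivative len * q u) (at u)"
  and lip_p: "\<exists>C. C-lipschitz_on UNIV p" and lip_q: "\<exists>C. C-lipschitz_on UNIV q"
proof -
  show lip_p: "\<exists>C. C-lipschitz_on UNIV p"
  proof -
    obtain C C' where "C-lipschitz_on UNIV (ken_tr a y)" "C'-lipschitz_on UNIV (ken_tr (-1) (-c))"
      using und.tr_lipschitz nod.tr_lipschitz by blast
    then show ?thesis
      unfolding p_def by (intro glue_lipschitz) (auto simp: ends intro: lipschitz_on_subset)
  qed
  show lip_q: "\<exists>C. C-lipschitz_on UNIV q"
  proof -
    obtain C C' where "C-lipschitz_on UNIV (ken_tz a y)" "C'-lipschitz_on UNIV (ken_tz (-1) (-c))"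
      using und.tz_lipschitz nod.tz_lipschitz by blast
    then show ?thesis
      unfolding q_def by (intro glue_lipschitz) (auto simp: ends intro: lipschitz_on_subset)
  qed
  have cont: "continuous_on UNIV h" if "\<exists>C. C-lipschitz_on UNIV h" for h :: "real \<Rightarrow> real"
    using that lipschitz_on_continuous_on by blast
  have "\<exists>C. C-lipschitz_on UNIV f"
    unfolding f_def using glue_lipschitz[OF und.rad_lipschitz nod.rad_lipschitz] ends by simp
  moreover have "\<exists>C. C-lipschitz_on UNIV g"
  proof -
    have "1-lipschitz_on {0..2 * pi} (\<lambda>w. L + ken_hgt (-1) (-c) w)"
      using lipschitz_on_subset[OF nod.hgt_lipschitz, of "{0..2 * pi}"] by (auto simp: lipschitz_on_def)
    moreover have "1-lipschitz_on {0..2 * pi * a} (ken_hgt a y)"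
      by (rule lipschitz_on_subset[OF und.hgt_lipschitz]) auto
    ultimately show ?thesis
      unfolding g_def by (intro glue_lipschitz) (simp_all add: close_und close_nod)
  qed
  ultimately have cf: "continuous_on UNIV f" and cg: "continuous_on UNIV g" by (simp_all add: cont)
  show "(f has_real_derivative len * p u) (at u)"
  proof (rule DERIV_across_exceptions[OF cf _ junctions_finite])
    show "continuous_on UNIV (\<lambda>u. len * p u)" by (intro continuous_intros cont lip_p)
    show "(f has_real_derivative len * p x) (at x)" if "x \<notin> junctions" for x
      unfolding f_def p_def by (rule DERIV_glue[OF that und.DERIV_rad nod.DERIV_rad])
  qed
  have dn: "((\<lambda>w. L + ken_hgt (-1) (-c) w) has_real_derivative ken_tz (-1) (-c) w) (at w)" if "0 < w" for w
    using DERIV_add[OF DERIV_const[of L] nod.DERIV_hgt[OF that]] by simp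
  show "(g has_real_derivative len * q u) (at u)"
  proof (rule DERIV_across_exceptions[OF cg _ junctions_finite])
    show "continuous_on UNIV (\<lambda>u. len * q u)" by (intro continuous_intros cont lip_q)
    show "(g has_real_derivative len * q x) (at x)" if "x \<notin> junctions" for x
      unfolding g_def q_def by (rule DERIV_glue[OF that und.DERIV_hgt dn])
  qed
qed

section \<open>The profile has no self-intersections\<close>

lemma L_pos: "0 < L"
proof -
  have "0 < ken_tz a y t" for t
    unfolding ken_tz_def using und.minus_pos[of "t / a"] und.rad_pos[of t] by simp
  then have "ken_hgt a y 0 < ken_hgt a y (2 * pi * a)"
    by (intro und.hgt_strict_mono) (use a_pos in auto)
  then show ?thesis by (simp add: close_und)
qed

lemma hgt_und_mono:
  assumes "0 \<le> v" "v < w"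
  shows "ken_hgt a y v < ken_hgt a y w"
proof -
  have "0 < ken_tz a y t" for t
    unfolding ken_tz_def using und.minus_pos[of "t / a"] und.rad_pos[of t] by simp
  then show ?thesis using assms by (intro und.hgt_strict_mono) auto
qed

lemma hgt_und_reflect: "0 \<le> v \<Longrightarrow> v \<le> 2 * pi * a \<Longrightarrow> ken_hgt a y (2 * pi * a - v) = L - ken_hgt a y v"
  using und.hgt_reflect[of v] a_pos by (simp add: close_und)

lemma hgt_nod_reflect: "0 \<le> v \<Longrightarrow> v \<le> 2 * pi \<Longrightarrow> ken_hgt (-1) (-c) (2 * pi - v) = - L - ken_hgt (-1) (-c) v"
  using nod.hgt_reflect[of v] by (simp add: close_nod)

lemma hgt_und_half: "ken_hgt a y (pi * a) = L / 2"
  using hgt_und_reflect[of "pi * a"] a_pos by simp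

lemma hgt_nod_half: "ken_hgt (-1) (-c) pi = - L / 2"
  using hgt_nod_reflect[of pi] by simp

text \<open>The first half of the nodoid arc rises while \<open>1 \<le> c * cos u\<close>, staying
  above its start at \<open>0\<close>, and then falls strictly to the midpoint value
  \<open>- L / 2\<close>.\<close>

lemma hgt_nod_upper:
  assumes u: "0 \<le> u" "u < pi"
  shows "- L / 2 < ken_hgt (-1) (-c) u"
proof (cases "1 \<le> c * cos u")
  case True
  have "0 \<le> ken_tz (-1) (-c) t" if "t \<in> {0..u}" for t
  proof -
    have "cos u \<le> cos t" using that u by (intro cos_monotone_0_pi_le) auto
    then have "1 \<le> c * cos t" using True c_gt mult_left_mono[of "cos u" "cos t" c] by linarith
    then show ?thesis unfolding ken_tz_def using nod.rad_pos[of t] by simp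
  qed
  then have "0 \<le> ken_hgt (-1) (-c) u"
    unfolding ken_hgt_def by (intro Henstock_Kurzweil_Integration.integral_nonneg integrable_continuous_real nod.continuous_tz)
  then show ?thesis using L_pos by simp
next
  case False
  have "ken_tz (-1) (-c) t < 0" if "u < t" "t < pi" for t
  proof -
    have "cos t < cos u" using that u by (intro cos_monotone_0_pi) auto
    then have "c * cos t < 1" using False c_gt mult_strict_left_mono[of "cos t" "cos u" c] by linarith
    then show ?thesis unfolding ken_tz_def using nod.rad_pos[of t] by (simp add: divide_neg_pos)
  qed
  then have "ken_hgt (-1) (-c) pi < ken_hgt (-1) (-c) u"
    using u by (intro nod.hgt_strict_antimono) auto
  then show ?thesis by (simp add: hgt_nod_half)
qed

text \<open>Over a common radius \<open>r\<close> the axial components of the unit tangents add up to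
  \<open>(a (c\<^sup>2 - 1) + a\<^sup>2 - y\<^sup>2 + (1 - a) r\<^sup>2) / (2 a r)\<close>, so the gap between the two arcs keeps growing.\<close>

lemma nodoid_outside:
  assumes v: "0 < v" "v \<le> pi * a" and u: "0 \<le> u" "u \<le> pi"
    and r: "ken_rad a y v = ken_rad (-1) (-c) u"
  shows "- ken_hgt (-1) (-c) u < ken_hgt a y v"
proof -
  \<comment> \<open>\<open>A v\<close> is the cosine of the nodoid's arc length at the radius that
    the unduloid has at \<open>v\<close>. The map \<open>\<phi>\<close> is that arc length, so
    \<open>?D\<close> below measures the gap between the arcs over a common radius.\<close>
  define A where "A v = (1 + c\<^sup>2 - (ken_rad a y v)\<^sup>2) / (2 * c)" for v
  define \<phi> where "\<phi> v = arccos (A v)" for v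
  have rng: "-1 < A t \<and> A t \<le> 1 \<and> (t > 0 \<longrightarrow> A t < 1)" if t: "0 \<le> t" "t \<le> pi * a" for t
  proof -
    have "(ken_rad a y t)\<^sup>2 \<ge> (a - y)\<^sup>2" using und.rad_arg_ge by (simp add: und.rad_sq)
    then have 1: "(ken_rad a y t)\<^sup>2 \<ge> (c - 1)\<^sup>2" by (simp add: eps)
    have ay: "0 < a * y" by (rule und.ay)
    have "(ken_rad a y t)\<^sup>2 \<le> (a + y)\<^sup>2"
    proof -
      have "- (a * y) \<le> a * y * cos (t / a)" using mult_left_mono[OF cos_ge_minus_one[of "t / a"], of "a * y"] ay by simp
      then show ?thesis unfolding und.rad_sq by (simp add: power2_eq_square algebra_simps)
    qed
    \<comment> \<open>The largest radius of the unduloid is \<open>a + y\<close>, that of the nodoid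
      is \<open>c + 1\<close>; because \<open>a < 1\<close>, the nodoid reaches every radius of the
      unduloid before its midpoint.\<close>
    also have "\<dots> < (c + 1)\<^sup>2"
      using eps a_less a_pos und.y_pos und.y_less by (intro power_strict_mono) linarith+
    finally have 2: "(ken_rad a y t)\<^sup>2 < (c + 1)\<^sup>2" .
    have 3: "(ken_rad a y t)\<^sup>2 > (c - 1)\<^sup>2" if "0 < t"
    proof -
      have "cos (t / a) < cos 0"
        using \<open>0 < t\<close> t a_pos by (intro cos_monotone_0_pi) (auto simp: field_simps)
      then have "a * y * cos (t / a) < a * y * 1" by (intro mult_strict_left_mono ay) simp
      then have "(ken_rad a y t)\<^sup>2 > (a - y)\<^sup>2" unfolding und.rad_sq by (simp add: power2_eq_square algebra_simps)
      then show ?thesis by (simp add: eps)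
    qed
    have "(c - 1)\<^sup>2 = 1 + c\<^sup>2 - 2 * c" "(c + 1)\<^sup>2 = 1 + c\<^sup>2 + 2 * c" by algebra+
    then have "- (2 * c) < 1 + c\<^sup>2 - (ken_rad a y t)\<^sup>2" "1 + c\<^sup>2 - (ken_rad a y t)\<^sup>2 \<le> 2 * c"
      "0 < t \<Longrightarrow> 1 + c\<^sup>2 - (ken_rad a y t)\<^sup>2 < 2 * c"
      using 1 2 3 by linarith+
    then show ?thesis unfolding A_def using c_gt by (simp add: less_divide_eq)
  qed
  have cos\<phi>: "cos (\<phi> t) = A t" and \<phi>0: "0 \<le> \<phi> t" if "0 \<le> t" "t \<le> pi * a" for t
    using rng[OF that] unfolding \<phi>_def by (auto intro!: cos_arccos arccos_lbound)
  have rad\<phi>: "ken_rad (-1) (-c) (\<phi> t) = ken_rad a y t" if t: "0 \<le> t" "t \<le> pi * a" for t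
  proof -
    have "(ken_rad (-1) (-c) (\<phi> t))\<^sup>2 = (ken_rad a y t)\<^sup>2"
      unfolding nod.rad_sq using cos\<phi>[OF t] c_gt by (simp add: A_def)
    then show ?thesis using und.rad_pos[of t] nod.rad_pos[of "\<phi> t"] by (simp add: power2_eq_iff_nonneg less_imp_le)
  qed
  have \<phi>_0: "\<phi> 0 = 0"
  proof -
    have "A 0 = 1" using c_gt by (simp add: A_def ends field_simps power2_eq_square)
    then show ?thesis by (simp add: \<phi>_def)
  qed
  have \<phi>_v: "\<phi> v = u"
  proof -
    have "A v = cos u" unfolding A_def r nod.rad_sq using c_gt by (simp add: field_simps)
    then show ?thesis using u by (simp add: \<phi>_def arccos_cos)
  qed
  let ?D = "\<lambda>t. ken_hgt a y t + ken_hgt (-1) (-c) (\<phi> t)"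
  have "?D 0 < ?D v"
  proof (rule DERIV_pos_imp_increasing_open[OF v(1)])
    show "continuous_on {0..v} ?D"
    proof (intro continuous_on_add und.continuous_hgt)
      have cA: "continuous_on {0..v} A"
        unfolding A_def using c_gt by (intro continuous_intros und.continuous_rad) auto
      have "continuous_on {0..v} \<phi>"
        unfolding \<phi>_def using rng v by (intro continuous_on_arccos cA) (force simp: less_imp_le)
      then show "continuous_on {0..v} (\<lambda>t. ken_hgt (-1) (-c) (\<phi> t))"
        by (rule continuous_on_compose2[OF nod.continuous_hgt[OF order_refl]]) (use \<phi>0 v in auto)
    qed auto
    fix t assume t: "0 < t" "t < v"
    then have t': "0 \<le> t" "t \<le> pi * a" using v by auto
    have A: "-1 < A t" "A t < 1" using rng[OF t'] t by auto
    have sinpos: "0 < sqrt (1 - (A t)\<^sup>2)" using A by (simp add: abs_square_less_1 abs_less_iff)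
    have \<phi>pos: "0 < \<phi> t" unfolding \<phi>_def using arccos_lt_bounded[OF A] by simp
    let ?r = "ken_rad a y t" and ?trU = "ken_tr a y t" and ?tzU = "ken_tz a y t"
      and ?trN = "ken_tr (-1) (-c) (\<phi> t)" and ?tzN = "ken_tz (-1) (-c) (\<phi> t)"
    have rp: "0 < ?r" by (rule und.rad_pos)
    have trN: "?trN = c * sqrt (1 - (A t)\<^sup>2) / ?r"
      unfolding ken_tr_def rad\<phi>[OF t'] using A by (simp add: \<phi>_def sin_arccos)
    have trN_pos: "0 < ?trN" unfolding trN using rp sinpos c_gt by simp
    have trU_pos: "0 < ?trU"
    proof -
      have "t / a < pi" using t v a_pos by (simp add: field_simps)
      then have "0 < sin (t / a)" using t a_pos by (intro sin_gt_zero) auto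
      then show ?thesis unfolding ken_tr_def using und.y_pos rp by simp
    qed
    have dA: "(A has_real_derivative (- (2 * ?r * ?trU) / (2 * c))) (at t)"
      unfolding A_def[abs_def] using c_gt
      by (auto intro!: derivative_eq_intros und.DERIV_rad simp: field_simps)
    have d\<phi>: "(\<phi> has_real_derivative ?trU / ?trN) (at t)"
    proof -
      have "(\<phi> has_real_derivative inverse (- sqrt (1 - (A t)\<^sup>2)) * (- (2 * ?r * ?trU) / (2 * c))) (at t)"
        unfolding \<phi>_def[abs_def] by (rule DERIV_chain2[OF DERIV_arccos dA]) (use A in auto)
      moreover have "inverse (- sqrt (1 - (A t)\<^sup>2)) * (- (2 * ?r * ?trU) / (2 * c)) = ?trU / ?trN"
        unfolding trN using sinpos rp c_gt by (simp add: field_simps)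
      ultimately show ?thesis by simp
    qed
    have dD: "(?D has_real_derivative ?tzU + ?tzN * (?trU / ?trN)) (at t)"
      by (intro DERIV_add und.DERIV_hgt DERIV_chain2[OF nod.DERIV_hgt d\<phi>] t \<phi>pos)
    have sum: "0 < ?tzU + ?tzN"
    proof -
      have "?tzU + ?tzN = (a * (c\<^sup>2 - 1) + (a\<^sup>2 - y\<^sup>2) + (1 - a) * ?r\<^sup>2) / (2 * a * ?r)"
        unfolding und.tz_eq nod.tz_eq rad\<phi>[OF t'] using rp a_pos by (simp add: field_simps)
      moreover have "0 < a * (c\<^sup>2 - 1) + (a\<^sup>2 - y\<^sup>2) + (1 - a) * ?r\<^sup>2"
        using a_pos nod.c_sq und.sq_less a_less rp by (intro add_pos_pos mult_pos_pos) auto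
      ultimately show ?thesis using a_pos rp by simp
    qed
    have "0 < ?tzU + ?tzN * (?trU / ?trN)"
    \<comment> \<open>Where the nodoid falls, a positive sum forces the axial part of its unit
      tangent to be smaller in size than that of the unduloid, hence its radial part larger. The
      factor \<open>?trU / ?trN\<close> is then at most \<open>1\<close> and cannot spoil the
      sign.\<close>
    proof (cases "0 \<le> ?tzN")
      case True
      have "0 < ?tzU" unfolding ken_tz_def using und.minus_pos rp by simp
      then show ?thesis using True trU_pos trN_pos by (intro add_pos_nonneg mult_nonneg_nonneg) auto
    next
      case False
      then have "?tzN\<^sup>2 < ?tzU\<^sup>2" using sum by (intro power2_strict_mono) auto
      then have "?trU\<^sup>2 < ?trN\<^sup>2" unfolding und.tr_sq nod.tr_sq by simp
      then have "?trU < ?trN" using trN_pos by (simp add: power_less_imp_less_base less_imp_le)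
      then have "?trU / ?trN \<le> 1" using trN_pos by simp
      then have "?tzN * 1 \<le> ?tzN * (?trU / ?trN)" using False by (intro mult_left_mono_neg) auto
      then show ?thesis using sum by simp
    qed
    then show "\<exists>d. (?D has_real_derivative d) (at t) \<and> 0 < d" using dD by blast
  qed
  then show ?thesis by (simp add: \<phi>_0 \<phi>_v)
qed

lemma rad_nod_gt:
  assumes "0 < u" "u < 2 * pi"
  shows "c - 1 < ken_rad (-1) (-c) u"
proof -
  have "cos u < 1"
  proof (rule ccontr)
    assume "\<not> cos u < 1"
    then have "cos u = cos 0" using cos_le_one[of u] by simp
    then show False using cos_eq_cases[of u 0] assms by simp
  qed
  then have "(c - 1)\<^sup>2 < (ken_rad (-1) (-c) u)\<^sup>2"
    unfolding nod.rad_sq using c_gt by (simp add: power2_eq_square algebra_simps)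
  then show ?thesis using nod.rad_pos[of u] by (simp add: power_less_imp_less_base less_imp_le)
qed

text \<open>Both arcs are symmetric about height \<open>L / 2\<close>. Halves on opposite sides of
  it are separated by \<open>hgt_nod_upper\<close>, halves on the same side by
  \<open>nodoid_outside\<close>, after a reflection where required. The ends of the nodoid are left
  out because the arcs meet there.\<close>

lemma arcs_disjoint:
  assumes v: "0 \<le> v" "v \<le> 2 * pi * a" and u: "0 < u" "u < 2 * pi"
    and r: "ken_rad a y v = ken_rad (-1) (-c) u"
  shows "ken_hgt a y v \<noteq> L + ken_hgt (-1) (-c) u"
proof
  assume h: "ken_hgt a y v = L + ken_hgt (-1) (-c) u"
  have v_ne: "v \<noteq> 0" "v \<noteq> 2 * pi * a" using r rad_nod_gt[OF u] ends by auto
  have low: "ken_hgt a y t \<le> L / 2" if "0 \<le> t" "t \<le> pi * a" for t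
    using hgt_und_mono[of t "pi * a"] that hgt_und_half by (cases "t = pi * a") auto
  have rN: "ken_rad (-1) (-c) (2 * pi - u) = ken_rad (-1) (-c) u" using nod.ken_reflect(1)[of u] by simp
  have rU: "ken_rad a y (2 * pi * a - v) = ken_rad a y v" using und.ken_reflect(1)[of v] a_pos by simp
  have hN: "ken_hgt (-1) (-c) (2 * pi - u) = - L - ken_hgt (-1) (-c) u" using u by (intro hgt_nod_reflect) auto
  have hU: "ken_hgt a y (2 * pi * a - v) = L - ken_hgt a y v" using v by (intro hgt_und_reflect)
  show False
  proof (cases "v \<le> pi * a")
    case True
    show False
    proof (cases "pi \<le> u")
      case True
      have "- ken_hgt (-1) (-c) (2 * pi - u) < ken_hgt a y v"
        by (rule nodoid_outside) (use v v_ne u r rN \<open>v \<le> pi * a\<close> True in auto)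
      then show False using h hN by simp
    next
      case False
      then show False using hgt_nod_upper[of u] u low[of v] v True h by simp
    qed
  next
    case False
    then have v': "0 < 2 * pi * a - v" "2 * pi * a - v \<le> pi * a" using v v_ne by auto
    show False
    proof (cases "u \<le> pi")
      case True
      have "- ken_hgt (-1) (-c) u < ken_hgt a y (2 * pi * a - v)"
        by (rule nodoid_outside[OF v']) (use u r rU True in auto)
      then show False using h hU by simp
    next
      case False
      then show False using hgt_nod_upper[of "2 * pi - u"] u low[of "2 * pi * a - v"] v' h hN hU by simp
    qed
  qed
qed

text \<open>Along the unduloid the height alone is injective. Along the nodoid an equal radius
  leaves only the mirror point as a second candidate; equal heights would be \<open>- L / 2\<close>,
  which rules out the first half of the arc for both points.\<close>

lemma profile_simple:
  assumes "f u = f u'" "g u = g u'"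
  shows "u - u' \<in> \<int>"
proof -
  define w w' where "w = len * frac u" and "w' = len * frac u'"
  have rng: "0 \<le> len * frac t" "len * frac t - 2 * pi * a < 2 * pi" for t
  proof -
    show "0 \<le> len * frac t" using len_pos by simp
    have "len * frac t < len * 1" using len_pos frac_lt_1 by (intro mult_strict_left_mono)
    then show "len * frac t - 2 * pi * a < 2 * pi" by (simp add: len_def distrib_left)
  qed
  have cross: False if "len * frac s \<le> 2 * pi * a" "\<not> len * frac t \<le> 2 * pi * a" "f s = f t" "g s = g t" for s t
    using arcs_disjoint[of "len * frac s" "len * frac t - 2 * pi * a"] that rng[of s] rng[of t]
    by (simp add: f_def g_def glue_def)
  have "w = w'"
  proof (cases "w \<le> 2 * pi * a")
    case True
    then have "w' \<le> 2 * pi * a" using cross[of u u'] assms by (auto simp: w_def w'_def)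
    then have "ken_hgt a y w = ken_hgt a y w'"
      using True assms(2) by (simp add: g_def glue_def w_def w'_def)
    then show ?thesis using hgt_und_mono[of w w'] hgt_und_mono[of w' w] rng[of u] rng[of u']
      by (cases w w' rule: linorder_cases) (auto simp: w_def w'_def)
  next
    case False
    then have F': "\<not> w' \<le> 2 * pi * a" using cross[of u' u] assms by (auto simp: w_def w'_def)
    let ?x = "w - 2 * pi * a" and ?x' = "w' - 2 * pi * a"
    have e: "ken_rad (-1) (-c) ?x = ken_rad (-1) (-c) ?x'" "ken_hgt (-1) (-c) ?x = ken_hgt (-1) (-c) ?x'"
      using False F' assms by (simp_all add: f_def g_def glue_def w_def w'_def)
    have xr: "0 < ?x" "?x < 2 * pi" "0 < ?x'" "?x' < 2 * pi"
      using False F' rng[of u] rng[of u'] by (auto simp: w_def w'_def)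
    have "(ken_rad (-1) (-c) ?x)\<^sup>2 = (ken_rad (-1) (-c) ?x')\<^sup>2" using e by simp
    moreover have sq: "(ken_rad (-1) (-c) t)\<^sup>2 = 1 + c\<^sup>2 - 2 * c * cos t" for t by (simp add: nod.rad_sq)
    note sq[of ?x] sq[of ?x']
    ultimately have "2 * c * cos ?x = 2 * c * cos ?x'" by linarith
    then have "cos ?x = cos ?x'" using c_gt by (simp only: mult_cancel_left) linarith
    then consider "?x = ?x'" | "?x + ?x' = 2 * pi" using cos_eq_cases xr by (metis less_imp_le)
    then show ?thesis
    proof cases
      case 2
      then have x': "?x' = 2 * pi - ?x" by simp
      have "ken_hgt (-1) (-c) ?x' = - L - ken_hgt (-1) (-c) ?x"
        unfolding x' using xr by (intro hgt_nod_reflect) auto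
      then have half: "ken_hgt (-1) (-c) ?x = - L / 2" using e by simp
      then have "pi \<le> ?x" using hgt_nod_upper[of ?x] xr by linarith
      moreover have "pi \<le> ?x'" using hgt_nod_upper[of ?x'] xr e half by linarith
      ultimately show ?thesis using 2 by linarith
    qed simp
  qed
  then have "frac u = frac u'" using len_pos by (simp add: w_def w'_def)
  then have "u - u' = of_int (\<lfloor>u\<rfloor> - \<lfloor>u'\<rfloor>)" by (simp add: frac_def algebra_simps)
  then show ?thesis by (metis Ints_of_int)
qed

sublocale revolution_torus f g p q len
proof
  show "0 < f u" for u
    unfolding f_def glue_def Let_def using und.rad_pos nod.rad_pos by simp
  show "(p u)\<^sup>2 + (q u)\<^sup>2 = 1" for u
    unfolding p_def q_def glue_def Let_def using und.unit nod.unit by simp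
  show "f (u + 1) = f u" "g (u + 1) = g u" for u
    by (simp_all add: f_def g_def glue_def frac_1_eq)
qed (fact len_pos DERIV_f DERIV_g lip_p lip_q profile_simple)+

section \<open>Area, Willmore energy and volume as integrals of powers of the radius\<close>

lemma curv_plus: "ken_curv a y w + ken_tz a y w / ken_rad a y w = 1 / a"
  "ken_curv (-1) (-c) w + ken_tz (-1) (-c) w / ken_rad (-1) (-c) w = - 1"
proof -
  show "ken_curv a y w + ken_tz a y w / ken_rad a y w = 1 / a"
    unfolding ken_curv_def und.tz_eq using und.rad_pos[of w] a_pos by (simp add: field_simps power2_eq_square)
  show "ken_curv (-1) (-c) w + ken_tz (-1) (-c) w / ken_rad (-1) (-c) w = - 1"
    unfolding ken_curv_def nod.tz_eq using nod.rad_pos[of w] by (simp add: field_simps power2_eq_square)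
qed

text \<open>On each arc the sum of the principal curvatures is constant by \<open>curv_plus\<close>:
  \<open>1 / a\<close> on the unduloid and \<open>- 1\<close> on the nodoid. Squaring half of it
  removes the opposite signs.\<close>

lemma mean_curvature_torus:
  assumes "fst z \<notin> junctions"
  shows "(mean_curvature F z)\<^sup>2 = glue (\<lambda>_. 1 / (4 * a\<^sup>2)) (\<lambda>_. 1 / 4) (fst z)"
proof -
  let ?k = "glue (ken_curv a y) (ken_curv (-1) (-c)) (fst z)"
  have "(p has_real_derivative - (len * ?k * q (fst z))) (at (fst z))"
    using DERIV_glue[OF assms und.DERIV_tr nod.DERIV_tr] by (simp add: p_def q_def glue_def Let_def mult.assoc split: if_splits)
  moreover have "(q has_real_derivative len * ?k * p (fst z)) (at (fst z))"
    using DERIV_glue[OF assms und.DERIV_tz nod.DERIV_tz] by (simp add: p_def q_def glue_def Let_def mult.assoc split: if_splits)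
  ultimately have "mean_curvature F z = (?k + q (fst z) / f (fst z)) / 2"
    by (rule mean_curvature_eq)
  also have "?k + q (fst z) / f (fst z) = glue (\<lambda>_. 1 / a) (\<lambda>_. - 1) (fst z)"
    by (simp add: q_def f_def glue_def Let_def curv_plus)
  finally have m: "mean_curvature F z = glue (\<lambda>_. 1 / a) (\<lambda>_. - 1) (fst z) / 2" .
  show ?thesis
    unfolding m by (simp add: glue_def Let_def power_divide power_mult_distrib)
qed

lemma has_integral_rad_und: "((\<lambda>w. ken_rad a y w ^ n) has_integral a * J n a y) {0..2 * pi * a}"
proof -
  let ?h = "\<lambda>v. sqrt (a\<^sup>2 + y\<^sup>2 - 2 * a * y * cos v) ^ n"
  have "(?h has_integral J n a y) {0..2 * pi}"
    unfolding J_def by (intro integrable_integral integrable_continuous_real continuous_intros)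
  from has_integral_affine_real[OF this, of "1 / a" 0] a_pos
  show ?thesis by (simp add: ken_rad_def mult.commute)
qed

lemma has_integral_rad_nod: "((\<lambda>w. ken_rad (-1) (-c) w ^ n) has_integral J n 1 c) {0..2 * pi}"
proof -
  have "((\<lambda>v. sqrt (1\<^sup>2 + c\<^sup>2 - 2 * 1 * c * cos v) ^ n) has_integral J n 1 c) {0..2 * pi}"
    unfolding J_def by (intro integrable_integral integrable_continuous_real continuous_intros)
  then show ?thesis by (simp add: ken_rad_def)
qed

lemma area_torus: "surface_area F = 2 * pi * (a * J 1 a y + J 1 1 c)"
proof -
  have "(f has_integral (a * J 1 a y + J 1 1 c) / len) {0..1}"
    using glue_has_integral[OF has_integral_rad_und[of 1] has_integral_rad_nod[of 1]] by (simp add: f_def)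
  then show ?thesis unfolding area_eq using len_pos by (simp add: integral_unique)
qed

lemma willmore_torus: "willmore F = pi / 2 * (J 1 a y / a + J 1 1 c)"
proof -
  let ?H = "glue (\<lambda>_. 1 / (4 * a\<^sup>2)) (\<lambda>_. 1 / 4)"
  have "willmore F = 2 * pi * len * integral {0..1} (\<lambda>u. f u * ?H u)"
  proof (rule willmore_eq[where S = "junctions \<inter> {0..1}"])
    show "?H \<in> borel_measurable borel"
      unfolding glue_eq frac_def by measurable
    show "\<bar>?H u\<bar> \<le> 1 / (4 * a\<^sup>2) + 1 / 4" for u
      by (simp add: glue_eq)
    show "finite (junctions \<inter> {0..1})" by (rule junctions_finite)
    show "(mean_curvature F z)\<^sup>2 = ?H (fst z)" if "fst z \<in> {0..1} - junctions \<inter> {0..1}" for z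
      by (rule mean_curvature_torus) (use that in auto)
  qed
  also have "integral {0..1} (\<lambda>u. f u * ?H u) = (a * J 1 a y * (1 / (4 * a\<^sup>2)) + J 1 1 c * (1 / 4)) / len"
    unfolding f_def glue_mult
    using glue_has_integral[OF has_integral_mult_left[OF has_integral_rad_und[of 1], of "1 / (4 * a\<^sup>2)"]
        has_integral_mult_left[OF has_integral_rad_nod[of 1], of "1 / 4"]]
    by (simp add: integral_unique)
  also have "2 * pi * len * (\<dots>) = 2 * pi * (a * J 1 a y * (1 / (4 * a\<^sup>2)) + J 1 1 c * (1 / 4))"
    using len_pos by simp
  finally show ?thesis using a_pos by (simp add: field_simps power2_eq_square)
qed

text \<open>By \<open>tz_eq\<close>, the disc integrand \<open>r^2 * ken_tz\<close> equals
  \<open>(r^3 + (a^2 - y^2) * r) / (2 * a)\<close>, so only the first and third moments of the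
  radius remain.\<close>

lemma vol_torus: "enclosed_vol F =
  pi / 2 * (J 3 1 c - J 3 a y - (a\<^sup>2 - y\<^sup>2) * J 1 a y - (c\<^sup>2 - 1) * J 1 1 c)"
proof -
  have 1: "((\<lambda>w. (ken_rad a y w)\<^sup>2 * ken_tz a y w) has_integral (a * J 3 a y + a * J 1 a y * (a\<^sup>2 - y\<^sup>2)) / (2 * a)) {0..2 * pi * a}"
  proof -
    have "(\<lambda>w. (ken_rad a y w)\<^sup>2 * ken_tz a y w) = (\<lambda>w. (ken_rad a y w ^ 3 + ken_rad a y w ^ 1 * (a\<^sup>2 - y\<^sup>2)) / (2 * a))"
    proof
      show "(ken_rad a y w)\<^sup>2 * ken_tz a y w = (ken_rad a y w ^ 3 + ken_rad a y w ^ 1 * (a\<^sup>2 - y\<^sup>2)) / (2 * a)" for w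
        unfolding und.tz_eq using und.rad_pos[of w] a_pos by (simp add: field_simps power2_eq_square power3_eq_cube)
    qed
    then show ?thesis
      by (simp only:) (intro has_integral_divide has_integral_add has_integral_mult_left has_integral_rad_und)
  qed
  have 2: "((\<lambda>w. (ken_rad (-1) (-c) w)\<^sup>2 * ken_tz (-1) (-c) w) has_integral (J 3 1 c + J 1 1 c * (1 - c\<^sup>2)) / (- 2)) {0..2 * pi}"
  proof -
    have "(\<lambda>w. (ken_rad (-1) (-c) w)\<^sup>2 * ken_tz (-1) (-c) w) = (\<lambda>w. (ken_rad (-1) (-c) w ^ 3 + ken_rad (-1) (-c) w ^ 1 * (1 - c\<^sup>2)) / (- 2))"
    proof
      show "(ken_rad (-1) (-c) w)\<^sup>2 * ken_tz (-1) (-c) w = (ken_rad (-1) (-c) w ^ 3 + ken_rad (-1) (-c) w ^ 1 * (1 - c\<^sup>2)) / (- 2)" for w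
        unfolding nod.tz_eq using nod.rad_pos[of w] by (simp add: field_simps power2_eq_square power3_eq_cube)
    qed
    then show ?thesis
      by (simp only:) (intro has_integral_divide has_integral_add has_integral_mult_left has_integral_rad_nod)
  qed
  have "integral {0..1} (\<lambda>u. (f u)\<^sup>2 * q u)
      = ((a * J 3 a y + a * J 1 a y * (a\<^sup>2 - y\<^sup>2)) / (2 * a) + (J 3 1 c + J 1 1 c * (1 - c\<^sup>2)) / (- 2)) / len"
    unfolding f_def q_def glue_power glue_mult
    using glue_has_integral[OF 1 2] by (simp add: integral_unique)
  then have "enclosed_vol F = - pi * ((a * J 3 a y + a * J 1 a y * (a\<^sup>2 - y\<^sup>2)) / (2 * a) + (J 3 1 c + J 1 1 c * (1 - c\<^sup>2)) / (- 2))"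
    unfolding vol_eq using len_pos by simp
  also have "(a * J 3 a y + a * J 1 a y * (a\<^sup>2 - y\<^sup>2)) / (2 * a) = (J 3 a y + J 1 a y * (a\<^sup>2 - y\<^sup>2)) / 2"
    using a_pos by (simp add: distrib_left[symmetric] mult.assoc del: distrib_left)
  finally show ?thesis by (simp add: field_simps)
qed

section \<open>The concatenated arcs in constant-speed parametrization\<close>

definition traveled :: "real \<Rightarrow> real" where
  "traveled x = (if x \<le> 1 / 2 then und_len a y (4 * pi * x) else 2 * pi * a + nod_len c (4 * pi * x - 2 * pi))"

lemma traveled_ends: "traveled 0 = 0" "traveled 1 = len"
  using nod.nod_len_2pi by (simp_all add: traveled_def len_def algebra_simps)

lemma continuous_traveled: "continuous_on {0..1} traveled"
proof -
  have half: "4 * pi * x = 2 * pi" if "x = 1 / 2" for x using that by simp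
  show ?thesis
    unfolding traveled_def
    by (intro continuous_on_cases_le continuous_intros continuous_on_compose2[OF und.continuous_und_len[of UNIV]]
      continuous_on_compose2[OF nod.continuous_nod_len[of UNIV]])
    (auto simp: half und.und_len_2pi)
qed

lemma traveled_left: "0 \<le> x \<Longrightarrow> x \<le> 1 / 2 \<Longrightarrow> 0 \<le> traveled x \<and> traveled x \<le> 2 * pi * a"
  using und.und_len_range[of "4 * pi * x"] by (simp add: traveled_def)

lemma traveled_right:
  assumes "1 / 2 < x" "x \<le> 1"
  shows "0 < traveled x - 2 * pi * a \<and> traveled x \<le> len"
proof -
  have r: "0 < 4 * pi * x - 2 * pi" "4 * pi * x - 2 * pi \<le> 2 * pi" using assms by simp_all
  then have "0 < nod_len c (4 * pi * x - 2 * pi)" "nod_len c (4 * pi * x - 2 * pi) \<le> 2 * pi"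
    using nod.nod_len_mono[of 0 "4 * pi * x - 2 * pi"] nod.nod_len_range[of "4 * pi * x - 2 * pi"] by auto
  then show ?thesis using assms by (simp add: traveled_def len_def algebra_simps)
qed

definition arc_pair :: "real \<Rightarrow> real \<times> real" where
  "arc_pair w = (if w \<le> 2 * pi * a then (ken_rad a y w, ken_hgt a y w)
    else (ken_rad (-1) (-c) (w - 2 * pi * a), L + ken_hgt (-1) (-c) (w - 2 * pi * a)))"

definition curve :: "real \<Rightarrow> real \<times> real" where
  "curve = (\<lambda>x. unduloid_arc a y (2 * pi * x)) +++ (\<lambda>x. nodoid_arc c (2 * pi * x))"

lemma curve_left: "0 \<le> x \<Longrightarrow> x \<le> 1 / 2 \<Longrightarrow>
    curve x = (ken_rad a y (und_len a y (4 * pi * x)), ken_hgt a y (und_len a y (4 * pi * x)))"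
  using und.unduloid_arc_eq[of "2 * pi * (2 * x)"] by (simp add: curve_def joinpaths_def mult_ac)

lemma curve_right: 
  assumes "1 / 2 < x" "x \<le> 1"
  shows "curve x = (ken_rad (-1) (-c) (nod_len c (4 * pi * x - 2 * pi)), L + ken_hgt (-1) (-c) (nod_len c (4 * pi * x - 2 * pi)))"
proof -
  have "0 \<le> 4 * pi * x - 2 * pi" "4 * pi * x - 2 * pi \<le> 2 * pi" using assms by simp_all
  moreover have "2 * pi * (2 * x - 1) = 4 * pi * x - 2 * pi" by (simp add: algebra_simps)
  ultimately show ?thesis using nod.nodoid_arc_eq[of "4 * pi * x - 2 * pi"] assms
    by (simp add: curve_def joinpaths_def)
qed

lemma curve_arc_pair: "0 \<le> x \<Longrightarrow> x \<le> 1 \<Longrightarrow> curve x = arc_pair (traveled x)"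
proof (cases "x \<le> 1 / 2")
  case True
  then show "0 \<le> x \<Longrightarrow> x \<le> 1 \<Longrightarrow> curve x = arc_pair (traveled x)"
    using curve_left[of x] traveled_left[of x] by (simp add: arc_pair_def) (simp add: traveled_def)
next
  case False
  then show "0 \<le> x \<Longrightarrow> x \<le> 1 \<Longrightarrow> curve x = arc_pair (traveled x)"
    using curve_right[of x] traveled_right[of x] by (simp add: arc_pair_def) (simp add: traveled_def)
qed

text \<open>The speed jumps at \<open>1 / 2\<close>, where the arcs are joined.
  \<open>arc_length_curve\<close> integrates across this single exception using continuity of
  \<open>traveled\<close>.\<close>

lemma DERIV_traveled:
  assumes "0 < x" "x < 1" "x \<noteq> 1 / 2"
  shows "(traveled has_vector_derivative norm (vector_derivative curve (at x))) (at x)"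
proof (cases "x < 1 / 2")
  case True
  let ?S = "{0<..<1 / 2 :: real}"
  have lin: "((\<lambda>x. 4 * pi * x) has_real_derivative 4 * pi) (at x)"
    by (auto intro!: derivative_eq_intros)
  define d where "d = a * und.b / (a + y * cos (4 * pi * x)) * (4 * pi)"
  have d: "0 < d" unfolding d_def using a_pos und.b_pos und.plus_pos[of "4 * pi * x"] by simp
  have l: "((\<lambda>x. und_len a y (4 * pi * x)) has_real_derivative d) (at x)"
    unfolding d_def by (rule DERIV_chain2[OF und.DERIV_und_len lin])
  let ?w = "und_len a y (4 * pi * x)"
  have w: "0 < ?w" using und.und_len_mono[of 0 "4 * pi * x"] assms by simp
  have "((\<lambda>x. (ken_rad a y (und_len a y (4 * pi * x)), ken_hgt a y (und_len a y (4 * pi * x))))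
      has_vector_derivative (ken_tr a y ?w * d, ken_tz a y ?w * d)) (at x)"
    using DERIV_chain2[OF und.DERIV_rad l] DERIV_chain2[OF und.DERIV_hgt[OF w] l]
    by (intro has_vector_derivative_Pair) (simp_all add: has_real_derivative_iff_has_vector_derivative)
  then have "(curve has_vector_derivative (ken_tr a y ?w * d, ken_tz a y ?w * d)) (at x)"
    by (rule has_vector_derivative_transform_within_open[where S = ?S]) (use assms True in \<open>auto simp: curve_left\<close>)
  then have "norm (vector_derivative curve (at x)) = d"
    using d by (simp add: vector_derivative_at und.norm_tangent)
  moreover have "(traveled has_real_derivative d) (at x)"
    by (rule has_field_derivative_transform_within_open[OF l, where S = ?S]) (use assms True in \<open>auto simp: traveled_def\<close>)
  ultimately show ?thesis by (simp add: has_real_derivative_iff_has_vector_derivative)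
next
  case False
  then have gt: "1 / 2 < x" using assms by simp
  let ?S = "{1 / 2<..<1 :: real}"
  have lin: "((\<lambda>x. 4 * pi * x - 2 * pi) has_real_derivative 4 * pi) (at x)"
    by (auto intro!: derivative_eq_intros)
  let ?s = "4 * pi * x - 2 * pi"
  define d where "d = (1 - cos ?s / sqrt (c\<^sup>2 - (sin ?s)\<^sup>2)) * (4 * pi)"
  have d: "0 < d" unfolding d_def using nod.nod_speed_pos[of ?s] by simp
  have l: "((\<lambda>x. nod_len c (4 * pi * x - 2 * pi)) has_real_derivative d) (at x)"
    unfolding d_def by (rule DERIV_chain2[OF nod.DERIV_nod_len lin])
  let ?w = "nod_len c ?s"
  have w: "0 < ?w" using nod.nod_len_mono[of 0 ?s] gt by simp
  have "((\<lambda>x. (ken_rad (-1) (-c) (nod_len c (4 * pi * x - 2 * pi)), L + ken_hgt (-1) (-c) (nod_len c (4 * pi * x - 2 * pi))))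
      has_vector_derivative (ken_tr (-1) (-c) ?w * d, 0 + ken_tz (-1) (-c) ?w * d)) (at x)"
    using DERIV_chain2[OF nod.DERIV_rad l] DERIV_add[OF DERIV_const[of L] DERIV_chain2[OF nod.DERIV_hgt[OF w] l]]
    by (intro has_vector_derivative_Pair) (simp_all add: has_real_derivative_iff_has_vector_derivative)
  then have "(curve has_vector_derivative (ken_tr (-1) (-c) ?w * d, ken_tz (-1) (-c) ?w * d)) (at x)"
    by (simp, elim has_vector_derivative_transform_within_open[where S = ?S]) (use assms gt in \<open>auto simp: curve_right\<close>)
  then have "norm (vector_derivative curve (at x)) = d"
    using d by (simp add: vector_derivative_at nod.norm_tangent)
  moreover have "(traveled has_real_derivative d) (at x)"
  proof (rule has_field_derivative_transform_within_open[where S = ?S])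
    show "((\<lambda>x. 2 * pi * a + nod_len c (4 * pi * x - 2 * pi)) has_real_derivative d) (at x)"
      using DERIV_add[OF DERIV_const[of "2 * pi * a"] l] by simp
  qed (use assms gt in \<open>auto simp: traveled_def\<close>)
  ultimately show ?thesis by (simp add: has_real_derivative_iff_has_vector_derivative)
qed

lemma arc_length_curve:
  assumes "0 \<le> x" "x \<le> 1"
  shows "arc_length curve x = traveled x"
proof -
  have "((\<lambda>t. norm (vector_derivative curve (at t))) has_integral traveled x - traveled 0) {0..x}"
    by (rule fundamental_theorem_of_calculus_interior_strong[of "{1 / 2}"])
      (use assms in \<open>auto intro!: DERIV_traveled continuous_on_subset[OF continuous_traveled]\<close>)
  then show ?thesis by (simp add: arc_length_def integral_unique traveled_ends)
qed

text \<open>By \<open>curve_arc_pair\<close> a point of the curve depends only on the length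
  traveled, so every preimage that \<open>inv_into\<close> may select gives the same point.\<close>

lemma constant_speed_curve: "constant_speed curve = (\<lambda>u. (f u, g u))"
proof
  fix u
  define w where "w = frac u * len"
  have w: "0 \<le> w" "w \<le> len" using len_pos frac_lt_1[of u] by (auto simp: w_def mult_left_le_one_le less_imp_le)
  obtain x where "0 \<le> x" "x \<le> 1" "traveled x = w"
    using IVT'[of traveled 0 w 1] w traveled_ends continuous_traveled by auto
  then have img: "w \<in> arc_length curve ` {0..1}" using arc_length_curve by force
  define x where "x = inv_into {0..1} (arc_length curve) w"
  have x: "x \<in> {0..1}" "arc_length curve x = w"
    unfolding x_def using inv_into_into[OF img] f_inv_into_f[OF img] by auto
  have "constant_speed curve u = curve x"
    by (simp add: constant_speed_def arc_length_curve traveled_ends x_def w_def)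
  also have "\<dots> = arc_pair w" using x curve_arc_pair[of x] arc_length_curve[of x] by auto
  also have "\<dots> = (f u, g u)" by (simp add: arc_pair_def f_def g_def glue_def w_def mult.commute Let_def)
  finally show "constant_speed curve u = (f u, g u)" .
qed

end

section \<open>Elliptic integrals near modulus one\<close>

lemma integral_quadrant:
  fixes h :: "real \<Rightarrow> real"
  assumes h: "continuous_on UNIV h" and shift: "\<And>x. h (x + pi) = h x" and even: "\<And>x. h (- x) = h x"
  shows "integral {0..2 * pi} h = 4 * integral {0..pi / 2} h"
proof -
  let ?I = "integral {0..pi / 2} h"
  have 1: "(h has_integral ?I) {0..pi / 2}"
    by (intro integrable_integral integrable_continuous_real continuous_on_subset[OF h]) auto
  have sh: "h (x - pi) = h x" for x using shift[of "x - pi"] by simp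
  have "((\<lambda>x. h (x - pi / 2)) has_integral ?I) {pi / 2..pi}"
    using has_integral_affine_real[OF 1, of 1 "pi / 2"] by simp
  from has_integral_flip[OF this] have "((\<lambda>x. h (pi - x)) has_integral ?I) {pi / 2..pi}"
    by simp
  moreover have "h (pi - x) = h x" for x using shift[of "- x"] even[of x] by simp
  ultimately have 2: "(h has_integral ?I) {pi / 2..pi}" by simp
  have 3: "(h has_integral ?I + ?I) {0..pi}"
    using has_integral_combine[OF _ _ 1 2] by simp
  have 4: "(h has_integral ?I + ?I) {pi..2 * pi}"
    using has_integral_affine_real[OF 3, of 1 pi] by (simp add: sh)
  show ?thesis using has_integral_combine[OF _ _ 3 4] by (simp add: integral_unique)
qed

lemma (in unduloid) hgt_period_ellE: "ken_hgt a y (2 * pi * a) = 4 * a * ellE (y / a)"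
proof -
  let ?S = "\<lambda>x. sqrt (1 - (y / a)\<^sup>2 * (sin x)\<^sup>2)"
  have "(?S has_integral ellE (y / a)) {0..pi / 2}"
    unfolding ellE_def by (intro integrable_integral integrable_continuous_real continuous_intros)
  from has_integral_flip[OF this]
  have "((\<lambda>x. sqrt (1 - (y / a)\<^sup>2 * (cos x)\<^sup>2)) has_integral ellE (y / a)) {0..pi / 2}"
    by (simp add: sin_diff)
  from has_integral_mult_right[OF this, of a]
  have "((\<lambda>x. a * sqrt (1 - (y / a)\<^sup>2 * (cos x)\<^sup>2)) has_integral a * ellE (y / a)) {0..pi / 2}" .
  moreover have "a * sqrt (1 - (y / a)\<^sup>2 * (cos x)\<^sup>2) = R x" for x
  proof -
    have "a\<^sup>2 - y\<^sup>2 * (cos x)\<^sup>2 = a\<^sup>2 * (1 - (y / a)\<^sup>2 * (cos x)\<^sup>2)"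
      using a_pos by (simp add: field_simps)
    then show ?thesis using a_pos by (simp add: real_sqrt_mult)
  qed
  ultimately have "integral {0..pi / 2} R = a * ellE (y / a)" by (simp add: integral_unique)
  moreover have "integral {0..2 * pi} R = 4 * integral {0..pi / 2} R"
    by (rule integral_quadrant[OF continuous_R]) simp_all
  ultimately show ?thesis by (simp add: hgt_period)
qed

context nodoid begin

lemma continuous_S: "continuous_on A S"
  by (intro continuous_intros)

lemma continuous_quot: "continuous_on A (\<lambda>x. (cos x)\<^sup>2 / S x)"
  by (intro continuous_intros continuous_S) (use S_pos in \<open>auto simp: less_imp_neq[symmetric]\<close>)

text \<open>The combination of \<open>ellE\<close> and \<open>ellK\<close> in
  \<open>delaunay_L\<close> has a single integrand, because
  \<open>(S x)^2 - (c^2 - 1) = (cos x)^2\<close>. It is the part of the nodoid's height that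
  survives integration over a period.\<close>

lemma delaunay_L_eq: "delaunay_L c = 4 * integral {0..pi / 2} (\<lambda>x. (cos x)\<^sup>2 / S x)"
proof -
  have nz: "S x \<noteq> 0" for x using S_pos[of x] by linarith
  have Sc: "sqrt (1 - (1 / c)\<^sup>2 * (sin x)\<^sup>2) = S x / c" for x
  proof -
    have "1 - (1 / c)\<^sup>2 * (sin x)\<^sup>2 = (c\<^sup>2 - (sin x)\<^sup>2) / c\<^sup>2" using c_gt by (simp add: field_simps)
    then show ?thesis using c_gt by (simp add: real_sqrt_divide)
  qed
  have "((\<lambda>x. S x / c) has_integral ellE (1 / c)) {0..pi / 2}"
    unfolding ellE_def Sc
    by (intro integrable_integral integrable_continuous_real continuous_intros) (use c_gt in auto)
  moreover have "((\<lambda>x. 1 / (S x / c)) has_integral ellK (1 / c)) {0..pi / 2}"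
    unfolding ellK_def Sc
    by (intro integrable_integral integrable_continuous_real continuous_intros continuous_S) (use c_gt nz in auto)
  ultimately have "((\<lambda>x. c * (S x / c - (1 - 1 / c\<^sup>2) * (1 / (S x / c)))) has_integral
      c * (ellE (1 / c) - (1 - 1 / c\<^sup>2) * ellK (1 / c))) {0..pi / 2}"
    by (intro has_integral_mult_right has_integral_diff)
  moreover have "c * (S x / c - (1 - 1 / c\<^sup>2) * (1 / (S x / c))) = (cos x)\<^sup>2 / S x" for x
  proof -
    have "c * (S x / c - (1 - 1 / c\<^sup>2) * (1 / (S x / c))) = ((S x)\<^sup>2 - (c\<^sup>2 - 1)) / S x"
      using c_gt nz[of x] by (simp add: divide_simps) (simp add: power2_eq_square algebra_simps)
    also have "(S x)\<^sup>2 - (c\<^sup>2 - 1) = (cos x)\<^sup>2" unfolding S_sq by (simp add: cos_squared_eq)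
    finally show ?thesis .
  qed
  ultimately have "c * (ellE (1 / c) - (1 - 1 / c\<^sup>2) * ellK (1 / c)) = integral {0..pi / 2} (\<lambda>x. (cos x)\<^sup>2 / S x)"
    by (simp add: integral_unique)
  then show ?thesis by (simp add: delaunay_L_def)
qed

lemma hgt_period_L: "ken_hgt (-1) (-c) (2 * pi) = - delaunay_L c"
proof -
  have "(cos has_integral sin (2 * pi) - sin 0) {0..2 * pi}"
    by (rule fundamental_theorem_of_calculus)
      (auto intro!: derivative_eq_intros simp flip: has_real_derivative_iff_has_vector_derivative)
  then have 1: "(cos has_integral 0) {0..2 * pi}" by simp
  have q: "integral {0..2 * pi} (\<lambda>x. (cos x)\<^sup>2 / S x) = delaunay_L c"
    unfolding delaunay_L_eq by (rule integral_quadrant[OF continuous_quot]) simp_all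
  have "((\<lambda>x. (cos x)\<^sup>2 / S x) has_integral delaunay_L c) {0..2 * pi}"
    unfolding q[symmetric] by (intro integrable_integral integrable_continuous_real continuous_quot)
  from has_integral_diff[OF 1 this] show ?thesis by (simp add: hgt_period integral_unique)
qed

end

section \<open>Logarithmic bounds for the deficit of the period height\<close>

definition eta :: "real \<Rightarrow> real" where "eta c = 1 - delaunay_L c / 4"

text \<open>The source of the logarithm: half the integral of
  \<open>cos x * (c^2 - 1) / (c^2 - (sin x)^2)\<close> over a quadrant, obtained by partial
  fractions in \<open>sin x\<close>.\<close>

definition eta_low :: "real \<Rightarrow> real" where
  "eta_low c = (c\<^sup>2 - 1) / (4 * c) * (ln (c + 1) - ln (c - 1))"

lemma one_minus_sqrt_bounds:
  fixes w :: real
  assumes "0 \<le> w" "w \<le> 1"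
  shows "w / 2 \<le> 1 - sqrt (1 - w)" "1 - sqrt (1 - w) \<le> w / 2 + w\<^sup>2 / 2"
proof -
  define s where "s = sqrt (1 - w)"
  have s: "0 \<le> s" "s \<le> 1" "w = 1 - s\<^sup>2" using assms by (simp_all add: s_def)
  have "1 - s - w / 2 = (1 - s)\<^sup>2 / 2" unfolding s(3) by (simp add: power2_eq_square field_simps)
  moreover have "0 \<le> (1 - s)\<^sup>2 / 2" by simp
  ultimately show "w / 2 \<le> 1 - sqrt (1 - w)" unfolding s_def[symmetric] by linarith
  have "w / 2 + w\<^sup>2 / 2 - (1 - s) = s * (1 - s)\<^sup>2 * (2 + s) / 2"
    unfolding s(3) by (simp add: power2_eq_square field_simps)
  moreover have "0 \<le> s * (1 - s)\<^sup>2 * (2 + s) / 2" using s by simp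
  ultimately show "1 - sqrt (1 - w) \<le> w / 2 + w\<^sup>2 / 2" unfolding s_def[symmetric] by linarith
qed

context nodoid begin

lemma eta_has_integral: "((\<lambda>x. cos x * (1 - cos x / S x)) has_integral eta c) {0..pi / 2}"
proof -
  have "(cos has_integral sin (pi / 2) - sin 0) {0..pi / 2}"
    by (rule fundamental_theorem_of_calculus)
      (auto intro!: derivative_eq_intros simp flip: has_real_derivative_iff_has_vector_derivative)
  then have 1: "(cos has_integral 1) {0..pi / 2}" by simp
  have "((\<lambda>x. (cos x)\<^sup>2 / S x) has_integral delaunay_L c / 4) {0..pi / 2}"
    unfolding delaunay_L_eq by simp
      (intro integrable_integral integrable_continuous_real continuous_quot)
  from has_integral_diff[OF 1 this] show ?thesis
    by (simp add: eta_def right_diff_distrib power2_eq_square)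
qed

text \<open>With \<open>?w x = (c^2 - 1) / (S x)^2\<close> the quotient \<open>cos x / S x\<close>
  is \<open>sqrt (1 - ?w x)\<close>. The lower estimate \<open>?w x / 2\<close> integrates exactly
  to \<open>eta_low c\<close>; the quadratic remainder contributes only a multiple of
  \<open>c - 1\<close>, without logarithm.\<close>

lemma eta_bounds: "eta_low c \<le> eta c" "eta c \<le> eta_low c + (c\<^sup>2 - 1)"
proof -
  let ?p = "c\<^sup>2 - 1"
  let ?w = "\<lambda>x. ?p / (c\<^sup>2 - (sin x)\<^sup>2)"
  have p: "0 < ?p" using c_sq by simp
  have w: "0 \<le> ?w x" "?w x \<le> 1" "cos x / S x = sqrt (1 - ?w x)" if "x \<in> {0..pi / 2}" for x
  proof -
    have nz: "0 < c\<^sup>2 - (sin x)\<^sup>2" by (rule S_arg_pos)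
    show "0 \<le> ?w x" using p nz by simp
    have "(sin x)\<^sup>2 \<le> 1" by (simp add: abs_square_le_1)
    then show "?w x \<le> 1" using nz by simp
    have "1 - ?w x = (cos x)\<^sup>2 / (c\<^sup>2 - (sin x)\<^sup>2)" using nz by (simp add: field_simps cos_squared_eq)
    then show "cos x / S x = sqrt (1 - ?w x)"
      using that cos_ge_zero[of x] by (simp add: real_sqrt_divide)
  qed
  have pm: "0 < c + sin x" "0 < c - sin x" for x
    using c_gt sin_ge_minus_one[of x] sin_le_one[of x] by linarith+
  have i1: "((\<lambda>x. cos x * ?w x) has_integral 2 * eta_low c) {0..pi / 2}"
  proof -
    have "((\<lambda>x. cos x * ?w x) has_integral
       ?p / (2 * c) * (ln (c + sin (pi / 2)) - ln (c - sin (pi / 2))) - ?p / (2 * c) * (ln (c + sin 0) - ln (c - sin 0))) {0..pi / 2}"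
    proof (rule fundamental_theorem_of_calculus)
      fix x :: real
      have d1: "((\<lambda>x. ln (c + sin x)) has_real_derivative 1 / (c + sin x) * cos x) (at x)"
        by (rule DERIV_chain2[where f = ln], rule DERIV_ln_divide[OF pm(1)]) (auto intro!: derivative_eq_intros)
      have d2: "((\<lambda>x. ln (c - sin x)) has_real_derivative 1 / (c - sin x) * (- cos x)) (at x)"
        by (rule DERIV_chain2[where f = ln], rule DERIV_ln_divide[OF pm(2)]) (auto intro!: derivative_eq_intros)
      have "((\<lambda>x. ?p / (2 * c) * (ln (c + sin x) - ln (c - sin x))) has_real_derivative
          ?p / (2 * c) * (cos x / (c + sin x) + cos x / (c - sin x))) (at x)"
        using DERIV_cmult[OF DERIV_diff[OF d1 d2], of "?p / (2 * c)"] by simp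
      moreover have "?p / (2 * c) * (cos x / (c + sin x) + cos x / (c - sin x)) = cos x * ?w x"
      proof -
        have "c\<^sup>2 - (sin x)\<^sup>2 = (c + sin x) * (c - sin x)" by algebra
        moreover have "cos x / (c + sin x) + cos x / (c - sin x) = 2 * c * cos x / ((c + sin x) * (c - sin x))"
          using pm[of x] by (simp add: field_simps)
        ultimately show ?thesis using c_gt by simp
      qed
      ultimately show "((\<lambda>x. ?p / (2 * c) * (ln (c + sin x) - ln (c - sin x))) has_vector_derivative cos x * ?w x) (at x within {0..pi / 2})"
        by (simp only: has_real_derivative_iff_has_vector_derivative has_vector_derivative_at_within)
    qed simp
    then show ?thesis by (simp add: eta_low_def)
  qed
  show "eta_low c \<le> eta c"
  proof (rule has_integral_le[OF _ eta_has_integral])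
    show "((\<lambda>x. cos x * (?w x / 2)) has_integral eta_low c) {0..pi / 2}"
      using has_integral_divide[OF i1, of 2] by simp
    fix x assume x: "x \<in> {0..pi / 2}"
    show "cos x * (?w x / 2) \<le> cos x * (1 - cos x / S x)"
      unfolding w(3)[OF x] using one_minus_sqrt_bounds(1)[OF w(1,2)[OF x]] x cos_ge_zero[of x]
      by (intro mult_left_mono) auto
  qed
  \<comment> \<open>This dominates the squared term: replacing the factor \<open>c + sin x\<close>
    of its denominator by \<open>c\<close> leaves a multiple of the derivative of
    \<open>1 / (c - sin x)\<close>.\<close>
  have i2: "((\<lambda>x. cos x * (?p\<^sup>2 / (c\<^sup>2 * (c - sin x)\<^sup>2))) has_integral
      ?p\<^sup>2 / c\<^sup>2 * (1 / (c - sin (pi / 2))) - ?p\<^sup>2 / c\<^sup>2 * (1 / (c - sin 0))) {0..pi / 2}"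
  proof (rule fundamental_theorem_of_calculus)
    fix x :: real
    have "((\<lambda>x. c - sin x) has_real_derivative - cos x) (at x)" by (auto intro!: derivative_eq_intros)
    from DERIV_inverse_fun[OF this] pm(2)[of x]
    have "((\<lambda>x. inverse (c - sin x)) has_real_derivative cos x / (c - sin x)\<^sup>2) (at x)"
      by (simp add: power2_eq_square divide_inverse)
    from DERIV_cmult[OF this]
    have "((\<lambda>x. ?p\<^sup>2 / c\<^sup>2 * (1 / (c - sin x))) has_real_derivative ?p\<^sup>2 / c\<^sup>2 * (cos x / (c - sin x)\<^sup>2)) (at x)"
      by (simp only: inverse_eq_divide)
    then show "((\<lambda>x. ?p\<^sup>2 / c\<^sup>2 * (1 / (c - sin x))) has_vector_derivative cos x * (?p\<^sup>2 / (c\<^sup>2 * (c - sin x)\<^sup>2))) (at x within {0..pi / 2})"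
      by (simp add: has_real_derivative_iff_has_vector_derivative mult.commute has_vector_derivative_at_within)
  qed simp
  have "eta c \<le> 2 * eta_low c / 2 + (?p\<^sup>2 / c\<^sup>2 * (1 / (c - sin (pi / 2))) - ?p\<^sup>2 / c\<^sup>2 * (1 / (c - sin 0))) / 2"
  proof (rule has_integral_le[OF eta_has_integral has_integral_add[OF has_integral_divide[OF i1] has_integral_divide[OF i2]]])
    fix x assume x: "x \<in> {0..pi / 2}"
    have c: "0 \<le> cos x" using x by (intro cos_ge_zero) auto
    have s: "0 \<le> sin x" using x by (intro sin_ge_zero) auto
    have "(?w x)\<^sup>2 \<le> ?p\<^sup>2 / (c\<^sup>2 * (c - sin x)\<^sup>2)"
    proof -
      have "c\<^sup>2 * (c - sin x)\<^sup>2 \<le> (c + sin x)\<^sup>2 * (c - sin x)\<^sup>2"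
        using s c_gt by (intro mult_right_mono power_mono) auto
      also have "\<dots> = (c\<^sup>2 - (sin x)\<^sup>2)\<^sup>2" by algebra
      finally have "?p\<^sup>2 / (c\<^sup>2 - (sin x)\<^sup>2)\<^sup>2 \<le> ?p\<^sup>2 / (c\<^sup>2 * (c - sin x)\<^sup>2)"
        using pm[of x] c_gt S_arg_pos[of x] by (intro divide_left_mono mult_pos_pos) auto
      then show ?thesis by (simp add: power_divide)
    qed
    then have "1 - cos x / S x \<le> ?w x / 2 + ?p\<^sup>2 / (c\<^sup>2 * (c - sin x)\<^sup>2) / 2"
      unfolding w(3)[OF x]
      by (intro order.trans[OF one_minus_sqrt_bounds(2)[OF w(1,2)[OF x]]] add_left_mono divide_right_mono) auto
    from mult_left_mono[OF this c]
    show "cos x * (1 - cos x / S x) \<le> cos x * ?w x / 2 + cos x * (?p\<^sup>2 / (c\<^sup>2 * (c - sin x)\<^sup>2)) / 2"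
      by (simp add: distrib_left)
  qed
  also have "(?p\<^sup>2 / c\<^sup>2 * (1 / (c - sin (pi / 2))) - ?p\<^sup>2 / c\<^sup>2 * (1 / (c - sin 0))) / 2 \<le> ?p"
  proof -
    have "?p\<^sup>2 / c\<^sup>2 * (1 / (c - sin (pi / 2))) - ?p\<^sup>2 / c\<^sup>2 * (1 / (c - sin 0)) = ?p * ((c + 1) / c ^ 3)"
    proof -
      have sq: "?p\<^sup>2 = ?p * (c + 1) * (c - 1)" by algebra
      have d: "1 / (c - 1) - 1 / c = 1 / (c * (c - 1))" using c_gt by (simp add: field_simps)
      have r: "q * (c + 1) * (c - 1) / c\<^sup>2 * (1 / (c * (c - 1))) = q * ((c + 1) / c ^ 3)" for q
        using c_gt by (simp add: power2_eq_square power3_eq_cube)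
      have "?p\<^sup>2 / c\<^sup>2 * (1 / (c - sin (pi / 2))) - ?p\<^sup>2 / c\<^sup>2 * (1 / (c - sin 0)) = ?p\<^sup>2 / c\<^sup>2 * (1 / (c * (c - 1)))"
        unfolding d[symmetric] sin_pi_half sin_zero diff_zero by (rule right_diff_distrib[symmetric])
      then show ?thesis unfolding sq r .
    qed
    also have "\<dots> \<le> ?p * 2"
    proof (rule mult_left_mono)
      have "1 \<le> c ^ 3" "c \<le> c ^ 3" using c_gt power_increasing[of 1 3 c] by (simp_all add: one_le_power)
      then show "(c + 1) / c ^ 3 \<le> 2" using c_gt by (simp add: divide_le_eq)
    qed (use p in simp)
    finally show ?thesis by simp
  qed
  finally show "eta c \<le> eta_low c + (c\<^sup>2 - 1)" by simp
qed

lemma eta_pos: "0 < eta c"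
proof -
  have "0 < eta_low c"
    unfolding eta_low_def using c_gt c_sq by (intro mult_pos_pos divide_pos_pos) auto
  then show ?thesis using eta_bounds(1) by simp
qed

end

lemma eta_mono:
  assumes "1 < c" "c \<le> c'"
  shows "eta c \<le> eta c'"
proof -
  interpret c: nodoid c by unfold_locales fact
  interpret c': nodoid c' by unfold_locales (use assms in simp)
  show ?thesis
  proof (rule has_integral_le[OF c.eta_has_integral c'.eta_has_integral])
    fix x assume "x \<in> {0..pi / 2}"
    then have cos: "0 \<le> cos x" by (intro cos_ge_zero) auto
    have "c\<^sup>2 \<le> c'\<^sup>2" using assms by (intro power_mono) auto
    then have "c.S x \<le> c'.S x" by simp
    then have "cos x / c'.S x \<le> cos x / c.S x"
      using c.S_pos[of x] c'.S_pos[of x] cos by (intro divide_left_mono) auto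
    then show "cos x * (1 - cos x / c.S x) \<le> cos x * (1 - cos x / c'.S x)"
      using cos by (intro mult_left_mono) auto
  qed
qed

section \<open>Supporting lines of \<open>J 1 1\<close> and bounds for \<open>ellE\<close>\<close>

definition P :: "real \<Rightarrow> real" where
  "P \<rho> = integral {0..2 * pi} (\<lambda>v. (\<rho> - cos v) / sqrt (1\<^sup>2 + \<rho>\<^sup>2 - 2 * 1 * \<rho> * cos v))"

lemma rad_unit_pos: "0 < \<rho> \<Longrightarrow> \<rho> \<noteq> 1 \<Longrightarrow> 0 < 1\<^sup>2 + \<rho>\<^sup>2 - 2 * 1 * \<rho> * cos v" for \<rho> :: real
proof -
  assume "0 < \<rho>" "\<rho> \<noteq> 1"
  then interpret kenmotsu 1 \<rho> by unfold_locales auto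
  show ?thesis by (rule rad_arg_pos)
qed

lemma P_has_integral: "0 < \<rho> \<Longrightarrow> \<rho> \<noteq> 1 \<Longrightarrow>
  ((\<lambda>v. (\<rho> - cos v) / sqrt (1\<^sup>2 + \<rho>\<^sup>2 - 2 * 1 * \<rho> * cos v)) has_integral P \<rho>) {0..2 * pi}"
  unfolding P_def
  by (intro integrable_integral integrable_continuous_real continuous_intros)
    (use rad_unit_pos[of \<rho>] in \<open>auto simp: less_imp_neq[symmetric]\<close>)

text \<open>Up to rescaling the variable, the integrand is \<open>ken_tz a y\<close>, so a slope
  above \<open>1\<close> is the period height of an unduloid. In \<open>P_inverse\<close> it is
  \<open>- ken_tz (-1) (-c)\<close>, and a slope below \<open>1\<close> is the drop of a
  nodoid.\<close>

lemma (in unduloid) P_eq: "P (a / y) = 4 * ellE (y / a)"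
proof -
  have "((\<lambda>v. (a / y - cos v) / sqrt (1\<^sup>2 + (a / y)\<^sup>2 - 2 * 1 * (a / y) * cos v)) has_integral P (a / y)) {0..2 * pi}"
    by (rule P_has_integral) (use a_pos y_pos y_less in auto)
  from has_integral_affine_real[OF this, of "1 / a" 0] a_pos
  have "((\<lambda>w. (a / y - cos (w / a)) / sqrt (1\<^sup>2 + (a / y)\<^sup>2 - 2 * 1 * (a / y) * cos (w / a))) has_integral a * P (a / y)) {0..2 * pi * a}"
    by (simp add: mult.commute)
  moreover have "(a / y - cos v) / sqrt (1\<^sup>2 + (a / y)\<^sup>2 - 2 * 1 * (a / y) * cos v)
      = (a - y * cos v) / sqrt (a\<^sup>2 + y\<^sup>2 - 2 * a * y * cos v)" for v
  proof -
    have "1\<^sup>2 + (a / y)\<^sup>2 - 2 * 1 * (a / y) * cos v = (a\<^sup>2 + y\<^sup>2 - 2 * a * y * cos v) / y\<^sup>2"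
      using y_pos by (simp add: field_simps power2_eq_square)
    moreover have "a / y - cos v = (a - y * cos v) / y" using y_pos by (simp add: field_simps)
    ultimately show ?thesis using y_pos by (simp add: real_sqrt_divide)
  qed
  ultimately have "(ken_tz a y has_integral a * P (a / y)) {0..2 * pi * a}"
    by (simp add: ken_tz_def[abs_def] ken_rad_def)
  then have "a * P (a / y) = 4 * a * ellE (y / a)"
    using hgt_period_ellE by (simp add: ken_hgt_def integral_unique)
  then show ?thesis using a_pos by simp
qed

lemma (in nodoid) P_inverse: "P (1 / c) = 4 * (1 - eta c)"
proof -
  have "((\<lambda>v. (1 / c - cos v) / sqrt (1\<^sup>2 + (1 / c)\<^sup>2 - 2 * 1 * (1 / c) * cos v)) has_integral P (1 / c)) {0..2 * pi}"
    by (rule P_has_integral) (use c_gt in auto)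
  moreover have "(1 / c - cos v) / sqrt (1\<^sup>2 + (1 / c)\<^sup>2 - 2 * 1 * (1 / c) * cos v) = - ken_tz (-1) (-c) v" for v
  proof -
    have "1\<^sup>2 + (1 / c)\<^sup>2 - 2 * 1 * (1 / c) * cos v = (1 + c\<^sup>2 - 2 * c * cos v) / c\<^sup>2"
      using c_gt by (simp add: field_simps power2_eq_square)
    moreover have "1 / c - cos v = (1 - c * cos v) / c" using c_gt by (simp add: field_simps)
    ultimately have "(1 / c - cos v) / sqrt (1\<^sup>2 + (1 / c)\<^sup>2 - 2 * 1 * (1 / c) * cos v) = (1 - c * cos v) / sqrt (1 + c\<^sup>2 - 2 * c * cos v)"
      using c_gt by (simp add: real_sqrt_divide)
    then show ?thesis by (simp add: ken_tz_def ken_rad_def minus_divide_left)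
  qed
  ultimately have "((\<lambda>v. - ken_tz (-1) (-c) v) has_integral P (1 / c)) {0..2 * pi}" by simp
  from has_integral_neg[OF this] have "P (1 / c) = - ken_hgt (-1) (-c) (2 * pi)"
    by (simp add: ken_hgt_def integral_unique)
  then show ?thesis by (simp add: hgt_period_L eta_def)
qed

lemma J_has_integral: "((\<lambda>v. sqrt (a\<^sup>2 + y\<^sup>2 - 2 * a * y * cos v) ^ n) has_integral J n a y) {0..2 * pi}"
  unfolding J_def by (intro integrable_integral integrable_continuous_real continuous_intros)

text \<open>Pointwise Cauchy-Schwarz for the planar vectors \<open>(\<rho> - cos v, sin v)\<close>
  and \<open>(\<rho>' - cos v, sin v)\<close>, whose lengths are the two radii. The point of contact
  avoids \<open>1\<close>, but the line may be evaluated there.\<close>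

lemma J_tangent:
  assumes "0 < \<rho>" "\<rho> \<noteq> 1" "0 \<le> \<rho>'"
  shows "J 1 1 \<rho> + (\<rho>' - \<rho>) * P \<rho> \<le> J 1 1 \<rho>'"
proof (rule has_integral_le[OF has_integral_add[OF J_has_integral has_integral_mult_right[OF P_has_integral[OF assms(1,2)]]] J_has_integral])
  fix v :: real
  let ?C = "cos v"
  let ?x = "1\<^sup>2 + \<rho>\<^sup>2 - 2 * 1 * \<rho> * ?C" and ?x' = "1\<^sup>2 + \<rho>'\<^sup>2 - 2 * 1 * \<rho>' * ?C"
  have x: "0 < ?x" by (rule rad_unit_pos[OF assms(1,2)])
  have s2: "(sin v)\<^sup>2 = 1 - ?C\<^sup>2" by (rule sin_squared_eq)
  have "((\<rho> - ?C) * (\<rho>' - ?C) + (sin v)\<^sup>2)\<^sup>2 \<le> ?x * ?x'"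
  proof -
    have "?x * ?x' - ((\<rho> - ?C) * (\<rho>' - ?C) + (sin v)\<^sup>2)\<^sup>2 = (sin v)\<^sup>2 * (\<rho> - \<rho>')\<^sup>2"
      unfolding s2 power_one mult_1_right by algebra
    moreover have "0 \<le> (sin v)\<^sup>2 * (\<rho> - \<rho>')\<^sup>2" by simp
    ultimately show ?thesis by linarith
  qed
  then have "(\<rho> - ?C) * (\<rho>' - ?C) + (sin v)\<^sup>2 \<le> sqrt (?x * ?x')" by (rule real_le_rsqrt)
  then have "?x + (\<rho>' - \<rho>) * (\<rho> - ?C) \<le> sqrt ?x * sqrt ?x'"
    unfolding real_sqrt_mult s2 by (simp add: power2_eq_square algebra_simps)
  then have "(?x + (\<rho>' - \<rho>) * (\<rho> - ?C)) / sqrt ?x \<le> sqrt ?x'"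
    using x by (simp add: divide_le_eq mult.commute)
  moreover have "?x / sqrt ?x = sqrt ?x" using x by (simp add: real_div_sqrt)
  ultimately show "sqrt ?x ^ 1 + (\<rho>' - \<rho>) * ((\<rho> - ?C) / sqrt ?x) \<le> sqrt ?x' ^ 1"
    by (simp add: add_divide_distrib)
qed

lemma sqrt_2_2cos: "0 \<le> v \<Longrightarrow> v \<le> 2 * pi \<Longrightarrow> sqrt (1\<^sup>2 + 1\<^sup>2 - 2 * 1 * 1 * cos v) = 2 * sin (v / 2)"
proof -
  assume v: "0 \<le> v" "v \<le> 2 * pi"
  have "1\<^sup>2 + 1\<^sup>2 - 2 * 1 * 1 * cos v = (2 * sin (v / 2))\<^sup>2"
    using cos_double_sin[of "v / 2"] by (simp add: power_mult_distrib)
  moreover have "0 \<le> sin (v / 2)" using v by (intro sin_ge_zero) auto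
  ultimately show ?thesis by (intro real_sqrt_unique) auto
qed

lemma J_1_1_1: "J 1 1 1 = 8"
proof -
  have "((\<lambda>v. 2 * sin (v / 2)) has_integral (- 4 * cos (2 * pi / 2)) - (- 4 * cos (0 / 2))) {0..2 * pi}"
    by (rule fundamental_theorem_of_calculus)
      (auto intro!: derivative_eq_intros simp flip: has_real_derivative_iff_has_vector_derivative)
  then have i: "((\<lambda>v. 2 * sin (v / 2)) has_integral 8) {0..2 * pi}" by simp
  have "((\<lambda>v. sqrt (1\<^sup>2 + 1\<^sup>2 - 2 * 1 * 1 * cos v) ^ 1) has_integral 8) {0..2 * pi}"
  proof (rule has_integral_eq[OF _ i])
    show "2 * sin (v / 2) = sqrt (1\<^sup>2 + 1\<^sup>2 - 2 * 1 * 1 * cos v) ^ 1" if "v \<in> {0..2 * pi}" for v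
      unfolding power_one_right using that sqrt_2_2cos[of v] by simp
  qed
  then show ?thesis using J_has_integral[of 1 1 1] has_integral_unique by blast
qed

lemma J_scale: "0 < a \<Longrightarrow> J n a y = a ^ n * J n 1 (y / a)"
proof -
  assume a: "0 < a"
  have "sqrt (a\<^sup>2 + y\<^sup>2 - 2 * a * y * cos v) ^ n = a ^ n * sqrt (1\<^sup>2 + (y / a)\<^sup>2 - 2 * 1 * (y / a) * cos v) ^ n" for v
  proof -
    have "a\<^sup>2 + y\<^sup>2 - 2 * a * y * cos v = a\<^sup>2 * (1\<^sup>2 + (y / a)\<^sup>2 - 2 * 1 * (y / a) * cos v)"
      using a by (simp add: field_simps power2_eq_square)
    then show ?thesis using a by (simp add: real_sqrt_mult power_mult_distrib)
  qed
  then show ?thesis by (simp add: J_def)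
qed

lemma ellE_antimono:
  assumes "0 \<le> k" "k \<le> k'" "k' \<le> 1"
  shows "ellE k' \<le> ellE k"
  unfolding ellE_def
proof (intro integral_le integrable_continuous_real continuous_intros)
  fix x :: real
  have "k\<^sup>2 * (sin x)\<^sup>2 \<le> k'\<^sup>2 * (sin x)\<^sup>2" using assms by (intro mult_right_mono power_mono) auto
  then show "sqrt (1 - k'\<^sup>2 * (sin x)\<^sup>2) \<le> sqrt (1 - k\<^sup>2 * (sin x)\<^sup>2)" by simp
qed

lemma cos_has_integral: "(cos has_integral 1) {0..pi / 2}"
  and sin_has_integral: "(sin has_integral 1) {0..pi / 2}"
proof -
  have "(cos has_integral sin (pi / 2) - sin 0) {0..pi / 2}"
    by (rule fundamental_theorem_of_calculus)
      (auto intro!: derivative_eq_intros simp flip: has_real_derivative_iff_has_vector_derivative)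
  then show "(cos has_integral 1) {0..pi / 2}" by simp
  from has_integral_flip[OF this] show "(sin has_integral 1) {0..pi / 2}" by (simp add: cos_diff)
qed

lemma ellE_ge_1:
  assumes "0 \<le> k" "k \<le> 1"
  shows "1 \<le> ellE k"
proof -
  have "((\<lambda>x. sqrt (1 - k\<^sup>2 * (sin x)\<^sup>2)) has_integral ellE k) {0..pi / 2}"
    unfolding ellE_def by (intro integrable_integral integrable_continuous_real continuous_intros)
  then show ?thesis
  proof (rule has_integral_le[OF cos_has_integral])
    fix x assume "x \<in> {0..pi / 2}"
    have "k\<^sup>2 * (sin x)\<^sup>2 \<le> 1 * (sin x)\<^sup>2" using assms by (intro mult_right_mono) (auto simp: power_le_one)
    then show "cos x \<le> sqrt (1 - k\<^sup>2 * (sin x)\<^sup>2)"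
      by (intro real_le_rsqrt) (simp add: cos_squared_eq)
  qed
qed

text \<open>Subadditivity of the root applied to
  \<open>1 - k^2 sin^2 = cos^2 + (1 - k^2) sin^2\<close>. Its purpose is to keep \<open>a\<close>
  from falling much below \<open>1 - eta c\<close>.\<close>

lemma ellE_le:
  assumes "0 \<le> k" "k \<le> 1"
  shows "ellE k \<le> 1 + sqrt (1 - k\<^sup>2)"
proof -
  have k1: "k\<^sup>2 \<le> 1" using assms by (simp add: power_le_one)
  have "((\<lambda>x. sqrt (1 - k\<^sup>2 * (sin x)\<^sup>2)) has_integral ellE k) {0..pi / 2}"
    unfolding ellE_def by (intro integrable_integral integrable_continuous_real continuous_intros)
  moreover have "((\<lambda>x. cos x + sqrt (1 - k\<^sup>2) * sin x) has_integral 1 + sqrt (1 - k\<^sup>2) * 1) {0..pi / 2}"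
    by (intro has_integral_add has_integral_mult_right cos_has_integral sin_has_integral)
  ultimately have "ellE k \<le> 1 + sqrt (1 - k\<^sup>2) * 1"
  proof (rule has_integral_le)
    fix x assume "x \<in> {0..pi / 2}"
    then have cs: "0 \<le> cos x" "0 \<le> sin x" by (auto intro: cos_ge_zero sin_ge_zero)
    have "(cos x + sqrt (1 - k\<^sup>2) * sin x)\<^sup>2 = (cos x)\<^sup>2 + (sqrt (1 - k\<^sup>2))\<^sup>2 * (sin x)\<^sup>2 + 2 * (sqrt (1 - k\<^sup>2) * (cos x * sin x))"
      by algebra
    also have "(sqrt (1 - k\<^sup>2))\<^sup>2 = 1 - k\<^sup>2" using k1 by simp
    also have "(cos x)\<^sup>2 = 1 - (sin x)\<^sup>2" by (rule cos_squared_eq)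
    finally have "1 - k\<^sup>2 * (sin x)\<^sup>2 \<le> (cos x + sqrt (1 - k\<^sup>2) * sin x)\<^sup>2"
      using cs k1 by (simp add: algebra_simps)
    then show "sqrt (1 - k\<^sup>2 * (sin x)\<^sup>2) \<le> cos x + sqrt (1 - k\<^sup>2) * sin x"
      using cs k1 by (intro real_le_lsqrt) auto
  qed
  then show ?thesis by simp
qed

section \<open>Energy, volume and the limit\<close>

lemma (in delaunay) elliptic_eq: "a * ellE (y / a) = 1 - eta c"
  using close_und und.hgt_period_ellE by (simp add: eta_def)

text \<open>\<open>P\<close> is the derivative of \<open>J 1 1\<close>, which is convex. The tangents at \<open>c\<close>, at \<open>1 - D = y / a\<close> and at
  \<open>1 - D / 2\<close> bound the Willmore energy; the first slope is at most \<open>4 (1 - eta c) / a\<close> by the closing condition.\<close>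

lemma (in delaunay) willmore_less:
  assumes "eta (1 / (1 - (c - 1) / a)) + eta (1 / (1 - (c - 1) / a / 2)) < 2 * eta c"
  shows "willmore F < 8 * pi"
proof -
  define D where "D = (c - 1) / a"
  have D: "0 < D" "D < 1" and ya: "y / a = 1 - D"
    using eps a_pos c_gt und.y_pos by (auto simp: D_def field_simps)
  have aD: "a * D = c - 1" using a_pos by (simp add: D_def)
  interpret d1: nodoid "1 / (1 - D)" by unfold_locales (use D in simp)
  interpret d2: nodoid "1 / (1 - D / 2)" by unfold_locales (use D in simp)
  \<comment> \<open>With parameters \<open>c\<close> and \<open>1\<close>, the fact
    \<open>c1.P_eq\<close> evaluates the slope \<open>P c\<close>.\<close>
  interpret c1: unduloid c 1 by unfold_locales (use c_gt in auto)
  have P1: "P (1 - D) = 4 * (1 - eta (1 / (1 - D)))" using d1.P_inverse by simp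
  have P2: "P (1 - D / 2) = 4 * (1 - eta (1 / (1 - D / 2)))" using d2.P_inverse by simp
  have Pc: "a * P c \<le> 4 * (1 - eta c)"
  proof -
    \<comment> \<open>Since \<open>c - 1 + y = a\<close>, the product expands to
      \<open>a - c * y\<close>. Hence \<open>c\<close> is at most \<open>a / y\<close>, and the
      slope at \<open>c\<close> at most the one fixed by the closing condition.\<close>
    have "0 < (c - 1) * (1 - y)" using c_gt a_less und.y_less by simp
    then have "c * y \<le> a" using eps by (simp add: algebra_simps)
    then have "y / a \<le> 1 / c" using c_gt a_pos by (simp add: field_simps)
    then have "ellE (1 / c) \<le> ellE (y / a)"
      using a_pos und.y_pos c_gt by (intro ellE_antimono) auto
    then have "a * P c \<le> a * (4 * ellE (y / a))"
      using c1.P_eq a_pos by (intro mult_left_mono) auto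
    then show ?thesis using elliptic_eq by simp
  qed
  have "J 1 1 c + (1 - c) * P c \<le> 8"
    using J_tangent[of c 1] c_gt by (simp add: J_1_1_1 del: One_nat_def)
  moreover have "(c - 1) * P c \<le> D * (4 * (1 - eta c))"
  proof -
    have "(c - 1) * P c = D * (a * P c)" unfolding aD[symmetric] by (simp only: mult_ac)
    also have "\<dots> \<le> D * (4 * (1 - eta c))" using D by (intro mult_left_mono Pc) simp
    finally show ?thesis .
  qed
  moreover have "J 1 1 (1 - D) + (D / 2) * P (1 - D) \<le> J 1 1 (1 - D / 2)"
    using J_tangent[of "1 - D" "1 - D / 2"] D by simp
  moreover have "J 1 1 (1 - D / 2) + (D / 2) * P (1 - D / 2) \<le> 8"
    using J_tangent[of "1 - D / 2" 1] D by (simp add: J_1_1_1 del: One_nat_def)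
  \<comment> \<open>The linear terms \<open>- 4 * D\<close> and \<open>4 * D\<close> cancel in the
    sum of the tangent bounds; twice this inequality is the margin below \<open>16\<close>.\<close>
  moreover have "D * (eta (1 / (1 - D)) + eta (1 / (1 - D / 2))) < D * (2 * eta c)"
    using assms D unfolding D_def[symmetric] by (intro mult_strict_left_mono)
  ultimately have "J 1 1 (1 - D) + J 1 1 c < 16"
    unfolding P1 P2 by (simp add: algebra_simps)
  moreover have "J 1 a y / a = J 1 1 (1 - D)"
    using J_scale[OF a_pos, of 1 y] a_pos ya by simp
  ultimately have "pi / 2 * (J 1 a y / a + J 1 1 c) < pi / 2 * 16" by simp
  then show ?thesis unfolding willmore_torus by simp
qed

text \<open>The closing condition reads \<open>a * ellE (y / a) = 1 - eta c\<close>. Inserting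
  \<open>1 \<le> ellE k\<close> bounds \<open>a\<close> from above and makes \<open>1 - a\<close> at
  least \<open>eta c\<close>; the upper bound \<open>ellE_le\<close> yields the lower bound that
  drives \<open>a\<close> to \<open>1\<close>.\<close>

lemma delaunay_system_locale:
  assumes c: "1 < c" and sys: "delaunay_system c a y"
  shows "delaunay a y c" "a \<le> 1 - eta c" "1 - eta c - sqrt (2 * (c - 1)) \<le> a"
proof -
  have ya: "0 < y" "y < a" and e: "a - y = c - 1" and L: "4 * a * ellE (y / a) = delaunay_L c"
    using sys by (auto simp: delaunay_system_def)
  interpret und: unduloid a y by unfold_locales fact+
  interpret nod: nodoid c by unfold_locales fact
  have aE: "a * ellE (y / a) = 1 - eta c" using L by (simp add: eta_def)
  have k: "0 \<le> y / a" "y / a \<le> 1" using ya by auto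
  have "a * 1 \<le> a * ellE (y / a)" using ellE_ge_1[OF k] und.a_pos by (intro mult_left_mono) auto
  then show a_le: "a \<le> 1 - eta c" using aE by simp
  then have a1: "a < 1" using nod.eta_pos by simp
  show "delaunay a y c"
    by unfold_locales (use e a1 und.hgt_period_ellE nod.hgt_period_L L in auto)
  have "a * ellE (y / a) \<le> a * (1 + sqrt (1 - (y / a)\<^sup>2))"
    using ellE_le[OF k] und.a_pos by (intro mult_left_mono) auto
  also have "\<dots> = a + und.b"
  proof -
    have "1 - (y / a)\<^sup>2 = (a\<^sup>2 - y\<^sup>2) / a\<^sup>2" using und.a_pos by (simp add: field_simps)
    then show ?thesis using und.a_pos by (simp add: und.b_def real_sqrt_divide distrib_left)
  qed
  also have "und.b \<le> sqrt (2 * (c - 1))"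
  proof -
    have "a\<^sup>2 - y\<^sup>2 = (c - 1) * (a + y)" unfolding e[symmetric] by algebra
    also have "\<dots> \<le> (c - 1) * 2" using a1 ya c by (intro mult_left_mono) auto
    finally show ?thesis by (simp add: und.b_def mult.commute)
  qed
  finally show "1 - eta c - sqrt (2 * (c - 1)) \<le> a" using aE by simp
qed

text \<open>Intermediate value theorem in \<open>y\<close> on the unit interval. The hypothesis
  covers the value \<open>(c - 1) * pi / 2\<close> at \<open>0\<close>; at \<open>1\<close> the
  bound \<open>ellE_ge_1\<close> is enough.\<close>

lemma delaunay_system_exists:
  assumes c: "1 < c" and small: "2 * (c - 1) < 1 - eta c"
  shows "\<exists>a y. delaunay_system c a y"
proof -
  define e where "e = c - 1"
  have e: "0 < e" using c by (simp add: e_def)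
  interpret nod: nodoid c by unfold_locales fact
  \<comment> \<open>Moving the factor \<open>t + e\<close> under the root gives an integrand that is
    visibly continuous in \<open>t\<close> and \<open>x\<close> jointly.\<close>
  define h where "h t = integral {0..pi / 2} (\<lambda>x. sqrt ((t + e)\<^sup>2 - t\<^sup>2 * (sin x)\<^sup>2))" for t
  have h_eq: "h t = (t + e) * ellE (t / (t + e))" if "0 \<le> t" for t
  proof -
    have "sqrt ((t + e)\<^sup>2 - t\<^sup>2 * (sin x)\<^sup>2) = (t + e) * sqrt (1 - (t / (t + e))\<^sup>2 * (sin x)\<^sup>2)" for x
    proof -
      have "(t + e)\<^sup>2 - t\<^sup>2 * (sin x)\<^sup>2 = (t + e)\<^sup>2 * (1 - (t / (t + e))\<^sup>2 * (sin x)\<^sup>2)"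
        using that e by (simp add: field_simps)
      then show ?thesis using that e by (simp add: real_sqrt_mult)
    qed
    then show ?thesis by (simp add: h_def ellE_def)
  qed
  have cont: "continuous_on {0..1} h"
  proof -
    have "continuous_on {0..1} (\<lambda>t. integral (cbox 0 (pi / 2)) (\<lambda>x. sqrt ((t + e)\<^sup>2 - t\<^sup>2 * (sin x)\<^sup>2)))"
      by (rule integral_continuous_on_param) (auto simp: case_prod_unfold intro!: continuous_intros)
    then show ?thesis by (simp add: h_def[abs_def])
  qed
  have h0: "h 0 < 1 - eta c"
  proof -
    have "h 0 = e * (pi / 2)" using h_eq[of 0] by (simp add: ellE_def)
    also have "\<dots> \<le> e * 2" using pi_less_4 e by (intro mult_left_mono) auto
    finally show ?thesis using small by (simp add: e_def)
  qed
  have h1: "1 - eta c \<le> h 1"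
  proof -
    have "1 \<le> ellE (1 / (1 + e))" using e by (intro ellE_ge_1) auto
    then have "1 * 1 \<le> (1 + e) * ellE (1 / (1 + e))" using e by (intro mult_mono) auto
    then show ?thesis using h_eq[of 1] nod.eta_pos by simp
  qed
  obtain y where y: "0 \<le> y" "h y = 1 - eta c"
    using IVT'[of h 0 "1 - eta c" 1] h0 h1 cont by auto
  then have "0 < y" using h0 by (cases "y = 0") auto
  moreover have "4 * ((y + e) * ellE (y / (y + e))) = delaunay_L c"
    using y h_eq[of y] by (simp add: eta_def)
  ultimately have "delaunay_system c (y + e) y"
    using e by (simp add: delaunay_system_def e_def algebra_simps)
  then show ?thesis by blast
qed

section \<open>Positivity of the enclosed volume\<close>

lemma J_3_1_1_ge: "8 \<le> J 3 1 1"
proof -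
  have "((\<lambda>v. 3 * sqrt (1\<^sup>2 + 1\<^sup>2 - 2 * 1 * 1 * cos v) ^ 1 - 2) has_integral 3 * J 1 1 1 - 2 * (2 * pi)) {0..2 * pi}"
    using has_integral_diff[OF has_integral_mult_right[OF J_has_integral[of 1 1 1], of 3] has_integral_const_real[of 2 0 "2 * pi"]]
    by (simp add: algebra_simps)
  \<comment> \<open>The cube lies above its tangent \<open>3 * x - 2\<close> at
    \<open>x = 1\<close>. As \<open>J 1 1 1 = 8\<close> and \<open>pi < 4\<close>, the left side is
    at least \<open>24 - 16\<close>.\<close>
  then have "3 * J 1 1 1 - 2 * (2 * pi) \<le> J 3 1 1"
  proof (rule has_integral_le[OF _ J_has_integral])
    fix v :: real
    define x where "x = sqrt (1\<^sup>2 + 1\<^sup>2 - 2 * 1 * 1 * cos v)"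
    have "0 \<le> x" by (simp add: x_def)
    then have "0 \<le> (x - 1)\<^sup>2 * (x + 2)" by simp
    also have "\<dots> = x ^ 3 - 3 * x + 2" by (simp add: power2_eq_square power3_eq_cube algebra_simps)
    finally show "3 * sqrt (1\<^sup>2 + 1\<^sup>2 - 2 * 1 * 1 * cos v) ^ 1 - 2 \<le> sqrt (1\<^sup>2 + 1\<^sup>2 - 2 * 1 * 1 * cos v) ^ 3"
      by (simp add: x_def)
  qed
  then show ?thesis using pi_less_4 by (simp add: J_1_1_1 del: One_nat_def)
qed

lemma J_nonneg: "0 \<le> J n a y" if "0 < a" "0 < y"
proof (rule has_integral_nonneg[OF J_has_integral])
  fix v :: real
  have "a * y * cos v \<le> a * y * 1" using that by (intro mult_left_mono) auto
  moreover have "0 \<le> (a - y)\<^sup>2" by simp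
  ultimately have "0 \<le> a\<^sup>2 + y\<^sup>2 - 2 * a * y * cos v" by (simp add: power2_eq_square algebra_simps)
  then show "0 \<le> sqrt (a\<^sup>2 + y\<^sup>2 - 2 * a * y * cos v) ^ n" by simp
qed

lemma J_1_le:
  assumes "0 \<le> a" "0 \<le> y"
  shows "J 1 a y \<le> 2 * pi * (a + y)"
proof -
  have "((\<lambda>v. a + y) has_integral 2 * pi * (a + y)) {0..2 * pi}"
    using has_integral_const_real[of "a + y" 0 "2 * pi"] by simp
  then show ?thesis
  proof (rule has_integral_le[OF J_has_integral])
    fix v :: real
    have "a * y * - cos v \<le> a * y * 1" using assms cos_ge_minus_one[of v] by (intro mult_left_mono) auto
    then have "a\<^sup>2 + y\<^sup>2 - 2 * a * y * cos v \<le> (a + y)\<^sup>2"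
      by (simp add: power2_eq_square algebra_simps)
    then show "sqrt (a\<^sup>2 + y\<^sup>2 - 2 * a * y * cos v) ^ 1 \<le> a + y"
      using assms by (simp add: real_le_lsqrt)
  qed
qed

lemma J_3_mono: "1 \<le> c \<Longrightarrow> J 3 1 1 \<le> J 3 1 c"
proof (rule has_integral_le[OF J_has_integral J_has_integral])
  fix v :: real assume c: "1 \<le> c"
  have "0 \<le> (c - 1) * (c + 1 - 2 * cos v)" using c cos_le_one[of v] by (intro mult_nonneg_nonneg) linarith+
  then have "1\<^sup>2 + 1\<^sup>2 - 2 * 1 * 1 * cos v \<le> 1\<^sup>2 + c\<^sup>2 - 2 * 1 * c * cos v"
    by (simp add: power2_eq_square algebra_simps)
  then show "sqrt (1\<^sup>2 + 1\<^sup>2 - 2 * 1 * 1 * cos v) ^ 3 \<le> sqrt (1\<^sup>2 + c\<^sup>2 - 2 * 1 * c * cos v) ^ 3"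
    by (intro power_mono) auto
qed

text \<open>The radius for \<open>1 - D\<close> exceeds the chord \<open>x\<close> of the unit
  circle by at most \<open>D\<close>. The constant is \<open>19 = 3 * 4 + 3 * 2 + 1\<close>, from
  \<open>x \<le> 2\<close> and \<open>D \<le> 1\<close>, times the period
  \<open>2 * pi\<close>.\<close>

lemma J_3_le:
  assumes "0 \<le> D" "D \<le> 1"
  shows "J 3 1 (1 - D) \<le> J 3 1 1 + 38 * pi * D"
proof -
  have "((\<lambda>v. sqrt (1\<^sup>2 + 1\<^sup>2 - 2 * 1 * 1 * cos v) ^ 3 + 19 * D) has_integral J 3 1 1 + 38 * pi * D) {0..2 * pi}"
    using has_integral_add[OF J_has_integral[of 1 1 3] has_integral_const_real[of "19 * D" 0 "2 * pi"]] by (simp add: mult_ac)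
  then show ?thesis
  proof (rule has_integral_le[OF J_has_integral])
    fix v :: real
    define x where "x = sqrt (1\<^sup>2 + 1\<^sup>2 - 2 * 1 * 1 * cos v)"
    have x2: "x\<^sup>2 = 2 - 2 * cos v" by (simp add: x_def)
    have "x\<^sup>2 \<le> 2\<^sup>2" unfolding x2 using cos_ge_minus_one[of v] by (simp only: power2_eq_square)
    then have x: "0 \<le> x" "x \<le> 2" using power2_le_imp_le[of x 2] by (simp_all add: x_def)
    have arg: "1\<^sup>2 + (1 - D)\<^sup>2 - 2 * 1 * (1 - D) * cos v = D\<^sup>2 + (1 - D) * x\<^sup>2"
      unfolding x2 by (simp add: power2_eq_square algebra_simps)
    also have "\<dots> \<le> D\<^sup>2 + 1 * x\<^sup>2" using assms by (intro add_left_mono mult_right_mono) auto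
    also have "\<dots> \<le> (x + D)\<^sup>2" using x assms by (simp add: power2_sum)
    finally have "sqrt (1\<^sup>2 + (1 - D)\<^sup>2 - 2 * 1 * (1 - D) * cos v) \<le> x + D"
      using x assms by (intro real_le_lsqrt) auto
    then have "sqrt (1\<^sup>2 + (1 - D)\<^sup>2 - 2 * 1 * (1 - D) * cos v) ^ 3 \<le> (x + D) ^ 3"
    proof (rule power_mono)
      have "0 \<le> D\<^sup>2 + (1 - D) * x\<^sup>2" using assms by simp
      then show "0 \<le> sqrt (1\<^sup>2 + (1 - D)\<^sup>2 - 2 * 1 * (1 - D) * cos v)"
        unfolding arg by (rule real_sqrt_ge_zero)
    qed
    also have "(x + D) ^ 3 = x ^ 3 + D * (3 * (x * x) + 3 * (x * D) + D * D)"
      by (simp add: power3_eq_cube algebra_simps)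
    also have "\<dots> \<le> x ^ 3 + D * 19"
    proof -
      have "x * x \<le> 2 * 2" "x * D \<le> 2 * 1" "D * D \<le> 1 * 1"
        using x assms by (intro mult_mono; simp)+
      then have "3 * (x * x) + 3 * (x * D) + D * D \<le> 19" by linarith
      then show ?thesis using assms by (intro add_left_mono mult_left_mono) auto
    qed
    finally show "sqrt (1\<^sup>2 + (1 - D)\<^sup>2 - 2 * 1 * (1 - D) * cos v) ^ 3 \<le> sqrt (1\<^sup>2 + 1\<^sup>2 - 2 * 1 * 1 * cos v) ^ 3 + 19 * D"
      by (simp add: x_def)
  qed
qed

text \<open>Scaling to \<open>a = 1\<close> exposes the gain \<open>(1 - a) * J 3 1 1\<close>, at
  least \<open>8 * eta c\<close>. The errors are linear in \<open>c - 1\<close> with coefficients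
  \<open>38\<close>, \<open>8\<close> and \<open>18\<close> times \<open>pi\<close>, hence below
  \<open>256 * (c - 1)\<close>; this is the origin of \<open>32\<close> in the hypothesis.\<close>

lemma (in delaunay) vol_pos:
  assumes c2: "c \<le> 2" and small: "32 * (c - 1) < eta c" and a_le: "a \<le> 1 - eta c"
  shows "0 < enclosed_vol F"
proof -
  define D where "D = (c - 1) / a"
  have D: "0 < D" "D < 1" and ya: "y / a = 1 - D"
    using eps a_pos c_gt und.y_pos by (auto simp: D_def field_simps)
  have aD: "a * D = c - 1" using a_pos by (simp add: D_def)
  have j: "8 \<le> J 3 1 1" by (rule J_3_1_1_ge)
  have "J 3 a y = a ^ 3 * J 3 1 (1 - D)" using J_scale[OF a_pos, of 3 y] ya by simp
  also have "\<dots> \<le> a ^ 3 * (J 3 1 1 + 38 * pi * D)"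
    using a_pos D by (intro mult_left_mono J_3_le) auto
  also have "\<dots> \<le> a * (J 3 1 1 + 38 * pi * D)"
    using a_pos a_less j D power_decreasing[of 1 3 a] by (intro mult_right_mono) auto
  also have "\<dots> = a * J 3 1 1 + 38 * pi * (c - 1)"
    unfolding aD[symmetric] by (simp add: algebra_simps)
  finally have 1: "J 3 a y \<le> a * J 3 1 1 + 38 * pi * (c - 1)" .
  have J1: "J 1 a y \<le> 2 * pi * 2"
    by (rule order.trans[OF J_1_le mult_left_mono]) (use a_pos und.y_pos a_less und.y_less in auto)
  have J1c: "J 1 1 c \<le> 2 * pi * 3"
    by (rule order.trans[OF J_1_le mult_left_mono]) (use c_gt c2 in auto)
  have "a\<^sup>2 - y\<^sup>2 = (c - 1) * (a + y)" unfolding eps[symmetric] by algebra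
  moreover have "(c - 1) * (a + y) \<le> (c - 1) * 2"
    using a_less und.y_less c_gt by (intro mult_left_mono) auto
  ultimately have "a\<^sup>2 - y\<^sup>2 \<le> (c - 1) * 2" by linarith
  then have "(a\<^sup>2 - y\<^sup>2) * J 1 a y \<le> ((c - 1) * 2) * (2 * pi * 2)"
    using c_gt by (intro mult_mono J1 J_nonneg a_pos und.y_pos) auto
  then have 2: "(a\<^sup>2 - y\<^sup>2) * J 1 a y \<le> 8 * pi * (c - 1)" by (simp add: algebra_simps)
  have "c\<^sup>2 - 1 = (c - 1) * (c + 1)" by algebra
  moreover have "(c - 1) * (c + 1) \<le> (c - 1) * 3" using c_gt c2 by (intro mult_left_mono) auto
  ultimately have "c\<^sup>2 - 1 \<le> (c - 1) * 3" by linarith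
  then have "(c\<^sup>2 - 1) * J 1 1 c \<le> ((c - 1) * 3) * (2 * pi * 3)"
    using c_gt by (intro mult_mono J1c J_nonneg) auto
  then have 3: "(c\<^sup>2 - 1) * J 1 1 c \<le> 18 * pi * (c - 1)" by (simp add: algebra_simps)
  have 4: "J 3 1 1 \<le> J 3 1 c" using c_gt by (intro J_3_mono) simp
  have "64 * pi * (c - 1) \<le> 64 * 4 * (c - 1)"
    using pi_less_4 c_gt by (intro mult_right_mono mult_left_mono) auto
  also have "\<dots> < 8 * eta c" using small by simp
  also have "\<dots> \<le> J 3 1 1 * (1 - a)"
    using j a_le nod.eta_pos by (intro mult_mono) auto
  finally have "64 * pi * (c - 1) < J 3 1 1 - a * J 3 1 1" by (simp add: algebra_simps)
  then have "0 < J 3 1 c - J 3 a y - (a\<^sup>2 - y\<^sup>2) * J 1 a y - (c\<^sup>2 - 1) * J 1 1 c"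
    using 1 2 3 4 by (simp add: algebra_simps)
  then show ?thesis unfolding vol_torus by simp
qed

section \<open>Asymptotics as \<open>c\<close> tends to \<open>1\<close> from above\<close>

lemma J_tendsto:
  assumes "(A \<longlongrightarrow> a) G" "(Y \<longlongrightarrow> y) G"
  shows "((\<lambda>x. J n (A x) (Y x)) \<longlongrightarrow> J n a y) G"
proof -
  have "continuous_on UNIV (\<lambda>z :: real \<times> real. integral (cbox 0 (2 * pi))
      (\<lambda>v. sqrt ((fst z)\<^sup>2 + (snd z)\<^sup>2 - 2 * fst z * snd z * cos v) ^ n))"
    by (rule integral_continuous_on_param) (auto simp: case_prod_unfold intro!: continuous_intros)
  then have "isCont (\<lambda>z. J n (fst z) (snd z)) (a, y)"
    by (simp add: J_def continuous_on_eq_continuous_at)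
  from isCont_tendsto_compose[OF this tendsto_Pair[OF assms]] show ?thesis by simp
qed

lemma eta_low_large: "\<forall>\<^sub>F c in at_right 1. 32 * (c - 1) < eta_low c"
  unfolding eta_low_def by real_asymp

lemma eta_upper_tendsto: "((\<lambda>c. eta_low c + (c\<^sup>2 - 1)) \<longlongrightarrow> 0) (at_right 1)"
  unfolding eta_low_def by real_asymp

lemma sqrt_tendsto: "((\<lambda>c :: real. sqrt (2 * (c - 1))) \<longlongrightarrow> 0) (at_right 1)"
  by real_asymp

text \<open>Since \<open>eta c\<close> is asymptotic to \<open>- (c - 1) ln (c - 1) / 2\<close>, the two sides compare like \<open>11/10 + 11/20\<close> and \<open>2\<close>.\<close>

lemma eta_upper_less:
  "\<forall>\<^sub>F c in at_right 1.
    (eta_low (1 / (1 - 11 / 10 * (c - 1))) + ((1 / (1 - 11 / 10 * (c - 1)))\<^sup>2 - 1))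
    + (eta_low (1 / (1 - 11 / 20 * (c - 1))) + ((1 / (1 - 11 / 20 * (c - 1)))\<^sup>2 - 1)) < 2 * eta_low c"
  unfolding eta_low_def by real_asymp

text \<open>Here \<open>D\<close> depends on the implicit parameter \<open>a\<close>. Monotonicity
  of \<open>eta\<close> trades it for an explicit \<open>x\<close>, after which
  \<open>eta_low\<close> allows an asymptotic comparison.\<close>

lemma eta_inverse_bounds:
  assumes "0 < D" "D \<le> x" "x < 1"
  shows "eta (1 / (1 - D)) \<le> eta_low (1 / (1 - x)) + ((1 / (1 - x))\<^sup>2 - 1)"
proof -
  interpret nodoid "1 / (1 - x)" by unfold_locales (use assms in simp)
  have "eta (1 / (1 - D)) \<le> eta (1 / (1 - x))"
  proof (rule eta_mono)
    show "1 / (1 - D) \<le> 1 / (1 - x)" using assms by (intro divide_left_mono) auto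
  qed (use assms in simp)
  then show ?thesis using eta_bounds(2) by linarith
qed

text \<open>A crude bound on \<open>a\<close> is enough: it gives
  \<open>D \<le> 11 / 10 * (c - 1)\<close>, and the leading coefficients \<open>11 / 10\<close> and
  \<open>11 / 20\<close> still add up to less than \<open>2\<close>.\<close>

lemma (in delaunay) willmore_less_of_estimates:
  assumes a: "10 / 11 < a" and c: "11 / 10 * (c - 1) < 1"
    and e: "(eta_low (1 / (1 - 11 / 10 * (c - 1))) + ((1 / (1 - 11 / 10 * (c - 1)))\<^sup>2 - 1))
    + (eta_low (1 / (1 - 11 / 20 * (c - 1))) + ((1 / (1 - 11 / 20 * (c - 1)))\<^sup>2 - 1)) < 2 * eta_low c"
  shows "willmore F < 8 * pi"
proof (rule willmore_less)
  let ?D = "(c - 1) / a" and ?x = "11 / 10 * (c - 1)" and ?y = "11 / 20 * (c - 1)"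
  have D: "0 < ?D" "?D \<le> ?x" "?D / 2 \<le> ?y"
  proof -
    have "1 / a \<le> 11 / 10" using a by (simp add: field_simps)
    then have "(c - 1) * (1 / a) \<le> (c - 1) * (11 / 10)" using c_gt by (intro mult_left_mono) auto
    then show "?D \<le> ?x" by simp
    then have "?D / 2 \<le> ?x / 2" by (rule divide_right_mono) simp
    then show "?D / 2 \<le> ?y" by simp
    show "0 < ?D" using c_gt a_pos by simp
  qed
  have "eta (1 / (1 - ?D)) + eta (1 / (1 - ?D / 2)) \<le> 
    (eta_low (1 / (1 - ?x)) + ((1 / (1 - ?x))\<^sup>2 - 1)) + (eta_low (1 / (1 - ?y)) + ((1 / (1 - ?y))\<^sup>2 - 1))"
  proof (intro add_mono eta_inverse_bounds D c)
    show "0 < ?D / 2" using D(1) by simp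
    show "?y < 1" using c by linarith
  qed
  also note e
  also have "2 * eta_low c \<le> 2 * eta c" using nod.eta_bounds(1) by simp
  finally show "eta (1 / (1 - ?D)) + eta (1 / (1 - ?D / 2)) < 2 * eta c" .
qed

text \<open>The sign of the volume decides the branch of \<open>choose_orientation\<close>, so
  positivity of the volume has to precede any statement about \<open>delaunay_torus\<close>.\<close>

lemma (in delaunay) delaunay_torus_eq:
  assumes "delaunay_params c = (a, y)" "0 \<le> enclosed_vol F"
  shows "delaunay_torus c = F"
proof -
  have "delaunay_profile c = curve"
    by (simp add: delaunay_profile_def assms(1) curve_def)
  then show ?thesis
    using assms(2) by (simp add: delaunay_torus_def constant_speed_curve choose_orientation_def)
qed

definition apar :: "real \<Rightarrow> real" where "apar c = fst (delaunay_params c)"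
definition ypar :: "real \<Rightarrow> real" where "ypar c = snd (delaunay_params c)"

lemma delaunay_params_system:
  assumes "delaunay_exists c"
  shows "delaunay_system c (apar c) (ypar c)"
proof -
  have "\<exists>z. case z of (a, y) \<Rightarrow> delaunay_system c a y" using assms by (auto simp: delaunay_exists_def)
  then have "case delaunay_params c of (a, y) \<Rightarrow> delaunay_system c a y"
    unfolding delaunay_params_def by (rule someI_ex)
  then show ?thesis by (simp add: apar_def ypar_def case_prod_unfold)
qed

text \<open>Carries the results for a single \<open>c\<close> out of the locale, with
  \<open>apar\<close> and \<open>ypar\<close> as functions of \<open>c\<close>, so that limits can
  be taken along the family.\<close>

definition admissible :: "real \<Rightarrow> bool" where
  "admissible c \<longleftrightarrow> delaunay_exists c \<and> embedded_C11_torus (delaunay_torus c) \<and> willmore (delaunay_torus c) < 8 * pi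
    \<and> delaunay (apar c) (ypar c) c \<and> 0 < enclosed_vol (delaunay_torus c)
    \<and> surface_area (delaunay_torus c) = 2 * pi * (apar c * J 1 (apar c) (ypar c) + J 1 1 c)
    \<and> enclosed_vol (delaunay_torus c) = pi / 2 * (J 3 1 c - J 3 (apar c) (ypar c)
        - ((apar c)\<^sup>2 - (ypar c)\<^sup>2) * J 1 (apar c) (ypar c) - (c\<^sup>2 - 1) * J 1 1 c)
    \<and> 1 - (eta_low c + (c\<^sup>2 - 1)) - sqrt (2 * (c - 1)) \<le> apar c"

lemma eventually_admissible: "\<forall>\<^sub>F c in at_right 1. admissible c"
proof -
  \<comment> \<open>This expression bounds \<open>apar c\<close> from below, so its limit
    \<open>1\<close> provides the threshold \<open>10 / 11\<close> required by the energy
    estimate.\<close>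
  have "((\<lambda>c. 1 - (eta_low c + (c\<^sup>2 - 1)) - sqrt (2 * (c - 1))) \<longlongrightarrow> 1 - 0 - 0) (at_right 1)"
    by (intro tendsto_intros eta_upper_tendsto sqrt_tendsto)
  then have 1: "\<forall>\<^sub>F c in at_right 1. 10 / 11 < 1 - (eta_low c + (c\<^sup>2 - 1)) - sqrt (2 * (c - 1))"
    by (rule order_tendstoD) simp
  \<comment> \<open>This second limit supplies the smallness condition of
    \<open>delaunay_system_exists\<close>.\<close>
  have "((\<lambda>c. 1 - (eta_low c + (c\<^sup>2 - 1)) - 2 * (c - 1)) \<longlongrightarrow> 1 - 0 - 2 * (1 - 1)) (at_right 1)"
    by (intro tendsto_intros eta_upper_tendsto)
  then have 2: "\<forall>\<^sub>F c in at_right 1. 0 < 1 - (eta_low c + (c\<^sup>2 - 1)) - 2 * (c - 1)"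
    by (rule order_tendstoD) simp
  have 3: "\<forall>\<^sub>F c in at_right (1 :: real). 1 < c \<and> c < 3 / 2"
    by (auto simp: eventually_at_right_field intro!: exI[of _ "3 / 2"])
  show ?thesis
    using 1 2 3 eta_low_large eta_upper_less
  proof eventually_elim
    case (elim c)
    have c: "1 < c" "c < 3 / 2" using elim(3) by auto
    interpret nod: nodoid c by unfold_locales fact
    have ex: "delaunay_exists c"
      unfolding delaunay_exists_def using elim(2) nod.eta_bounds(2) by (intro delaunay_system_exists c) linarith
    note sys = delaunay_params_system[OF ex]
    note bounds = delaunay_system_locale(2,3)[OF c(1) sys]
    interpret D: delaunay "apar c" "ypar c" c by (rule delaunay_system_locale(1)[OF c(1) sys])
    have low: "1 - (eta_low c + (c\<^sup>2 - 1)) - sqrt (2 * (c - 1)) \<le> apar c"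
      using bounds(2) nod.eta_bounds(2) by linarith
    have vol: "0 < enclosed_vol D.F"
      using elim(4) c nod.eta_bounds(1) bounds(1) by (intro D.vol_pos) linarith+
    have T: "delaunay_torus c = D.F"
      using vol by (intro D.delaunay_torus_eq) (auto simp: apar_def ypar_def)
    have "willmore D.F < 8 * pi"
    proof (rule D.willmore_less_of_estimates[OF _ _ elim(5)])
      show "10 / 11 < apar c" using elim(1) low by linarith
      show "11 / 10 * (c - 1) < 1" using c by simp
    qed
    then show ?case
      unfolding admissible_def T
      by (intro conjI ex D.embedded D.delaunay_axioms vol D.area_torus D.vol_torus low)
  qed
qed

theorem theorem1p1:
  shows "\<exists>\<gamma>\<^sub>0>1.
    (\<forall>c. 1 < c \<and> c < \<gamma>\<^sub>0 \<longrightarrow>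
       delaunay_exists c \<and>
       embedded_C11_torus (delaunay_torus c) \<and>
       willmore (delaunay_torus c) < 8 * pi) \<and>
    ((\<lambda>c. iso_ratio (delaunay_torus c)) \<longlongrightarrow> \<infinity>) (at_right 1)"
proof -
  let ?vol = "\<lambda>c. enclosed_vol (delaunay_torus c)" and ?area = "\<lambda>c. surface_area (delaunay_torus c)"
  have c_lim: "((\<lambda>c. c) \<longlongrightarrow> 1) (at_right (1 :: real))" by (rule tendsto_ident_at)
  have a_lim: "(apar \<longlongrightarrow> 1) (at_right 1)"
  proof (rule tendsto_sandwich)
    show "\<forall>\<^sub>F c in at_right 1. 1 - (eta_low c + (c\<^sup>2 - 1)) - sqrt (2 * (c - 1)) \<le> apar c"
      using eventually_admissible by eventually_elim (simp add: admissible_def)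
    show "\<forall>\<^sub>F c in at_right 1. apar c \<le> 1"
      using eventually_admissible by eventually_elim (auto simp: admissible_def dest!: delaunay.a_less)
    have "((\<lambda>c. 1 - (eta_low c + (c\<^sup>2 - 1)) - sqrt (2 * (c - 1))) \<longlongrightarrow> 1 - 0 - 0) (at_right 1)"
      by (intro tendsto_intros eta_upper_tendsto sqrt_tendsto)
    then show "((\<lambda>c. 1 - (eta_low c + (c\<^sup>2 - 1)) - sqrt (2 * (c - 1))) \<longlongrightarrow> 1) (at_right 1)" by simp
  qed simp
  have y_lim: "(ypar \<longlongrightarrow> 1) (at_right 1)"
  proof (rule Lim_transform_eventually)
    show "\<forall>\<^sub>F c in at_right 1. apar c - (c - 1) = ypar c"
      using eventually_admissible by eventually_elim (auto simp: admissible_def dest!: delaunay.eps)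
    show "((\<lambda>c. apar c - (c - 1)) \<longlongrightarrow> 1) (at_right 1)"
      using tendsto_diff[OF a_lim tendsto_diff[OF c_lim tendsto_const[of 1]]] by simp
  qed
  note lims = a_lim y_lim c_lim J_tendsto[OF a_lim y_lim] J_tendsto[OF tendsto_const c_lim]
  \<comment> \<open>The limit is the area of two spheres of radius \<open>2\<close>, each
    contributing \<open>2 * pi * J 1 1 1 = 16 * pi\<close>.\<close>
  have area_lim: "(?area \<longlongrightarrow> 32 * pi) (at_right 1)"
  proof (rule Lim_transform_eventually)
    show "\<forall>\<^sub>F c in at_right 1. 2 * pi * (apar c * J 1 (apar c) (ypar c) + J 1 1 c) = ?area c"
      using eventually_admissible by eventually_elim (simp add: admissible_def)
    have "((\<lambda>c. 2 * pi * (apar c * J 1 (apar c) (ypar c) + J 1 1 c)) \<longlongrightarrow> 2 * pi * (1 * J 1 1 1 + J 1 1 1)) (at_right 1)"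
      by (intro tendsto_intros lims)
    then show "((\<lambda>c. 2 * pi * (apar c * J 1 (apar c) (ypar c) + J 1 1 c)) \<longlongrightarrow> 32 * pi) (at_right 1)"
      by (simp add: J_1_1_1 del: One_nat_def)
  qed
  \<comment> \<open>Both arcs acquire the parameters \<open>(1, 1)\<close>: the third moments
    cancel, and the coefficients of the first moments vanish.\<close>
  have vol_lim: "(?vol \<longlongrightarrow> 0) (at_right 1)"
  proof (rule Lim_transform_eventually)
    let ?v = "\<lambda>c. pi / 2 * (J 3 1 c - J 3 (apar c) (ypar c)
        - ((apar c)\<^sup>2 - (ypar c)\<^sup>2) * J 1 (apar c) (ypar c) - (c\<^sup>2 - 1) * J 1 1 c)"
    show "\<forall>\<^sub>F c in at_right 1. ?v c = ?vol c"
      using eventually_admissible by eventually_elim (simp add: admissible_def)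
    have "(?v \<longlongrightarrow> pi / 2 * (J 3 1 1 - J 3 1 1 - (1\<^sup>2 - 1\<^sup>2) * J 1 1 1 - (1\<^sup>2 - 1) * J 1 1 1)) (at_right 1)"
      by (intro tendsto_intros lims)
    then show "(?v \<longlongrightarrow> 0) (at_right 1)" by simp
  qed
  have vol_pos: "\<forall>\<^sub>F c in at_right 1. 0 < ?vol c"
    using eventually_admissible by eventually_elim (simp add: admissible_def)
  \<comment> \<open>The area stays near a positive limit while the volume tends to \<open>0\<close>
    through positive values, so the finite branch of \<open>iso_ratio\<close> applies near
    \<open>1\<close> and diverges.\<close>
  have "filterlim (\<lambda>c. ?area c * inverse (?vol c powr (2 / 3))) at_top (at_right 1)"
  proof (rule filterlim_tendsto_pos_mult_at_top[OF area_lim])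
    show "filterlim (\<lambda>c. inverse (?vol c powr (2 / 3))) at_top (at_right 1)"
    proof (rule filterlim_inverse_at_top)
      show "((\<lambda>c. ?vol c powr (2 / 3)) \<longlongrightarrow> 0) (at_right 1)"
        using vol_pos by (intro tendsto_zero_powrI[OF vol_lim tendsto_const]) (auto elim: eventually_mono)
      show "\<forall>\<^sub>F c in at_right 1. 0 < ?vol c powr (2 / 3)"
        using vol_pos by eventually_elim simp
    qed
  qed simp
  then have "((\<lambda>c. ereal (?area c * inverse (?vol c powr (2 / 3)))) \<longlongrightarrow> \<infinity>) (at_right 1)"
    by (rule tendsto_PInfty_eq_at_top[THEN iffD2])
  moreover have "\<forall>\<^sub>F c in at_right 1. ereal (?area c * inverse (?vol c powr (2 / 3))) = iso_ratio (delaunay_torus c)"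
    using vol_pos by eventually_elim (simp only: iso_ratio_def divide_inverse if_True)
  ultimately have iso: "((\<lambda>c. iso_ratio (delaunay_torus c)) \<longlongrightarrow> \<infinity>) (at_right 1)"
    by (rule Lim_transform_eventually)
  obtain \<gamma>\<^sub>0 where "\<gamma>\<^sub>0 > 1" "\<And>c. 1 < c \<Longrightarrow> c < \<gamma>\<^sub>0 \<Longrightarrow> admissible c"
    using eventually_admissible unfolding eventually_at_right_field by blast
  moreover from this have "delaunay_exists c \<and> embedded_C11_torus (delaunay_torus c) \<and> willmore (delaunay_torus c) < 8 * pi"
    if "1 < c" "c < \<gamma>\<^sub>0" for c
    using that by (simp add: admissible_def)
  ultimately show ?thesis using iso by blast
qed

end
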